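(* Let $n\ge1$. The $\mathcal L_{\lambda,\boldsymbol z,y}$-module homomorphisms $$\mathrm{Stab}_{\mathrm{id}}:(\mathbb C^2)^{\otimes n}\otimes\mathcal L_{\lambda,\boldsymbol z,y}\to H^*_T(\mathcal X_n)\otimes\mathcal L_{\lambda,\boldsymbol z,y},\qquad v_I\mapsto\kappa_{\mathrm{id},I},$$ and $$\nu:H^*_T(\mathcal X_n)\otimes\mathcal L_{\lambda,\boldsymbol z,y}\to(\mathbb C^2)^{\otimes n}\otimes\mathcal L_{\lambda,\boldsymbol z,y},\qquad [f(\lambda,\Gamma,\boldsymbol z,y)]\mapsto\sum_{I\in\mathcal I_k}\frac{f(\lambda,\boldsymbol z_I,\boldsymbol z,y)}{R_I(\boldsymbol z)}\,\xi_I$$ for $[f(\lambda,\Gamma,\boldsymbol z,y)]\in H^*_T(T^*\mathrm{Gr}_k(\mathbb C^n))\otimes\mathcal L_{\lambda,\boldsymbol z,y}$, $0\le k\le n$, are inverse to each other.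
   Context: **Notation.** $[n]=\{1,\dots,n\}$; $\mathcal I_k$ is the set of $k$-element subsets of $[n]$; $\bar I=[n]\setminus I$; $\boldsymbol z=(z_1,\dots,z_n)$; $\lambda,y$ are further variables. $R_I(\boldsymbol z)=\prod_{a\in I,b\in\bar I}(z_a-z_b)$, $Q_I(\boldsymbol z,y)=\prod_{a\in I,b\in\bar I}(z_a-z_b+y)$. **Rings.** $\mathcal L_{\boldsymbol z,y}$: rational functions $f(\boldsymbol z,y)/\big(\prod_{i\ne j}(z_i-z_j)^{k_{ij}}\prod_{i,j}(z_i-z_j-y)^{l_{ij}}\big)$, $f$ a polynomial, $k_{ij},l_{ij}\in\mathbb Z_{\ge0}$. $\mathcal L_{\lambda,y}$: rational functions $f/g$, $f\in\mathbb C[\lambda,y]$, $g$ a finite product of factors $\lambda+ly$, $l\in\mathbb Z$. $\mathcal L_{\lambda,\boldsymbol z,y}=\mathcal L_{\lambda,y}\otimes_{\mathbb C[y]}\mathcal L_{\boldsymbol z,y}$. **Cohomology.** $T=(\mathbb C^\times)^n\times\mathbb C^\times$; the diagonal torus acts on $T^*\mathrm{Gr}_k(\mathbb C^n)$ via $\mathbb C^n$, the extra $\mathbb C^\times$ scales the fibers. With $\Gamma=\{\gamma_{1,1},\dots,\gamma_{1,k},\gamma_{2,1},\dots,\gamma_{2,n-k}\}$, $H^*_T(T^*\mathrm{Gr}_k(\mathbb C^n))=\mathbb C[\Gamma,\boldsymbol z,y]^{S_k\times S_{n-k}}$ modulo the coefficients in $u$ of $\prod_i(u-\gamma_{1,i})\prod_i(u-\gamma_{2,i})-\prod_i(u-z_i)$.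 Restriction to the fixed point $x_I$ ($I\in\mathcal I_k$) is the substitution $\{\gamma_{1,*}\}\mapsto\{z_a\}_{a\in I}$, $\{\gamma_{2,*}\}\mapsto\{z_a\}_{a\in\bar I}$, written $f(\lambda,\Gamma,\boldsymbol z,y)\mapsto f(\lambda,\boldsymbol z_I,\boldsymbol z,y)$; after tensoring over $\mathbb C[\boldsymbol z,y]$ with $\mathcal L_{\lambda,\boldsymbol z,y}$ the map to the direct sum over all fixed points is an isomorphism. $\mathcal X_n=\coprod_{k=0}^nT^*\mathrm{Gr}_k(\mathbb C^n)$. **Weight functions.** For $i\in I$ put $w(i,I)=\#\{j>i:j\in I\}-\#\{j>i:j\in\bar I\}$ ($j\in[n]$). For $I=\{i_1<\dots<i_k\}$ let $l_I(r,a)=t_r-z_a+y$ if $a<i_r$; $=\lambda+t_r-z_a-w(i_r,I)y$ if $a=i_r$; $=t_r-z_a$ if $a>i_r$. Let $W_I(\lambda,\boldsymbol t,\boldsymbol z,y)=y^k\sum_{\pi\in S_k}\Big(\prod_{r=1}^k\prod_{a=1}^n l_I(r,a)\prod_{1\le a<b\le k}\frac{t_a-t_b+y}{t_a-t_b}\Big)\Big|_{t_i\to t_{\pi(i)}}$ and $W_{\sigma,I}(\lambda,\boldsymbol t,\boldsymbol z,y)=W_{\sigma^{-1}(I)}(\lambda,\boldsymbol t,z_{\sigma(1)},\dots,z_{\sigma(n)},y)$. Let $e_k=\prod_{a,b=1}^k(t_a-t_b+y)$, $C^{(r)}_{\mathrm{id},I}=\prod_{i\in I}(\lambda-(w(i,I)+r)y)$,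 $\tilde W^+_I=W_I/(C^{(0)}_{\mathrm{id},I}C^{(1)}_{\mathrm{id},I}e_k)$, and $\tilde W^-_J(\lambda,\boldsymbol t,\boldsymbol z,y)=\frac{(-1)^k}{e_k}W_{s_0,J}(-\lambda-(n-2k)y,\boldsymbol t,\boldsymbol z,y)$ with $s_0(i)=n+1-i$. In these functions, $\boldsymbol z_J$ in place of $\boldsymbol t$ means substituting $\{z_j\}_{j\in J}$ for $t_1,\dots,t_k$. **Classes and vectors.** $\kappa_{\mathrm{id},I}\in H^*_T(T^*\mathrm{Gr}_k(\mathbb C^n))\otimes\mathcal L_{\lambda,\boldsymbol z,y}$ is the class with $\kappa_{\mathrm{id},I}|_{x_J}=\tilde W^+_I(\lambda,\boldsymbol z_J,\boldsymbol z,y)$ for all $J\in\mathcal I_k$. $\mathbb C^2$ has basis $v_1,v_2$; $v_I=v_{i_1}\otimes\dots\otimes v_{i_n}$ with $i_j=1$ if $j\in I$, $i_j=2$ otherwise. $\xi_I=\frac1{Q_I(\boldsymbol z,y)}\sum_{J\in\mathcal I_k}\tilde W^-_J(\lambda,\boldsymbol z_I,\boldsymbol z,y)\,v_J$ for $I\in\mathcal I_k$. *)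

theory Defs
  imports
    "HOL-Algebra.Module"
    "HOL-Algebra.QuotRing"
    "HOL-Algebra.Generated_Groups"
    "HOL-Algebra.Free_Abelian_Groups"
    "HOL-Combinatorics.Permutations"
    "HOL-Computational_Algebra.Polynomial_Factorial"
begin

section \<open>Polynomials and rational functions\<close>

text \<open>
  The variables \<open>\<lambda>\<close>, \<open>y\<close>, \<open>z\<^sub>i\<close>, \<open>\<gamma>\<^sub>1\<^sub>,\<^sub>i\<close>, \<open>\<gamma>\<^sub>2\<^sub>,\<^sub>i\<close>. The linear order below has no mathematical
  content: it is what the library needs to see that the polynomials form an integral domain.
\<close>

datatype var = VLam | VY | VZ nat | VG1 nat | VG2 nat

fun var_code :: "var \<Rightarrow> nat" where
  "var_code VLam = 0"
| "var_code VY = 1"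
| "var_code (VZ i) = 3 * i + 2"
| "var_code (VG1 i) = 3 * i + 3"
| "var_code (VG2 i) = 3 * i + 4"

lemma var_code_inject: "var_code a = var_code b \<longleftrightarrow> a = b"
  by (cases a; cases b; simp; presburger)

instantiation var :: linorder
begin

definition less_eq_var :: "var \<Rightarrow> var \<Rightarrow> bool"
  where "less_eq_var a b \<longleftrightarrow> var_code a \<le> var_code b"

definition less_var :: "var \<Rightarrow> var \<Rightarrow> bool"
  where "less_var a b \<longleftrightarrow> var_code a < var_code b"

instance
  by standard (auto simp: less_eq_var_def less_var_def var_code_inject)

end

text \<open>Polynomials with complex coefficients, and the field of rational functions.\<close>

type_synonym pol = "(var \<Rightarrow>\<^sub>0 nat) \<Rightarrow>\<^sub>0 complex"
type_synonym rat_fun = "pol fract"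

definition Const :: "complex \<Rightarrow> pol"
  where "Const c = Poly_Mapping.single 0 c"

definition Var :: "var \<Rightarrow> pol"
  where "Var v = Poly_Mapping.single (Poly_Mapping.single v 1) 1"

definition pols_in :: "var set \<Rightarrow> pol set"
  where "pols_in V = {p. \<forall>m \<in> Poly_Mapping.keys p. Poly_Mapping.keys m \<subseteq> V}"

definition subst :: "(var \<Rightarrow> pol) \<Rightarrow> pol \<Rightarrow> pol"
  where "subst \<sigma> p = (\<Sum>m \<in> Poly_Mapping.keys p.
     Const (Poly_Mapping.lookup p m) *
     (\<Prod>v \<in> Poly_Mapping.keys m. \<sigma> v ^ Poly_Mapping.lookup m v))"

abbreviation lam :: rat_fun where "lam \<equiv> to_fract (Var VLam)"
abbreviation yy :: rat_fun where "yy \<equiv> to_fract (Var VY)"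
abbreviation zz :: "nat \<Rightarrow> rat_fun" where "zz i \<equiv> to_fract (Var (VZ i))"

section \<open>The coefficient rings\<close>

definition L_zy :: "nat \<Rightarrow> rat_fun set"
  where "L_zy n = {to_fract f /
       ((\<Prod>(i, j) \<in> {(i, j) \<in> {1..n} \<times> {1..n}. i \<noteq> j}. (zz i - zz j) ^ k i j) *
        (\<Prod>(i, j) \<in> {1..n} \<times> {1..n}. (zz i - zz j - yy) ^ l i j)) | f k l.
     f \<in> pols_in (insert VY (VZ ` {1..n}))}"

definition L_lamy :: "rat_fun set"
  where "L_lamy = {to_fract f / (\<Prod>l\<leftarrow>ls. lam + of_int l * yy) | f ls.
     f \<in> pols_in {VLam, VY}}"

text \<open>
  The tensor product of these two localizations over \<open>\<complex>[y]\<close> is realized inside the field of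
  rational functions in \<open>\<lambda>, z, y\<close>, namely as the set of sums of products. (Both factors are
  localizations, of \<open>\<complex>[\<lambda>,y]\<close> and \<open>\<complex>[z,y]\<close>, so their tensor product is a localization of
  \<open>\<complex>[\<lambda>,z,y]\<close> and multiplication \<open>a \<otimes> b \<mapsto> a b\<close> is injective on it.)
\<close>

definition L_set :: "nat \<Rightarrow> rat_fun set"
  where "L_set n = {(\<Sum>i<m. a i * b i) | (m::nat) a b.
     (\<forall>i<m. a i \<in> L_lamy) \<and> (\<forall>i<m. b i \<in> L_zy n)}"

definition ring_on :: "'a::comm_ring_1 set \<Rightarrow> 'a ring"
  where "ring_on S = \<lparr>carrier = S, monoid.mult = (*), one = 1, ring.zero = 0, add = (+)\<rparr>"

definition Czy :: "nat \<Rightarrow> pol ring"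
  where "Czy n = ring_on (pols_in (insert VY (VZ ` {1..n})))"

text \<open>The ring \<open>L\<^sub>\<lambda>\<^sub>,\<^sub>z\<^sub>,\<^sub>y\<close> as an algebra over \<open>\<complex>[z,y]\<close>.\<close>

definition L :: "nat \<Rightarrow> (pol, rat_fun) module"
  where "L n = \<lparr>carrier = L_set n, monoid.mult = (*), one = 1, ring.zero = 0, add = (+),
     module.smult = (\<lambda>r c. to_fract r * c)\<rparr>"

section \<open>Extension of scalars\<close>

text \<open>
  For a commutative ring \<open>R\<close>, an \<open>R\<close>-module \<open>M\<close> and a commutative \<open>R\<close>-algebra \<open>A\<close>, the
  \<open>A\<close>-module \<open>M \<otimes>\<^sub>R A\<close> is the free abelian group on pairs \<open>(m, a)\<close> modulo the bilinearity
  relations, with \<open>c (m \<otimes> a) = m \<otimes> c a\<close>.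
\<close>

definition tensor_free ::
    "('m, 'k) ring_scheme \<Rightarrow> ('a, 'l) ring_scheme \<Rightarrow> (('m \<times> 'a) \<Rightarrow>\<^sub>0 int) monoid"
  where "tensor_free M A = free_Abelian_group (carrier M \<times> carrier A)"

definition tensor_rels ::
    "('r, 'k) ring_scheme \<Rightarrow> ('r, 'm) module \<Rightarrow> ('r, 'a) module \<Rightarrow> (('m \<times> 'a) \<Rightarrow>\<^sub>0 int) set"
  where "tensor_rels R M A =
     {frag_of (m \<oplus>\<^bsub>M\<^esub> m', a) - frag_of (m, a) - frag_of (m', a) | m m' a.
        m \<in> carrier M \<and> m' \<in> carrier M \<and> a \<in> carrier A}
   \<union> {frag_of (m, a \<oplus>\<^bsub>A\<^esub> a') - frag_of (m, a) - frag_of (m, a') | m a a'.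
        m \<in> carrier M \<and> a \<in> carrier A \<and> a' \<in> carrier A}
   \<union> {frag_of (r \<odot>\<^bsub>M\<^esub> m, a) - frag_of (m, r \<odot>\<^bsub>A\<^esub> a) | r m a.
        r \<in> carrier R \<and> m \<in> carrier M \<and> a \<in> carrier A}"

definition tensor_ker ::
    "('r, 'k) ring_scheme \<Rightarrow> ('r, 'm) module \<Rightarrow> ('r, 'a) module \<Rightarrow> (('m \<times> 'a) \<Rightarrow>\<^sub>0 int) set"
  where "tensor_ker R M A = generate (tensor_free M A) (tensor_rels R M A)"

definition tensor_class ::
    "('r, 'k) ring_scheme \<Rightarrow> ('r, 'm) module \<Rightarrow> ('r, 'a) module \<Rightarrow>
     (('m \<times> 'a) \<Rightarrow>\<^sub>0 int) \<Rightarrow> (('m \<times> 'a) \<Rightarrow>\<^sub>0 int) set"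
  where "tensor_class R M A x = tensor_ker R M A #>\<^bsub>tensor_free M A\<^esub> x"

text \<open>
  The map induced by \<open>f \<otimes> g\<close> into \<open>M' \<otimes>\<^sub>R A'\<close>; for linear \<open>f\<close> and \<open>g\<close> the union is over
  equal cosets.
\<close>

definition tensor_map ::
    "('r, 'k) ring_scheme \<Rightarrow> ('r, 'n) module \<Rightarrow> ('r, 'b) module \<Rightarrow> ('m \<Rightarrow> 'n) \<Rightarrow> ('a \<Rightarrow> 'b) \<Rightarrow>
     (('m \<times> 'a) \<Rightarrow>\<^sub>0 int) set \<Rightarrow> (('n \<times> 'b) \<Rightarrow>\<^sub>0 int) set"
  where "tensor_map R M' A' f g X =
     (\<Union>x\<in>X. tensor_class R M' A' (frag_extend (\<lambda>(m, a). frag_of (f m, g a)) x))"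

text \<open>
  The record type \<open>module\<close> extends rings; the two ring fields \<open>mult\<close> and \<open>one\<close> play no role for
  a module and are left undefined.
\<close>

definition tensor_ext ::
    "('r, 'k) ring_scheme \<Rightarrow> ('r, 'm) module \<Rightarrow> ('r, 'a) module \<Rightarrow>
     ('a, (('m \<times> 'a) \<Rightarrow>\<^sub>0 int) set) module"
  where "tensor_ext R M A =
     \<lparr>carrier = carrier (tensor_free M A Mod tensor_ker R M A),
      monoid.mult = undefined, one = undefined,
      ring.zero = one (tensor_free M A Mod tensor_ker R M A),
      add = monoid.mult (tensor_free M A Mod tensor_ker R M A),
      module.smult = (\<lambda>c. tensor_map R M A id (\<lambda>a. c \<otimes>\<^bsub>A\<^esub> a))\<rparr>"

definition linear_maps ::
    "('a, 'k) ring_scheme \<Rightarrow> ('a, 'm) module \<Rightarrow> ('a, 'n) module \<Rightarrow> ('m \<Rightarrow> 'n) set"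
  where "linear_maps R M N =
     {f \<in> carrier M \<rightarrow> carrier N.
        (\<forall>u\<in>carrier M. \<forall>v\<in>carrier M. f (u \<oplus>\<^bsub>M\<^esub> v) = f u \<oplus>\<^bsub>N\<^esub> f v) \<and>
        (\<forall>c\<in>carrier R. \<forall>u\<in>carrier M. f (c \<odot>\<^bsub>M\<^esub> u) = c \<odot>\<^bsub>N\<^esub> f u)}"

section \<open>Equivariant cohomology of the cotangent bundles of Grassmannians\<close>

definition subsets_of_card :: "nat \<Rightarrow> nat \<Rightarrow> nat set set"
  where "subsets_of_card n k = {I. I \<subseteq> {1..n} \<and> card I = k}"

text \<open>\<open>nth_elt I r\<close> is the \<open>r\<close>-th smallest element of \<open>I\<close>, counted from \<open>1\<close>.\<close>

definition nth_elt :: "nat set \<Rightarrow> nat \<Rightarrow> nat"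
  where "nth_elt I r = sorted_list_of_set I ! (r - 1)"

definition perm_vars :: "(nat \<Rightarrow> nat) \<Rightarrow> (nat \<Rightarrow> nat) \<Rightarrow> var \<Rightarrow> pol"
  where "perm_vars \<pi> \<rho> v =
     (case v of VG1 i \<Rightarrow> Var (VG1 (\<pi> i)) | VG2 i \<Rightarrow> Var (VG2 (\<rho> i)) | _ \<Rightarrow> Var v)"

text \<open>The invariants \<open>\<complex>[\<Gamma>,z,y]\<close> under \<open>S\<^sub>k \<times> S\<^sub>n\<^sub>-\<^sub>k\<close>.\<close>

definition invariants :: "nat \<Rightarrow> nat \<Rightarrow> pol set"
  where "invariants n k =
     {f \<in> pols_in (VG1 ` {1..k} \<union> VG2 ` {1..n - k} \<union> VZ ` {1..n} \<union> {VY}).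
        \<forall>\<pi> \<rho>. \<pi> permutes {1..k} \<longrightarrow> \<rho> permutes {1..n - k} \<longrightarrow> subst (perm_vars \<pi> \<rho>) f = f}"

definition coh_relation :: "nat \<Rightarrow> nat \<Rightarrow> pol poly"
  where "coh_relation n k =
     (\<Prod>i = 1..k. [:- Var (VG1 i), 1:]) * (\<Prod>i = 1..n - k. [:- Var (VG2 i), 1:])
     - (\<Prod>i = 1..n. [:- Var (VZ i), 1:])"

definition coh_ideal :: "nat \<Rightarrow> nat \<Rightarrow> pol set"
  where "coh_ideal n k =
     Idl\<^bsub>ring_on (invariants n k)\<^esub> {coeff (coh_relation n k) j | j. True}"

definition coh_class :: "nat \<Rightarrow> nat \<Rightarrow> pol \<Rightarrow> pol set"
  where "coh_class n k f = coh_ideal n k +>\<^bsub>ring_on (invariants n k)\<^esub> f"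

text \<open>\<open>HT n k\<close> is \<open>H\<^sub>T(T\<^sup>*Gr\<^sub>k(\<complex>\<^sup>n))\<close>, as an algebra over \<open>\<complex>[z,y]\<close>.\<close>

definition HT :: "nat \<Rightarrow> nat \<Rightarrow> (pol, pol set) module"
  where "HT n k = (let Q = ring_on (invariants n k) Quot coh_ideal n k in
     \<lparr>carrier = carrier Q, monoid.mult = monoid.mult Q, one = one Q, ring.zero = ring.zero Q, add = add Q,
      module.smult = (\<lambda>r h. coh_class n k r \<otimes>\<^bsub>Q\<^esub> h)\<rparr>)"

text \<open>\<open>HX n\<close> is \<open>H\<^sub>T(X\<^sub>n)\<close>, the direct sum of the \<open>HT n k\<close>, \<open>0 \<le> k \<le> n\<close>.\<close>

definition HX :: "nat \<Rightarrow> (pol, nat \<Rightarrow> pol set) module"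
  where "HX n =
     \<lparr>carrier = (\<Pi>\<^sub>E k\<in>{0..n}. carrier (HT n k)),
      monoid.mult = (\<lambda>g h. \<lambda>k\<in>{0..n}. g k \<otimes>\<^bsub>HT n k\<^esub> h k),
      one = (\<lambda>k\<in>{0..n}. \<one>\<^bsub>HT n k\<^esub>),
      ring.zero = (\<lambda>k\<in>{0..n}. \<zero>\<^bsub>HT n k\<^esub>),
      add = (\<lambda>g h. \<lambda>k\<in>{0..n}. g k \<oplus>\<^bsub>HT n k\<^esub> h k),
      module.smult = (\<lambda>r h. \<lambda>k\<in>{0..n}. r \<odot>\<^bsub>HT n k\<^esub> h k)\<rparr>"

definition HX_incl :: "nat \<Rightarrow> nat \<Rightarrow> pol set \<Rightarrow> nat \<Rightarrow> pol set"
  where "HX_incl n k h = (\<lambda>j\<in>{0..n}. if j = k then h else \<zero>\<^bsub>HT n j\<^esub>)"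

definition HTL :: "nat \<Rightarrow> nat \<Rightarrow> (rat_fun, ((pol set \<times> rat_fun) \<Rightarrow>\<^sub>0 int) set) module"
  where "HTL n k = tensor_ext (Czy n) (HT n k) (L n)"

definition HXL ::
    "nat \<Rightarrow> (rat_fun, (((nat \<Rightarrow> pol set) \<times> rat_fun) \<Rightarrow>\<^sub>0 int) set) module"
  where "HXL n = tensor_ext (Czy n) (HX n) (L n)"

text \<open>The inclusion of \<open>H\<^sub>T(T\<^sup>*Gr\<^sub>k) \<otimes> L\<close> into \<open>H\<^sub>T(X\<^sub>n) \<otimes> L\<close>, and simple tensors in the former.\<close>

definition HXL_incl ::
    "nat \<Rightarrow> nat \<Rightarrow> ((pol set \<times> rat_fun) \<Rightarrow>\<^sub>0 int) set \<Rightarrow>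
     (((nat \<Rightarrow> pol set) \<times> rat_fun) \<Rightarrow>\<^sub>0 int) set"
  where "HXL_incl n k = tensor_map (Czy n) (HX n) (L n) (HX_incl n k) id"

definition HTL_simple ::
    "nat \<Rightarrow> nat \<Rightarrow> pol set \<Rightarrow> rat_fun \<Rightarrow> ((pol set \<times> rat_fun) \<Rightarrow>\<^sub>0 int) set"
  where "HTL_simple n k h c = tensor_class (Czy n) (HT n k) (L n) (frag_of (h, c))"

section \<open>Restriction to fixed points\<close>

definition fp_vars :: "nat \<Rightarrow> nat set \<Rightarrow> var \<Rightarrow> pol"
  where "fp_vars n I v =
     (case v of VG1 i \<Rightarrow> Var (VZ (nth_elt I i))
      | VG2 i \<Rightarrow> Var (VZ (nth_elt ({1..n} - I) i))
      | _ \<Rightarrow> Var v)"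

text \<open>\<open>fp_pol n I f\<close> is \<open>f(z\<^sub>I, z, y)\<close>.\<close>

definition fp_pol :: "nat \<Rightarrow> nat set \<Rightarrow> pol \<Rightarrow> rat_fun"
  where "fp_pol n I f = to_fract (subst (fp_vars n I) f)"

definition fp_HT :: "nat \<Rightarrow> nat set \<Rightarrow> pol set \<Rightarrow> rat_fun"
  where "fp_HT n I h = the_elem (fp_pol n I ` h)"

text \<open>
  The restriction \<open>H\<^sub>T(X\<^sub>n) \<otimes> L \<rightarrow> L\<close> to the fixed point \<open>x\<^sub>I\<close>, which lies on the component
  of index \<open>card I\<close>; it sends \<open>h \<otimes> c\<close> to \<open>c\<close> times the restriction of that component of \<open>h\<close>.
\<close>

definition restr ::
    "nat \<Rightarrow> nat set \<Rightarrow> (((nat \<Rightarrow> pol set) \<times> rat_fun) \<Rightarrow>\<^sub>0 int) set \<Rightarrow> rat_fun"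
  where "restr n I X = the_elem ((\<lambda>x. \<Sum>(h, c) \<in> Poly_Mapping.keys x.
     of_int (Poly_Mapping.lookup x (h, c)) * c * fp_HT n I (h (card I))) ` X)"

section \<open>Weight functions\<close>

text \<open>
  All these functions are evaluated at elements \<open>lm\<close>, \<open>t i\<close>, \<open>z i\<close>, \<open>y\<close> of a field. They are
  only used with the \<open>t i\<close> specialized to distinct \<open>z\<^sub>j\<close> in the field of rational functions,
  where no denominator vanishes.
\<close>

definition wt :: "nat \<Rightarrow> nat \<Rightarrow> nat set \<Rightarrow> int"
  where "wt n i I = int (card {j. i < j \<and> j \<le> n \<and> j \<in> I}) - int (card {j. i < j \<and> j \<le> n \<and> j \<notin> I})"

definition l_fun ::
    "nat \<Rightarrow> nat set \<Rightarrow> 'a::field \<Rightarrow> (nat \<Rightarrow> 'a) \<Rightarrow> (nat \<Rightarrow> 'a) \<Rightarrow> 'a \<Rightarrow> nat \<Rightarrow> nat \<Rightarrow> 'a"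
  where "l_fun n I lm t z y r a =
     (let i = nth_elt I r in
      if a < i then t r - z a + y
      else if a = i then lm + t r - z a - of_int (wt n i I) * y
      else t r - z a)"

definition W_fun ::
    "nat \<Rightarrow> nat set \<Rightarrow> 'a::field \<Rightarrow> (nat \<Rightarrow> 'a) \<Rightarrow> (nat \<Rightarrow> 'a) \<Rightarrow> 'a \<Rightarrow> 'a"
  where "W_fun n I lm t z y =
     (let k = card I in
      y ^ k * (\<Sum>\<pi> | \<pi> permutes {1..k}.
        (\<Prod>r = 1..k. \<Prod>a = 1..n. l_fun n I lm (t \<circ> \<pi>) z y r a) *
        (\<Prod>(a, b) \<in> {(a, b) \<in> {1..k} \<times> {1..k}. a < b}.
           (t (\<pi> a) - t (\<pi> b) + y) / (t (\<pi> a) - t (\<pi> b)))))"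

definition W_perm ::
    "nat \<Rightarrow> (nat \<Rightarrow> nat) \<Rightarrow> nat set \<Rightarrow> 'a::field \<Rightarrow> (nat \<Rightarrow> 'a) \<Rightarrow> (nat \<Rightarrow> 'a) \<Rightarrow> 'a \<Rightarrow> 'a"
  where "W_perm n \<sigma> I lm t z y = W_fun n {i \<in> {1..n}. \<sigma> i \<in> I} lm t (z \<circ> \<sigma>) y"

definition e_fun :: "nat \<Rightarrow> (nat \<Rightarrow> 'a::field) \<Rightarrow> 'a \<Rightarrow> 'a"
  where "e_fun k t y = (\<Prod>a = 1..k. \<Prod>b = 1..k. t a - t b + y)"

definition C_fun :: "nat \<Rightarrow> int \<Rightarrow> nat set \<Rightarrow> 'a::field \<Rightarrow> 'a \<Rightarrow> 'a"
  where "C_fun n r I lm y = (\<Prod>i\<in>I. lm - of_int (wt n i I + r) * y)"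

definition W_plus ::
    "nat \<Rightarrow> nat set \<Rightarrow> 'a::field \<Rightarrow> (nat \<Rightarrow> 'a) \<Rightarrow> (nat \<Rightarrow> 'a) \<Rightarrow> 'a \<Rightarrow> 'a"
  where "W_plus n I lm t z y =
     W_fun n I lm t z y / (C_fun n 0 I lm y * C_fun n 1 I lm y * e_fun (card I) t y)"

definition W_minus ::
    "nat \<Rightarrow> nat set \<Rightarrow> 'a::field \<Rightarrow> (nat \<Rightarrow> 'a) \<Rightarrow> (nat \<Rightarrow> 'a) \<Rightarrow> 'a \<Rightarrow> 'a"
  where "W_minus n J lm t z y =
     (let k = card J in
      (- 1) ^ k / e_fun k t y *
      W_perm n (\<lambda>i. n + 1 - i) J (- lm - of_int (int n - 2 * int k) * y) t z y)"

text \<open>\<open>z_at J\<close> is the substitution of \<open>{z\<^sub>j}\<close>, \<open>j \<in> J\<close>, for \<open>t\<^sub>1, \<dots>, t\<^sub>k\<close>, in increasing order.\<close>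

definition z_at :: "nat set \<Rightarrow> nat \<Rightarrow> rat_fun"
  where "z_at J r = zz (nth_elt J r)"

definition R_fun :: "nat \<Rightarrow> nat set \<Rightarrow> rat_fun"
  where "R_fun n I = (\<Prod>a\<in>I. \<Prod>b\<in>{1..n} - I. zz a - zz b)"

definition Q_fun :: "nat \<Rightarrow> nat set \<Rightarrow> rat_fun"
  where "Q_fun n I = (\<Prod>a\<in>I. \<Prod>b\<in>{1..n} - I. zz a - zz b + yy)"

section \<open>Classes and vectors\<close>

definition kappa ::
    "nat \<Rightarrow> nat set \<Rightarrow> ((pol set \<times> rat_fun) \<Rightarrow>\<^sub>0 int) set"
  where "kappa n I = (THE X. X \<in> carrier (HTL n (card I)) \<and>
     (\<forall>J \<in> subsets_of_card n (card I).
        restr n J (HXL_incl n (card I) X) = W_plus n I lam (z_at J) zz yy))"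

text \<open>
  \<open>(\<complex>\<^sup>2)\<^sup>\<otimes>\<^sup>n \<otimes> L\<close> is realized as the free \<open>L\<close>-module of arrays of shape \<open>2 \<times> \<dots> \<times> 2\<close> with entries
  in \<open>L\<close>, indexed by the words in the letters \<open>1, 2\<close> of length \<open>n\<close>.
\<close>

definition words :: "nat \<Rightarrow> (nat \<Rightarrow> nat) set"
  where "words n = {1..n} \<rightarrow>\<^sub>E {1, 2}"

definition VL :: "nat \<Rightarrow> (rat_fun, (nat \<Rightarrow> nat) \<Rightarrow> rat_fun) module"
  where "VL n =
     \<lparr>carrier = words n \<rightarrow>\<^sub>E carrier (L n),
      monoid.mult = undefined, one = undefined,
      ring.zero = (\<lambda>w\<in>words n. 0),
      add = (\<lambda>u v. \<lambda>w\<in>words n. u w + v w),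
      module.smult = (\<lambda>c u. \<lambda>w\<in>words n. c * u w)\<rparr>"

definition basis_C2 :: "nat \<Rightarrow> nat \<Rightarrow> rat_fun"
  where "basis_C2 i = (\<lambda>j. if j = i then 1 else 0)"

definition pure_tensor :: "nat \<Rightarrow> (nat \<Rightarrow> nat \<Rightarrow> rat_fun) \<Rightarrow> (nat \<Rightarrow> nat) \<Rightarrow> rat_fun"
  where "pure_tensor n x = (\<lambda>w\<in>words n. \<Prod>j = 1..n. x j (w j))"

definition word_of :: "nat \<Rightarrow> nat set \<Rightarrow> nat \<Rightarrow> nat"
  where "word_of n I = (\<lambda>j\<in>{1..n}. if j \<in> I then 1 else 2)"

definition v_basis :: "nat \<Rightarrow> nat set \<Rightarrow> (nat \<Rightarrow> nat) \<Rightarrow> rat_fun"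
  where "v_basis n I = pure_tensor n (\<lambda>j. basis_C2 (word_of n I j))"

definition xi :: "nat \<Rightarrow> nat set \<Rightarrow> (nat \<Rightarrow> nat) \<Rightarrow> rat_fun"
  where "xi n I = (\<lambda>w\<in>words n. 1 / Q_fun n I *
     (\<Sum>J \<in> subsets_of_card n (card I). W_minus n J lam (z_at I) zz yy * v_basis n J w))"

section \<open>The two maps\<close>

text \<open>The \<open>L\<close>-linear extension of \<open>v\<^sub>I \<mapsto> \<kappa>\<^sub>I\<close>; the entry of \<open>u\<close> at \<open>word_of n I\<close> is the
  coefficient of \<open>v\<^sub>I\<close> in \<open>u\<close>.\<close>

definition Stab ::
    "nat \<Rightarrow> ((nat \<Rightarrow> nat) \<Rightarrow> rat_fun) \<Rightarrow> (((nat \<Rightarrow> pol set) \<times> rat_fun) \<Rightarrow>\<^sub>0 int) set"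
  where "Stab n u = (\<Oplus>\<^bsub>HXL n\<^esub>I \<in> Pow {1..n}.
     u (word_of n I) \<odot>\<^bsub>HXL n\<^esub> HXL_incl n (card I) (kappa n I))"

definition nu ::
    "nat \<Rightarrow> (((nat \<Rightarrow> pol set) \<times> rat_fun) \<Rightarrow>\<^sub>0 int) set \<Rightarrow> (nat \<Rightarrow> nat) \<Rightarrow> rat_fun"
  where "nu n X = (\<lambda>w\<in>words n.
     \<Sum>k = 0..n. \<Sum>I \<in> subsets_of_card n k. restr n I X / R_fun n I * xi n I w)"

end

theory Submission
  imports
    "Jordan_Normal_Form.Determinant"
    Defs
begin

text \<open>
  Restriction to the fixed points turns both maps into matrices: over \<open>L\<close> a cohomology class is
  the same as the family of its restrictions, because up to a power of the discriminant of \<open>z\<close>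
  the Lagrange interpolation idempotents at the points \<open>\<gamma> i = z (s i)\<close> decompose \<open>1\<close> in the
  cohomology ring. The theorem thus says that the matrices of \<open>W\<^sup>+\<close> and \<open>W\<^sup>-\<close> are inverse to each
  other for the pairing with weights \<open>1 / (R Q)\<close>.

  Exchanging \<open>z a\<close> and \<open>z (a + 1)\<close> expresses the weight function of the transposed subset through
  that of the original one, with coefficients given by the dynamical \<open>R\<close>-matrix. Applied to both
  factors of the pairing, these exchange relations carry biorthogonality from a subset \<open>K\<close> to
  \<open>s\<^sub>a K\<close>, simultaneously for all orderings of \<open>z\<close>. The starting point \<open>K = {1..k}\<close> is settled by
  triangularity, which leaves a single fixed point in the sum.
\<close>

section \<open>Weight functions as sums over bijections\<close>

text \<open>The obstacle is that an exchange relation changes the ordering of the points in only one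
  factor of the pairing, so it produces mixed pairings whose two factors carry the orderings
  \<open>z \<circ> s\<close> and \<open>z\<close>. Biorthogonality says nothing about those. They
  are found by writing the opposite exchange relation for the second factor twice, once for each
  ordering; together with the unmixed values this is a triangular linear system with nonzero pivots.
  For this to make sense the summation runs over sets of values instead of sets of indices, and the
  variables of a weight function are labelled by the elements of \<open>K\<close>, not by their
  ranks. On the cohomological side the Lagrange idempotents are not symmetric in the \<gamma>, so
  the interpolation takes place in the full polynomial ring and is brought back to the invariants by
  averaging over S_k \<times> S_(n-k), dividing by the order of the group. The exchange argument
  gives one of the two compositions; the other follows because a one-sided inverse of a finite
  square matrix is two-sided.\<close>

definition bijs :: "nat set \<Rightarrow> 'a set \<Rightarrow> (nat \<Rightarrow> 'a) set"
  where "bijs K U = {\<phi> \<in> extensional K. bij_betw \<phi> K U}"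

text \<open>This is \<open>l_fun\<close> with the rank \<open>r\<close> replaced by the element
  \<open>i\<close> of \<open>K\<close>. Labelling by elements lets a transposition of sites act on a
  term without renumbering the variables.\<close>

definition site_factor ::
    "nat \<Rightarrow> nat set \<Rightarrow> 'a::field \<Rightarrow> (nat \<Rightarrow> 'a) \<Rightarrow> 'a \<Rightarrow> nat \<Rightarrow> nat \<Rightarrow> 'a \<Rightarrow> 'a"
  where "site_factor n K lm z y i a x =
     (if a < i then x - z a + y
      else if a = i then lm + x - z a - of_int (wt n i K) * y
      else x - z a)"

definition pair_factor :: "'a::field \<Rightarrow> nat set \<Rightarrow> (nat \<Rightarrow> 'a) \<Rightarrow> 'a"
  where "pair_factor y K \<phi> =
     (\<Prod>(i, j) \<in> {(i, j) \<in> K \<times> K. i < j}. (\<phi> i - \<phi> j + y) / (\<phi> i - \<phi> j))"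

definition weight_term ::
    "nat \<Rightarrow> 'a::field \<Rightarrow> (nat \<Rightarrow> 'a) \<Rightarrow> 'a \<Rightarrow> nat set \<Rightarrow> (nat \<Rightarrow> 'a) \<Rightarrow> 'a"
  where "weight_term n lm z y K \<phi> =
     (\<Prod>i\<in>K. \<Prod>a = 1..n. site_factor n K lm z y i a (\<phi> i)) * pair_factor y K \<phi>"

definition weight_sum ::
    "nat \<Rightarrow> 'a::field \<Rightarrow> (nat \<Rightarrow> 'a) \<Rightarrow> 'a \<Rightarrow> nat set \<Rightarrow> 'a set \<Rightarrow> 'a"
  where "weight_sum n lm z y K U = (\<Sum>\<phi>\<in>bijs K U. weight_term n lm z y K \<phi>)"

lemma nth_elt_bij:
  assumes "finite K" "card K = k"
  shows "bij_betw (nth_elt K) {1..k} K"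
proof -
  have "bij_betw ((!) (sorted_list_of_set K)) {..<length (sorted_list_of_set K)} (set (sorted_list_of_set K))"
    by (rule bij_betw_nth) auto
  moreover have "bij_betw (\<lambda>r. r - 1) {1..card K} {..<card K}"
    by (rule bij_betwI[where g = Suc]) auto
  ultimately have "bij_betw ((!) (sorted_list_of_set K) \<circ> (\<lambda>r. r - 1)) {1..card K} K"
    using assms by (auto intro: bij_betw_trans)
  then show ?thesis
    using assms(2) by (simp add: nth_elt_def[abs_def] comp_def)
qed

lemma nth_elt_less_iff:
  assumes "finite K" "r \<in> {1..card K}" "s \<in> {1..card K}"
  shows "nth_elt K r < nth_elt K s \<longleftrightarrow> r < s"
proof -
  have mono: "nth_elt K r < nth_elt K s" if "r < s" "r \<in> {1..card K}" "s \<in> {1..card K}" for r s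
    unfolding nth_elt_def using that assms(1)
    by (intro sorted_wrt_nth_less[OF strict_sorted_list_of_set]) auto
  show ?thesis
    using mono[of r s] mono[of s r] assms by (cases r s rule: linorder_cases) auto
qed

text \<open>Each permutation \<open>\<pi>\<close> corresponds to the bijection that sends the
  element of rank \<open>r\<close> to \<open>t (\<pi> r)\<close>; injectivity of \<open>t\<close>
  makes the correspondence one-to-one. The right-hand side sees \<open>t\<close> only through its
  set of values, so the symmetry in \<open>t\<close> is built in.\<close>

lemma W_fun_eq_weight_sum:
  fixes t z :: "nat \<Rightarrow> 'a::field"
  assumes K: "finite K" and t: "inj_on t {1..card K}"
  shows "W_fun n K lm t z y = y ^ card K * weight_sum n lm z y K (t ` {1..card K})"
proof -
  define k where "k = card K"
  define e where "e = nth_elt K"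
  define rk where "rk = inv_into {1..k} e"
  have e: "bij_betw e {1..k} K"
    using nth_elt_bij[OF K refl] by (simp add: e_def k_def)
  have rk: "bij_betw rk K {1..k}"
    unfolding rk_def by (rule bij_betw_inv_into[OF e])
  have rk_e: "rk (e r) = r" if "r \<in> {1..k}" for r
    using e that unfolding rk_def by (meson bij_betw_inv_into_left)
  have e_rk: "e (rk i) = i" if "i \<in> K" for i
    using e that unfolding rk_def by (meson bij_betw_inv_into_right)
  have e_in: "e r \<in> K" if "r \<in> {1..k}" for r
    using e that by (auto simp: bij_betw_def)
  have rk_in: "rk i \<in> {1..k}" if "i \<in> K" for i
    using rk that bij_betwE by blast
  have tb: "bij_betw t {1..k} (t ` {1..k})"
    using t by (simp add: k_def bij_betw_def)
  define ti where "ti = inv_into {1..k} t"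
  have ti_t: "ti (t r) = r" if "r \<in> {1..k}" for r
    using tb that unfolding ti_def by (meson bij_betw_inv_into_left)
  have t_ti: "t (ti u) = u" if "u \<in> t ` {1..k}" for u
    using tb that unfolding ti_def by (meson bij_betw_inv_into_right)
  have "weight_sum n lm z y K (t ` {1..k}) =
    (\<Sum>\<pi> | \<pi> permutes {1..k}. weight_term n lm z y K (\<lambda>i\<in>K. t (\<pi> (rk i))))"
    unfolding weight_sum_def
  proof (rule sum.reindex_bij_witness[of _ "\<lambda>\<pi>. \<lambda>i\<in>K. t (\<pi> (rk i))"
        "\<lambda>\<phi> r. if r \<in> {1..k} then ti (\<phi> (e r)) else r"], goal_cases)
    case (1 \<phi>)
    then have \<phi>: "\<phi> \<in> extensional K" "bij_betw \<phi> K (t ` {1..k})"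
      by (auto simp: bijs_def)
    have "\<phi> i \<in> t ` {1..k}" if "i \<in> K" for i
      using \<phi> that bij_betwE by blast
    then show ?case
      using \<phi>(1) rk_in e_rk t_ti by (fastforce simp: extensional_def)
  next
    case (2 \<phi>)
    then have \<phi>: "bij_betw \<phi> K (t ` {1..k})"
      by (auto simp: bijs_def)
    have "bij_betw ti (t ` {1..k}) {1..k}"
      unfolding ti_def by (rule bij_betw_inv_into[OF tb])
    then have "bij_betw (ti \<circ> (\<phi> \<circ> e)) {1..k} {1..k}"
      using \<phi> e by (auto intro: bij_betw_trans)
    then have "bij_betw (\<lambda>r. if r \<in> {1..k} then ti (\<phi> (e r)) else r) {1..k} {1..k}"
      by (rule bij_betw_cong[THEN iffD1, rotated]) auto
    then have "(\<lambda>r. if r \<in> {1..k} then ti (\<phi> (e r)) else r) permutes {1..k}"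
      by (rule bij_imp_permutes) auto
    then show ?case by simp
  next
    case (3 \<pi>)
    then have \<pi>: "\<pi> permutes {1..k}" by simp
    show ?case
    proof
      fix r
      show "(if r \<in> {1..k} then ti ((\<lambda>i\<in>K. t (\<pi> (rk i))) (e r)) else r) = \<pi> r"
      proof (cases "r \<in> {1..k}")
        case True
        then show ?thesis
          using \<pi> e_in rk_e ti_t permutes_in_image[OF \<pi>] by simp
      qed (use \<pi> in \<open>auto simp: permutes_def\<close>)
    qed
  next
    case (4 \<pi>)
    then have \<pi>: "bij_betw \<pi> {1..k} {1..k}" by (simp add: permutes_imp_bij)
    have "bij_betw (t \<circ> (\<pi> \<circ> rk)) K (t ` {1..k})"
      using \<pi> rk tb by (auto intro: bij_betw_trans)
    then have "bij_betw (\<lambda>i\<in>K. t (\<pi> (rk i))) K (t ` {1..k})"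
      by (rule bij_betw_cong[THEN iffD1, rotated]) auto
    then show ?case by (auto simp: bijs_def)
  next
    case (5 \<phi>)
    then have \<phi>: "\<phi> \<in> extensional K" "bij_betw \<phi> K (t ` {1..k})"
      by (auto simp: bijs_def)
    have "\<phi> i \<in> t ` {1..k}" if "i \<in> K" for i
      using \<phi> that bij_betwE by blast
    then have "(\<lambda>i\<in>K. t (if rk i \<in> {1..k} then ti (\<phi> (e (rk i))) else rk i)) = \<phi>"
      using \<phi>(1) rk_in e_rk t_ti by (fastforce simp: extensional_def)
    then show ?case by simp
  qed
  also have "\<dots> = (\<Sum>\<pi> | \<pi> permutes {1..k}.
        (\<Prod>r = 1..k. \<Prod>a = 1..n. l_fun n K lm (t \<circ> \<pi>) z y r a) *
        (\<Prod>(a, b) \<in> {(a, b) \<in> {1..k} \<times> {1..k}. a < b}.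
           (t (\<pi> a) - t (\<pi> b) + y) / (t (\<pi> a) - t (\<pi> b))))"
  proof (rule sum.cong[OF refl])
    fix \<pi> assume "\<pi> \<in> {\<pi>. \<pi> permutes {1..k}}"
    define \<phi> where "\<phi> = (\<lambda>i\<in>K. t (\<pi> (rk i)))"
    have \<phi>_e: "\<phi> (e r) = t (\<pi> r)" if "r \<in> {1..k}" for r
      using that e_in rk_e by (simp add: \<phi>_def)
    have 1: "(\<Prod>i\<in>K. \<Prod>a = 1..n. site_factor n K lm z y i a (\<phi> i)) =
      (\<Prod>r = 1..k. \<Prod>a = 1..n. l_fun n K lm (t \<circ> \<pi>) z y r a)"
      unfolding prod.reindex_bij_betw[OF e, symmetric]
      by (intro prod.cong refl) (simp add: \<phi>_e site_factor_def l_fun_def Let_def flip: e_def)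
    have 2: "pair_factor y K \<phi> = (\<Prod>(a, b) \<in> {(a, b) \<in> {1..k} \<times> {1..k}. a < b}.
           (t (\<pi> a) - t (\<pi> b) + y) / (t (\<pi> a) - t (\<pi> b)))"
      unfolding pair_factor_def
    proof (rule prod.reindex_bij_witness[of _ "\<lambda>(r, s). (e r, e s)" "\<lambda>(i, j). (rk i, rk j)"], goal_cases)
      case (2 p)
      then obtain i j where p: "p = (i, j)" "i \<in> K" "j \<in> K" "i < j" by auto
      then have "e (rk i) < e (rk j)" by (simp add: e_rk)
      then show ?case
        using p rk_in nth_elt_less_iff[OF K] unfolding e_def k_def by auto
    next
      case (4 p)
      then show ?case
        using e_in nth_elt_less_iff[OF K] unfolding e_def k_def by auto
    qed (use e_rk rk_e rk_in \<phi>_e in \<open>auto simp: \<phi>_def\<close>)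
    show "weight_term n lm z y K (\<lambda>i\<in>K. t (\<pi> (rk i))) =
        (\<Prod>r = 1..k. \<Prod>a = 1..n. l_fun n K lm (t \<circ> \<pi>) z y r a) *
        (\<Prod>(a, b) \<in> {(a, b) \<in> {1..k} \<times> {1..k}. a < b}.
           (t (\<pi> a) - t (\<pi> b) + y) / (t (\<pi> a) - t (\<pi> b)))"
      using 1 2 by (simp add: weight_term_def \<phi>_def)
  qed
  finally show ?thesis
    by (simp add: W_fun_def Let_def k_def)
qed

lemma weight_sum_cong:
  assumes "\<And>a. a \<in> {1..n} \<Longrightarrow> z a = z' a"
  shows "weight_sum n lm z y K U = weight_sum n lm z' y K U"
  unfolding weight_sum_def weight_term_def site_factor_def
  using assms by (intro sum.cong prod.cong arg_cong2[where f = "(*)"] refl) auto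

section \<open>Exchange relations under adjacent transpositions\<close>

lemma wt_eq_sum: "wt n i K = (\<Sum>j\<in>{i<..n}. if j \<in> K then 1 else - 1)"
proof -
  have "(\<Sum>j\<in>{i<..n}. if j \<in> K then 1 else - 1 :: int) =
    (\<Sum>j\<in>{i<..n} \<inter> {j. j \<in> K}. 1) + (\<Sum>j\<in>{i<..n} \<inter> - {j. j \<in> K}. - 1)"
    by (rule sum.If_cases) simp
  also have "{i<..n} \<inter> {j. j \<in> K} = {j. i < j \<and> j \<le> n \<and> j \<in> K}" by auto
  also have "{i<..n} \<inter> - {j. j \<in> K} = {j. i < j \<and> j \<le> n \<and> j \<notin> K}" by auto
  finally show ?thesis by (simp add: wt_def)
qed

lemma greaterThanAtMost_split: "a < (n::nat) \<Longrightarrow> {a<..n} = insert (Suc a) {Suc a<..n}"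
  by auto

lemma wt_step:
  assumes "a < n"
  shows "wt n a K = wt n (Suc a) K + (if Suc a \<in> K then 1 else - 1)"
  using assms by (simp add: wt_eq_sum greaterThanAtMost_split)

lemma transpose_image_mem: "x \<in> transpose a b ` K \<longleftrightarrow> transpose a b x \<in> K"
  by (metis image_iff transpose_involutory)

lemma transpose_Suc_bij:
  "a \<in> {1..n} \<Longrightarrow> Suc a \<in> {1..n} \<Longrightarrow> bij_betw (transpose a (Suc a)) {1..n} {1..n}"
  by (intro permutes_imp_bij permutes_swap_id)

text \<open>The sites \<open>a\<close> and \<open>Suc a\<close> lie either both above
  \<open>i\<close>, where the swap only permutes the terms of the signed count, or both below it,
  where they are not counted.\<close>

lemma wt_transpose:
  assumes "Suc a \<le> n" "i \<noteq> a" "i \<noteq> Suc a"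
  shows "wt n i (transpose a (Suc a) ` K) = wt n i K"
proof (cases "i < a")
  case True
  then have "transpose a (Suc a) permutes {i<..n}"
    using assms by (intro permutes_swap_id) auto
  then show ?thesis
    unfolding wt_eq_sum transpose_image_mem
    by (intro sum.reindex_bij_betw[OF permutes_imp_bij])
next
  case False
  then show ?thesis
    using assms unfolding wt_eq_sum transpose_image_mem
    by (intro sum.cong refl) (auto simp: transpose_def)
qed

text \<open>Seen from \<open>i\<close> the two swapped sites lie on the same side, so their factors
  have the same shape and swapping their points only reorders the product.\<close>

lemma site_prod_transpose:
  assumes a: "a \<in> {1..n}" "Suc a \<in> {1..n}" and i: "i \<noteq> a" "i \<noteq> Suc a"
    and wt: "wt n i K' = wt n i K"
  shows "(\<Prod>b = 1..n. site_factor n K' lm (z \<circ> transpose a (Suc a)) y i b x) =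
    (\<Prod>b = 1..n. site_factor n K lm z y i b x)"
proof -
  have "(\<Prod>b = 1..n. site_factor n K' lm (z \<circ> transpose a (Suc a)) y i b x) =
    (\<Prod>b = 1..n. site_factor n K' lm (z \<circ> transpose a (Suc a)) y i (transpose a (Suc a) b) x)"
    by (rule prod.reindex_bij_betw[OF transpose_Suc_bij[OF a], symmetric])
  also have "\<dots> = (\<Prod>b = 1..n. site_factor n K lm z y i b x)"
    using i by (intro prod.cong refl) (auto simp: site_factor_def wt transpose_def)
  finally show ?thesis .
qed

text \<open>Away from the two sites the factors are the same for \<open>i = a\<close> and
  \<open>i = Suc a\<close>. This outer product is common to all the terms compared below, which
  reduces the exchange relations to two sites.\<close>

lemma site_prod_split:
  assumes a: "a \<in> {1..n}" "Suc a \<in> {1..n}" and i: "i = a \<or> i = Suc a"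
  shows "(\<Prod>b = 1..n. site_factor n K lm z y i b x) =
    (\<Prod>b\<in>{1..n} - {a, Suc a}. if b < a then x - z b + y else x - z b) *
    (site_factor n K lm z y i a x * site_factor n K lm z y i (Suc a) x)"
proof -
  have "{1..n} = insert a (insert (Suc a) ({1..n} - {a, Suc a}))"
    using a by auto
  then have "(\<Prod>b = 1..n. site_factor n K lm z y i b x) =
    (\<Prod>b\<in>insert a (insert (Suc a) ({1..n} - {a, Suc a})). site_factor n K lm z y i b x)"
    by simp
  also have "\<dots> = site_factor n K lm z y i a x * (site_factor n K lm z y i (Suc a) x *
     (\<Prod>b\<in>{1..n} - {a, Suc a}. site_factor n K lm z y i b x))"
    by (subst prod.insert, auto)+
  also have "(\<Prod>b\<in>{1..n} - {a, Suc a}. site_factor n K lm z y i b x) =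
    (\<Prod>b\<in>{1..n} - {a, Suc a}. if b < a then x - z b + y else x - z b)"
    using i by (intro prod.cong refl) (auto simp: site_factor_def)
  finally show ?thesis by (simp add: algebra_simps)
qed

lemma outer_prod_transpose:
  assumes a: "a \<in> {1..n}" "Suc a \<in> {1..n}"
  shows "(\<Prod>b\<in>{1..n} - {a, Suc a}. if b < a then x - (z \<circ> transpose a (Suc a)) b + y
      else x - (z \<circ> transpose a (Suc a)) b) =
    (\<Prod>b\<in>{1..n} - {a, Suc a}. if b < a then x - z b + y else x - z b)"
  by (intro prod.cong refl) (auto simp: transpose_def)

lemma weight_sum_transpose_neither:
  assumes a: "a \<in> {1..n}" "Suc a \<in> {1..n}" and "a \<notin> K" "Suc a \<notin> K"
  shows "weight_sum n lm (z \<circ> transpose a (Suc a)) y K U = weight_sum n lm z y K U"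
  unfolding weight_sum_def weight_term_def
  using assms by (intro sum.cong arg_cong2[where f = "(*)"] prod.cong refl site_prod_transpose) auto

lemma transpose_less_iff:
  assumes "i \<noteq> j" "{i, j} \<noteq> {a, Suc a}"
  shows "transpose a (Suc a) i < transpose a (Suc a) j \<longleftrightarrow> i < j"
  using assms by (auto simp: transpose_def doubleton_eq_iff)

lemma bijs_transpose:
  assumes \<phi>: "\<phi> \<in> bijs (transpose a b ` K) U"
  shows "(\<lambda>i\<in>K. \<phi> (transpose a b i)) \<in> bijs K U"
proof -
  have "bij_betw (transpose a b) K (transpose a b ` K)"
    by (intro inj_on_imp_bij_betw inj_onI) (metis transpose_involutory)
  then have "bij_betw (\<phi> \<circ> transpose a b) K U"
    using \<phi> by (auto simp: bijs_def intro: bij_betw_trans)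
  then have "bij_betw (\<lambda>i\<in>K. \<phi> (transpose a b i)) K U"
    by (rule bij_betw_cong[THEN iffD1, rotated]) auto
  then show ?thesis by (auto simp: bijs_def)
qed

lemma sum_bijs_transpose:
  "(\<Sum>\<phi>\<in>bijs (transpose a b ` K) U. f \<phi>) =
   (\<Sum>\<phi>\<in>bijs K U. f (\<lambda>i\<in>transpose a b ` K. \<phi> (transpose a b i)))"
proof (rule sum.reindex_bij_witness[of _ "\<lambda>\<phi>. \<lambda>i\<in>transpose a b ` K. \<phi> (transpose a b i)"
      "\<lambda>\<phi>. \<lambda>i\<in>K. \<phi> (transpose a b i)"], goal_cases)
  case (1 \<phi>)
  then show ?case by (auto simp: bijs_def extensional_def transpose_image_mem)
next
  case (2 \<phi>) then show ?case by (rule bijs_transpose)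
next
  case (3 \<phi>)
  then show ?case by (fastforce simp: bijs_def extensional_def)
next
  case (4 \<phi>)
  have "transpose a b ` transpose a b ` K = K"
    by (simp add: image_image)
  with 4 show ?case using bijs_transpose[of \<phi> a b "transpose a b ` K" U] by simp
next
  case (5 \<phi>)
  have "(\<lambda>i\<in>transpose a b ` K. (\<lambda>i\<in>K. \<phi> (transpose a b i)) (transpose a b i)) = \<phi>"
    using 5 by (auto simp: bijs_def extensional_def transpose_image_mem)
  then show ?case by simp
qed

text \<open>An adjacent transposition reverses the order of the pair \<open>a\<close>,
  \<open>Suc a\<close> only, and the hypothesis says that this is not a pair of elements of
  \<open>K\<close>.\<close>

lemma pair_factor_transpose:
  assumes "\<not> (a \<in> K \<and> Suc a \<in> K)"
  shows "pair_factor y (transpose a (Suc a) ` K) (\<lambda>i\<in>transpose a (Suc a) ` K. \<phi> (transpose a (Suc a) i))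
    = pair_factor y K \<phi>"
  unfolding pair_factor_def
proof (rule prod.reindex_bij_witness[of _ "\<lambda>(i, j). (transpose a (Suc a) i, transpose a (Suc a) j)"
      "\<lambda>(i, j). (transpose a (Suc a) i, transpose a (Suc a) j)"], goal_cases)
  case (2 p)
  then obtain i j where p: "p = (i, j)" "transpose a (Suc a) i \<in> K" "transpose a (Suc a) j \<in> K" "i < j"
    by (auto simp: transpose_image_mem)
  moreover from p have "{i, j} \<noteq> {a, Suc a}"
    using assms by (auto simp: doubleton_eq_iff)
  ultimately show ?case
    by (simp add: transpose_less_iff)
next
  case (4 p)
  then obtain i j where p: "p = (i, j)" "i \<in> K" "j \<in> K" "i < j"
    by auto
  moreover from p have "{i, j} \<noteq> {a, Suc a}"
    using assms by (auto simp: doubleton_eq_iff)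
  ultimately show ?case
    by (simp add: transpose_less_iff)
qed (auto simp: transpose_image_mem)

text \<open>The case of one variable and two sites. Both sides are quadratic in \<open>x\<close>:
  putting \<open>x = u\<close> kills the last product and dictates the coefficient
  \<open>y * (u - v + \<mu> - y)\<close>, putting \<open>x = v\<close> dictates the other one, and
  the leading coefficients agree. Up to normalization these are entries of the dynamical
  R-matrix.\<close>

lemma exchange_identity:
  fixes \<mu> :: "'a::field"
  shows "\<mu> * (u - v) * ((x - u + y) * (\<mu> - y + x - v)) =
    y * (u - v + \<mu> - y) * ((\<mu> + x - u) * (x - v)) +
    (\<mu> - y) * (u - v - y) * ((\<mu> + x - v) * (x - u))"
  by (simp add: algebra_simps)

text \<open>The relation holds already for each single bijection, transported along the swap: the
  factors of the other elements, the outer product and the pair factor are common to the three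
  terms, and what remains is \<open>exchange_identity\<close>.\<close>

lemma weight_sum_exchange:
  fixes z :: "nat \<Rightarrow> 'a::field" and lm y :: 'a
  assumes a: "a \<in> {1..n}" "Suc a \<in> {1..n}" and K: "finite K" "a \<in> K" "Suc a \<notin> K"
  defines "s \<equiv> transpose a (Suc a)"
  defines "d \<equiv> z a - z (Suc a)" and "\<mu> \<equiv> lm - of_int (wt n a K) * y"
  shows "\<mu> * d * weight_sum n lm z y (s ` K) U =
    y * (d + \<mu> - y) * weight_sum n lm z y K U +
    (\<mu> - y) * (d - y) * weight_sum n lm (z \<circ> s) y K U"
proof -
  define L where "L = K - {a}"
  have KL: "K = insert a L" "a \<notin> L" "Suc a \<notin> L" "finite L"
    using K by (auto simp: L_def)
  have sL: "s ` L = L"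
    using KL unfolding s_def by (force simp: transpose_def image_iff)
  have sK: "s ` K = insert (Suc a) L"
    using sL by (simp add: KL(1) s_def)
  have wtL: "wt n i (s ` K) = wt n i K" if "i \<in> L" for i
    unfolding s_def using that KL a by (intro wt_transpose) auto
  \<comment> \<open>Since \<open>Suc a\<close> is not in \<open>K\<close>, it counts as
    \<open>- 1\<close> for the site \<open>a\<close>. The moved element no longer sees it, so its
    weight goes up by one and \<open>\<mu>\<close> becomes \<open>\<mu> - y\<close>.\<close>
  have wta: "wt n (Suc a) (s ` K) = wt n a K + 1"
  proof -
    have "wt n (Suc a) (s ` K) = wt n (Suc a) K"
      using a unfolding wt_eq_sum s_def transpose_image_mem
      by (intro sum.cong refl) (auto simp: transpose_def)
    then show ?thesis using wt_step[of a n K] K a by auto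
  qed
  have "\<mu> * d * weight_term n lm z y (s ` K) (\<lambda>i\<in>s ` K. \<phi> (s i)) =
    y * (d + \<mu> - y) * weight_term n lm z y K \<phi> +
    (\<mu> - y) * (d - y) * weight_term n lm (z \<circ> s) y K \<phi>" for \<phi> :: "nat \<Rightarrow> 'a"
  proof -
    define P where "P = pair_factor y K \<phi>"
    define M where "M = (\<Prod>i\<in>L. \<Prod>b = 1..n. site_factor n K lm z y i b (\<phi> i))"
    define N where "N = (\<Prod>b\<in>{1..n} - {a, Suc a}. if b < a then \<phi> a - z b + y else \<phi> a - z b)"
    have M': "(\<Prod>i\<in>L. \<Prod>b = 1..n. site_factor n K lm (z \<circ> s) y i b (\<phi> i)) = M"
      unfolding M_def s_def using KL a by (intro prod.cong refl site_prod_transpose) auto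
    have M'': "(\<Prod>i\<in>L. \<Prod>b = 1..n. site_factor n (s ` K) lm z y i b ((\<lambda>i\<in>s ` K. \<phi> (s i)) i)) = M"
      unfolding M_def
    proof (intro prod.cong refl)
      fix i b assume i: "i \<in> L"
      have "s i = i" using i KL by (auto simp: s_def transpose_def)
      then show "site_factor n (s ` K) lm z y i b ((\<lambda>i\<in>s ` K. \<phi> (s i)) i) = site_factor n K lm z y i b (\<phi> i)"
        using i wtL[OF i] by (simp add: sK site_factor_def)
    qed
    have 1: "weight_term n lm z y K \<phi> =
      N * ((\<mu> + \<phi> a - z a) * (\<phi> a - z (Suc a))) * M * P"
    proof -
      have "(\<Prod>i\<in>K. \<Prod>b = 1..n. site_factor n K lm z y i b (\<phi> i)) =
        (\<Prod>b = 1..n. site_factor n K lm z y a b (\<phi> a)) * M"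
        unfolding M_def by (subst (1) KL(1), rule prod.insert) (use KL in auto)
      also have "(\<Prod>b = 1..n. site_factor n K lm z y a b (\<phi> a)) = N * ((\<mu> + \<phi> a - z a) * (\<phi> a - z (Suc a)))"
        by (subst site_prod_split[OF a]) (simp_all add: N_def site_factor_def \<mu>_def algebra_simps)
      finally show ?thesis by (simp add: weight_term_def P_def)
    qed
    have 2: "weight_term n lm (z \<circ> s) y K \<phi> =
      N * ((\<mu> + \<phi> a - z (Suc a)) * (\<phi> a - z a)) * M * P"
    proof -
      have "(\<Prod>i\<in>K. \<Prod>b = 1..n. site_factor n K lm (z \<circ> s) y i b (\<phi> i)) =
        (\<Prod>b = 1..n. site_factor n K lm (z \<circ> s) y a b (\<phi> a)) * M"
        unfolding M'[symmetric] by (subst (1) KL(1), rule prod.insert) (use KL in auto)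
      also have "(\<Prod>b = 1..n. site_factor n K lm (z \<circ> s) y a b (\<phi> a)) =
          N * ((\<mu> + \<phi> a - z (Suc a)) * (\<phi> a - z a))"
        by (subst site_prod_split[OF a], simp, unfold s_def outer_prod_transpose[OF a])
          (simp_all add: N_def site_factor_def \<mu>_def algebra_simps)
      finally show ?thesis by (simp only: weight_term_def P_def)
    qed
    have 3: "weight_term n lm z y (s ` K) (\<lambda>i\<in>s ` K. \<phi> (s i)) =
      N * ((\<phi> a - z a + y) * (\<mu> - y + \<phi> a - z (Suc a))) * M * P"
    proof -
      let ?\<psi> = "\<lambda>i\<in>s ` K. \<phi> (s i)"
      have \<psi>: "?\<psi> (Suc a) = \<phi> a" using K by (simp add: sK) (simp add: s_def)
      have "(\<Prod>i\<in>s ` K. \<Prod>b = 1..n. site_factor n (s ` K) lm z y i b (?\<psi> i)) =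
        (\<Prod>b = 1..n. site_factor n (s ` K) lm z y (Suc a) b (?\<psi> (Suc a))) * M"
        unfolding M''[symmetric] by (subst (1) sK, rule prod.insert) (use KL in auto)
      also have "(\<Prod>b = 1..n. site_factor n (s ` K) lm z y (Suc a) b (?\<psi> (Suc a))) =
          N * ((\<phi> a - z a + y) * (\<mu> - y + \<phi> a - z (Suc a)))"
        unfolding \<psi> by (subst site_prod_split[OF a], simp)
          (simp add: N_def site_factor_def \<mu>_def wta algebra_simps)
      finally show ?thesis
        using K by (simp add: weight_term_def P_def s_def pair_factor_transpose)
    qed
    have "\<mu> * d * ((\<phi> a - z a + y) * (\<mu> - y + \<phi> a - z (Suc a))) =
      y * (d + \<mu> - y) * ((\<mu> + \<phi> a - z a) * (\<phi> a - z (Suc a))) +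
      (\<mu> - y) * (d - y) * ((\<mu> + \<phi> a - z (Suc a)) * (\<phi> a - z a))"
      unfolding d_def by (rule exchange_identity)
    then have "\<mu> * d * ((\<phi> a - z a + y) * (\<mu> - y + \<phi> a - z (Suc a))) * (N * M * P) =
      (y * (d + \<mu> - y) * ((\<mu> + \<phi> a - z a) * (\<phi> a - z (Suc a))) +
      (\<mu> - y) * (d - y) * ((\<mu> + \<phi> a - z (Suc a)) * (\<phi> a - z a))) * (N * M * P)"
      by simp
    then show ?thesis
      unfolding 1 2 3 by (simp add: algebra_simps)
  qed
  then show ?thesis
    unfolding weight_sum_def
    unfolding s_def sum_bijs_transpose sum_distrib_left sum.distrib[symmetric] by simp
qed

text \<open>Here \<open>r\<close> stands for the inverse of \<open>x - x'\<close>, so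
  \<open>1 + y * r\<close> and \<open>1 - y * r\<close> are the two pair factors. Pulling out
  \<open>r\<close> leaves a polynomial identity: the antisymmetric part in \<open>u\<close>,
  \<open>v\<close> of the two-site integrand vanishes after symmetrization in \<open>x\<close>,
  \<open>x'\<close>.\<close>

lemma antisymmetry_identity:
  fixes \<mu> :: "'a::field"
  assumes "r * (x - x') = 1"
  shows "((\<mu> - y + x - u) * (x - v) * (x' - u + y) * (\<mu> + x' - v)
        - (\<mu> - y + x - v) * (x - u) * (x' - v + y) * (\<mu> + x' - u)) * (1 + y * r) +
      ((\<mu> - y + x' - u) * (x' - v) * (x - u + y) * (\<mu> + x - v)
        - (\<mu> - y + x' - v) * (x' - u) * (x - v + y) * (\<mu> + x - u)) * (1 - y * r) = 0"
    (is "?A * _ + ?B * _ = 0")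
proof -
  have "1 + y * r = r * (x - x' + y)" "1 - y * r = r * (x - x' - y)"
    using assms by (simp_all add: distrib_left right_diff_distrib mult.commute)
  then have "?A * (1 + y * r) + ?B * (1 - y * r) = r * (?A * (x - x' + y) + ?B * (x - x' - y))"
    by (simp only: distrib_left mult.left_commute)
  also have "?A * (x - x' + y) + ?B * (x - x' - y) = 0"
    by (simp add: algebra_simps)
  finally show ?thesis by simp
qed

text \<open>When both sites are occupied, the terms for \<open>z\<close> and
  \<open>z \<circ> s\<close> need not agree one by one. Their difference \<open>D\<close> changes
  sign when \<open>\<phi>\<close> is composed with the swap, so the sum of \<open>D\<close> equals
  its own negative and vanishes because \<open>2\<close> is nonzero.\<close>

lemma weight_sum_transpose_both:
  fixes z :: "nat \<Rightarrow> 'a::field" and lm y :: 'a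
  assumes a: "a \<in> {1..n}" "Suc a \<in> {1..n}" and K: "finite K" "a \<in> K" "Suc a \<in> K"
    and two: "(2::'a) \<noteq> 0"
  defines "s \<equiv> transpose a (Suc a)"
  shows "weight_sum n lm (z \<circ> s) y K U = weight_sum n lm z y K U"
proof -
  define L where "L = K - {a, Suc a}"
  have KL: "K = insert a (insert (Suc a) L)" "a \<notin> L" "Suc a \<notin> L" "finite L"
    using K by (auto simp: L_def)
  have mem_s: "i \<in> s ` K \<longleftrightarrow> i \<in> K" for i
    using K unfolding s_def transpose_image_mem by (auto simp: transpose_def)
  then have sK: "s ` K = K" by blast
  have smem: "s i \<in> K \<longleftrightarrow> i \<in> K" for i
    using mem_s[of i] by (simp add: s_def transpose_image_mem)
  \<comment> \<open>The swap permutes all ordered pairs of \<open>K\<close> except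
    \<open>(a, Suc a)\<close>, whose order it reverses; that pair supplies the only pair factor that
    changes.\<close>
  define PP where "PP = {(i, j) \<in> K \<times> K. i < j} - {(a, Suc a)}"
  have finPP: "finite PP"
    unfolding PP_def by (rule finite_subset[of _ "K \<times> K"]) (use K(1) in auto)
  have PP: "{(i, j) \<in> K \<times> K. i < j} = insert (a, Suc a) PP" "(a, Suc a) \<notin> PP"
    using K by (auto simp: PP_def)
  define \<mu> where "\<mu> = lm - of_int (wt n (Suc a) K) * y"
  have wta: "wt n a K = wt n (Suc a) K + 1"
    using wt_step[of a n K] K a by auto
  define N where "N x = (\<Prod>b\<in>{1..n} - {a, Suc a}. if b < a then x - z b + y else x - z b)" for x
  define D where "D \<phi> = weight_term n lm z y K \<phi> - weight_term n lm (z \<circ> s) y K \<phi>" for \<phi>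
  have antisym: "D (\<lambda>i\<in>s ` K. \<phi> (s i)) = - D \<phi>" if \<phi>: "\<phi> \<in> bijs K U" for \<phi>
  proof -
    define x x' where "x = \<phi> a" and "x' = \<phi> (Suc a)"
    define r where "r = 1 / (x - x')"
    have "x \<noteq> x'"
    proof -
      have "inj_on \<phi> K" using \<phi> by (simp add: bijs_def bij_betw_def)
      from inj_onD[OF this, of a "Suc a"] show ?thesis
        using K by (auto simp: x_def x'_def)
    qed
    then have r: "r * (x - x') = 1" by (simp add: r_def)
    define M where "M = (\<Prod>i\<in>L. \<Prod>b = 1..n. site_factor n K lm z y i b (\<phi> i))"
    define P where "P = (\<Prod>(i, j)\<in>PP. (\<phi> i - \<phi> j + y) / (\<phi> i - \<phi> j))"
    define \<psi> where "\<psi> = (\<lambda>i\<in>s ` K. \<phi> (s i))"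
    have \<psi>: "\<psi> a = x'" "\<psi> (Suc a) = x" "\<And>i. i \<in> L \<Longrightarrow> \<psi> i = \<phi> i"
    proof -
      show "\<psi> a = x'" "\<psi> (Suc a) = x"
        unfolding \<psi>_def sK x_def x'_def using K by (simp_all add: s_def)
      fix i assume i: "i \<in> L"
      then have "s i = i" "i \<in> K" by (auto simp: L_def s_def)
      then show "\<psi> i = \<phi> i" by (simp add: \<psi>_def sK)
    qed
    have M': "(\<Prod>i\<in>L. \<Prod>b = 1..n. site_factor n K lm (z \<circ> s) y i b (\<phi> i)) = M"
      unfolding M_def s_def using KL a by (intro prod.cong refl site_prod_transpose) auto
    have P': "(\<Prod>(i, j)\<in>PP. (\<psi> i - \<psi> j + y) / (\<psi> i - \<psi> j)) = P"
      unfolding P_def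
    proof (rule prod.reindex_bij_witness[of _ "\<lambda>(i, j). (s i, s j)" "\<lambda>(i, j). (s i, s j)"], goal_cases)
      case (2 p)
      then obtain i j where p: "p = (i, j)" "i \<in> K" "j \<in> K" "i < j" "(i, j) \<noteq> (a, Suc a)"
        by (auto simp: PP_def)
      then have "s i < s j"
        unfolding s_def by (subst transpose_less_iff) (auto simp: doubleton_eq_iff)
      moreover have "\<not> (s i = a \<and> s j = Suc a)"
        using p(4) by (auto simp: s_def transpose_def split: if_splits)
      ultimately show ?case using p smem by (simp add: PP_def)
    next
      case (4 p)
      then obtain i j where p: "p = (i, j)" "i \<in> K" "j \<in> K" "i < j" "(i, j) \<noteq> (a, Suc a)"
        by (auto simp: PP_def)
      then have "s i < s j"
        unfolding s_def by (subst transpose_less_iff) (auto simp: doubleton_eq_iff)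
      moreover have "\<not> (s i = a \<and> s j = Suc a)"
        using p(4) by (auto simp: s_def transpose_def split: if_splits)
      ultimately show ?case using p smem by (simp add: PP_def)
    next
      case (5 p)
      then show ?case by (auto simp: \<psi>_def PP_def sK smem)
    qed (auto simp: s_def)
    have split: "(\<Prod>i\<in>K. f i) = f a * (f (Suc a) * (\<Prod>i\<in>L. f i))" for f :: "nat \<Rightarrow> 'a"
      unfolding KL(1) using KL by simp
    have pf: "pair_factor y K \<phi> = ((x - x' + y) / (x - x')) * P"
      unfolding pair_factor_def PP(1) by (subst prod.insert[OF finPP PP(2)]) (simp add: P_def x_def x'_def)
    have pf': "pair_factor y K \<psi> = ((x' - x + y) / (x' - x)) * P"
      unfolding pair_factor_def PP(1) by (subst prod.insert[OF finPP PP(2)]) (simp only: P' \<psi> split_conv)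
    have c: "(x - x' + y) / (x - x') = 1 + y * r" "(x' - x + y) / (x' - x) = 1 - y * r"
      using \<open>x \<noteq> x'\<close> by (auto simp: r_def field_simps)
    have sf: "(\<Prod>b = 1..n. site_factor n K lm z y a b u) = N u * ((\<mu> - y + u - z a) * (u - z (Suc a)))"
        "(\<Prod>b = 1..n. site_factor n K lm z y (Suc a) b u) = N u * ((u - z a + y) * (\<mu> + u - z (Suc a)))"
        "(\<Prod>b = 1..n. site_factor n K lm (z \<circ> s) y a b u) = N u * ((\<mu> - y + u - z (Suc a)) * (u - z a))"
        "(\<Prod>b = 1..n. site_factor n K lm (z \<circ> s) y (Suc a) b u) =
           N u * ((u - z (Suc a) + y) * (\<mu> + u - z a))" for u
         apply (subst site_prod_split[OF a], simp, simp add: N_def site_factor_def \<mu>_def wta algebra_simps)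
        apply (subst site_prod_split[OF a], simp, simp add: N_def site_factor_def \<mu>_def wta algebra_simps)
       apply (subst site_prod_split[OF a], simp, unfold s_def outer_prod_transpose[OF a],
          simp add: N_def site_factor_def \<mu>_def wta algebra_simps)
      apply (subst site_prod_split[OF a], simp, unfold s_def outer_prod_transpose[OF a],
          simp add: N_def site_factor_def \<mu>_def wta algebra_simps)
      done
    have G: "weight_term n lm z y K \<phi> = N x * ((\<mu> - y + x - z a) * (x - z (Suc a))) *
       (N x' * ((x' - z a + y) * (\<mu> + x' - z (Suc a))) * M) * ((1 + y * r) * P)"
      unfolding weight_term_def split pf c
      unfolding x_def[symmetric] x'_def[symmetric] sf M_def[symmetric] by simp
    have Gs: "weight_term n lm (z \<circ> s) y K \<phi> = N x * ((\<mu> - y + x - z (Suc a)) * (x - z a)) *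
       (N x' * ((x' - z (Suc a) + y) * (\<mu> + x' - z a)) * M) * ((1 + y * r) * P)"
      unfolding weight_term_def split pf c
      unfolding x_def[symmetric] x'_def[symmetric] sf M' by simp
    have MM: "(\<Prod>i\<in>L. \<Prod>b = 1..n. site_factor n K lm z y i b (\<psi> i)) = M"
        "(\<Prod>i\<in>L. \<Prod>b = 1..n. site_factor n K lm (z \<circ> s) y i b (\<psi> i)) = M"
    proof -
      show "(\<Prod>i\<in>L. \<Prod>b = 1..n. site_factor n K lm z y i b (\<psi> i)) = M"
        unfolding M_def using \<psi>(3) by simp
      show "(\<Prod>i\<in>L. \<Prod>b = 1..n. site_factor n K lm (z \<circ> s) y i b (\<psi> i)) = M"
        unfolding M'[symmetric] by (intro prod.cong refl) (simp only: \<psi>(3))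
    qed
    have G': "weight_term n lm z y K \<psi> = N x' * ((\<mu> - y + x' - z a) * (x' - z (Suc a))) *
       (N x * ((x - z a + y) * (\<mu> + x - z (Suc a))) * M) * ((1 - y * r) * P)"
      unfolding weight_term_def split pf' c \<psi>(1,2) sf MM by simp
    have Gs': "weight_term n lm (z \<circ> s) y K \<psi> = N x' * ((\<mu> - y + x' - z (Suc a)) * (x' - z a)) *
       (N x * ((x - z (Suc a) + y) * (\<mu> + x - z a)) * M) * ((1 - y * r) * P)"
      unfolding weight_term_def split pf' c \<psi>(1,2) sf MM by simp
    have regroup: "(N1 * (a1 * a2) * (N2 * (a3 * a4) * M1) * (c * P1) -
        N1 * (b1 * b2) * (N2 * (b3 * b4) * M1) * (c * P1)) +
       (N2 * (c1 * c2) * (N1 * (c3 * c4) * M1) * (c' * P1) -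
        N2 * (d1 * d2) * (N1 * (d3 * d4) * M1) * (c' * P1)) =
      N1 * N2 * M1 * P1 * ((a1 * a2 * a3 * a4 - b1 * b2 * b3 * b4) * c + (c1 * c2 * c3 * c4 - d1 * d2 * d3 * d4) * c')"
      for N1 N2 M1 P1 a1 a2 a3 a4 b1 b2 b3 b4 c1 c2 c3 c4 d1 d2 d3 d4 c c' :: 'a
      by (simp add: algebra_simps)
    have "D \<phi> + D \<psi> = 0"
      unfolding D_def G Gs G' Gs' regroup antisymmetry_identity[OF r] by simp
    then show ?thesis
      unfolding \<psi>_def by (simp add: add_eq_0_iff)
  qed
  have "(\<Sum>\<phi>\<in>bijs K U. D \<phi>) = (\<Sum>\<phi>\<in>bijs (s ` K) U. D \<phi>)"
    by (simp add: sK)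
  also have "\<dots> = (\<Sum>\<phi>\<in>bijs K U. D (\<lambda>i\<in>s ` K. \<phi> (s i)))"
    unfolding s_def by (rule sum_bijs_transpose)
  also have "\<dots> = - (\<Sum>\<phi>\<in>bijs K U. D \<phi>)"
    by (simp add: antisym sum_negf)
  finally have "2 * (\<Sum>\<phi>\<in>bijs K U. D \<phi>) = 0"
    by (metis add.left_inverse mult_2)
  then show ?thesis
    using two by (simp add: D_def weight_sum_def sum_subtractf)
qed

section \<open>Triangularity\<close>

text \<open>If \<open>\<phi> i\<close> is the point of a site \<open>a\<close> beyond
  \<open>i\<close>, then the site factor there is \<open>\<phi> i - z a = 0\<close>; so only maps
  that raise no index contribute.\<close>

lemma weight_term_nonzeroE:
  assumes z: "inj_on z {1..n}" and A: "A \<subseteq> {1..n}" and K: "K \<subseteq> {1..n}"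
    and \<phi>: "\<phi> \<in> bijs K (z ` A)" and nz: "weight_term n lm z y K \<phi> \<noteq> 0"
  obtains \<alpha> where "bij_betw \<alpha> K A" "\<And>i. i \<in> K \<Longrightarrow> \<alpha> i \<le> i" "\<And>i. i \<in> K \<Longrightarrow> \<phi> i = z (\<alpha> i)"
proof
  define \<alpha> where "\<alpha> = inv_into A z \<circ> \<phi>"
  have zA: "bij_betw z A (z ` A)"
    using z A by (auto simp: bij_betw_def intro: inj_on_subset)
  have \<phi>': "bij_betw \<phi> K (z ` A)" using \<phi> by (simp add: bijs_def)
  show \<alpha>: "bij_betw \<alpha> K A"
    unfolding \<alpha>_def using \<phi>' bij_betw_inv_into[OF zA] by (rule bij_betw_trans)
  show *: "\<phi> i = z (\<alpha> i)" if "i \<in> K" for i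
  proof -
    have "\<phi> i \<in> z ` A" using \<phi>' that bij_betwE by blast
    then show ?thesis by (simp add: \<alpha>_def f_inv_into_f)
  qed
  show "\<alpha> i \<le> i" if i: "i \<in> K" for i
  proof (rule ccontr)
    assume "\<not> \<alpha> i \<le> i"
    then have "site_factor n K lm z y i (\<alpha> i) (\<phi> i) = 0"
      using *[OF i] by (simp add: site_factor_def)
    moreover have "\<alpha> i \<in> {1..n}"
      using \<alpha> i A bij_betwE by blast
    ultimately have "(\<Prod>a = 1..n. site_factor n K lm z y i a (\<phi> i)) = 0"
      by (intro prod_zero) auto
    then have "(\<Prod>i\<in>K. \<Prod>a = 1..n. site_factor n K lm z y i a (\<phi> i)) = 0"
      using i finite_subset[OF K] by (intro prod_zero) auto
    then show False using nz by (simp add: weight_term_def)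
  qed
qed

text \<open>As \<open>\<alpha>\<close> permutes \<open>K\<close>, both sides of
  \<open>\<alpha> i \<le> i\<close> have the same sum over \<open>K\<close>, which forces equality
  everywhere.\<close>

lemma bij_betw_decreasing_imp_id:
  fixes \<alpha> :: "nat \<Rightarrow> nat"
  assumes "finite K" "bij_betw \<alpha> K K" "\<And>i. i \<in> K \<Longrightarrow> \<alpha> i \<le> i" "i \<in> K"
  shows "\<alpha> i = i"
proof -
  have "sum \<alpha> K = sum (\<lambda>i. i) K"
    using sum.reindex_bij_betw[OF assms(2), of "\<lambda>i. i"] by simp
  then show ?thesis
    using sum_mono_inv[of \<alpha> K "\<lambda>i. i"] assms by blast
qed

lemma weight_sum_eq_0:
  assumes "inj_on z {1..n}" "A \<subseteq> {1..n}" "K \<subseteq> {1..n}"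
    and "\<And>\<alpha>. bij_betw \<alpha> K A \<Longrightarrow> (\<And>i. i \<in> K \<Longrightarrow> \<alpha> i \<le> i) \<Longrightarrow> False"
  shows "weight_sum n lm z y K (z ` A) = 0"
  unfolding weight_sum_def
proof (rule sum.neutral, rule ballI, rule ccontr)
  fix \<phi> assume \<phi>: "\<phi> \<in> bijs K (z ` A)" and nz: "weight_term n lm z y K \<phi> \<noteq> 0"
  show False
    by (rule weight_term_nonzeroE[OF assms(1-3) \<phi> nz]) (rule assms(4))
qed

lemma finite_bijs: "finite K \<Longrightarrow> finite U \<Longrightarrow> finite (bijs K U)"
  by (rule finite_subset[of _ "PiE K (\<lambda>_. U)"])
    (auto simp: bijs_def extensional_def dest: bij_betwE intro!: finite_PiE)

lemma weight_sum_diag: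
  assumes z: "inj_on z {1..n}" and K: "K \<subseteq> {1..n}"
  shows "weight_sum n lm z y K (z ` K) = weight_term n lm z y K (restrict z K)"
proof -
  have finK: "finite K" using K finite_subset by blast
  have "inj_on z K" using z K by (rule inj_on_subset)
  then have in_bijs: "restrict z K \<in> bijs K (z ` K)"
    by (auto simp: bijs_def bij_betw_def inj_on_def)
  have "weight_term n lm z y K \<phi> = 0" if \<phi>: "\<phi> \<in> bijs K (z ` K) - {restrict z K}" for \<phi>
  proof (rule ccontr)
    assume "weight_term n lm z y K \<phi> \<noteq> 0"
    then obtain \<alpha> where \<alpha>: "bij_betw \<alpha> K K" "\<And>i. i \<in> K \<Longrightarrow> \<alpha> i \<le> i" "\<And>i. i \<in> K \<Longrightarrow> \<phi> i = z (\<alpha> i)"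
      using weight_term_nonzeroE[OF z K K DiffD1[OF \<phi>]] by metis
    then have "\<phi> i = z i" if "i \<in> K" for i
      using that bij_betw_decreasing_imp_id[OF finK \<alpha>(1,2)] by simp
    moreover have "\<phi> \<in> extensional K"
      using \<phi> by (simp add: bijs_def)
    ultimately have "\<phi> = restrict z K"
      by (intro extensionalityI[of \<phi> K]) auto
    then show False using \<phi> by simp
  qed
  then show ?thesis
    unfolding weight_sum_def
    by (subst sum.remove[OF finite_bijs[OF finK finite_imageI[OF finK]] in_bijs]) simp
qed

text \<open>The denominators \<open>z i - z a\<close> of the pair factors cancel the site factors at
  the elements of \<open>K\<close> above \<open>i\<close> and replace them by
  \<open>z i - z a + y\<close>, the form that the site factors below \<open>i\<close> already
  have.\<close>

lemma weight_term_diag: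
  fixes z :: "nat \<Rightarrow> 'a::field" and lm y :: 'a
  assumes z: "inj_on z {1..n}" and K: "K \<subseteq> {1..n}"
  shows "weight_term n lm z y K (restrict z K) =
    (\<Prod>i\<in>K. lm - of_int (wt n i K) * y) *
    (\<Prod>i\<in>K. \<Prod>a\<in>K - {i}. z i - z a + y) *
    (\<Prod>i\<in>K. \<Prod>a\<in>{1..n} - K. if a < i then z i - z a + y else z i - z a)"
proof -
  have finK: "finite K" using K finite_subset by blast
  define P where "P = (\<Prod>i\<in>K. \<Prod>a\<in>{a \<in> K. i < a}. (z i - z a + y) / (z i - z a))"
  have "pair_factor y K (restrict z K) = (\<Prod>(i, j)\<in>Sigma K (\<lambda>i. {a \<in> K. i < a}). (z i - z j + y) / (z i - z j))"
    unfolding pair_factor_def by (rule prod.cong) auto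
  also have "\<dots> = P"
    unfolding P_def by (rule prod.Sigma[symmetric]) (use finK in auto)
  finally have pf: "pair_factor y K (restrict z K) = P" .
  \<comment> \<open>Each pair factor is assigned to the row of its smaller index.\<close>
  have row: "(\<Prod>a = 1..n. site_factor n K lm z y i a (restrict z K i)) *
      (\<Prod>a\<in>{a \<in> K. i < a}. (z i - z a + y) / (z i - z a)) =
      (lm - of_int (wt n i K) * y) * (\<Prod>a\<in>K - {i}. z i - z a + y) *
      (\<Prod>a\<in>{1..n} - K. if a < i then z i - z a + y else z i - z a)" if i: "i \<in> K" for i
  proof -
    have dec: "K - {i} = {a \<in> K. a < i} \<union> {a \<in> K. i < a}"
      using i by auto
    have disj: "{a \<in> K. a < i} \<inter> {a \<in> K. i < a} = {}" by auto
    have union: "prod g (K - {i}) = prod g {a \<in> K. a < i} * prod g {a \<in> K. i < a}" for g :: "nat \<Rightarrow> 'a"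
      unfolding dec using finK disj by (simp add: prod.union_disjoint)
    let ?f = "\<lambda>a. site_factor n K lm z y i a (z i)"
    have f1: "(\<Prod>a = 1..n. ?f a) = (\<Prod>a\<in>{1..n} - K. ?f a) * (\<Prod>a\<in>K. ?f a)"
      by (rule prod.subset_diff[OF K finite_atLeastAtMost])
    have f2: "(\<Prod>a\<in>K. ?f a) = ?f i * (\<Prod>a\<in>K - {i}. ?f a)"
      using prod.remove[OF finK i, of ?f] .
    have f3: "(\<Prod>a\<in>K - {i}. ?f a) = (\<Prod>a\<in>{a \<in> K. a < i}. ?f a) * (\<Prod>a\<in>{a \<in> K. i < a}. ?f a)"
      using union[of ?f] .
    have f4: "(\<Prod>a\<in>{a \<in> K. a < i}. ?f a) = (\<Prod>a\<in>{a \<in> K. a < i}. z i - z a + y)"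
      by (rule prod.cong) (auto simp: site_factor_def)
    have f5: "(\<Prod>a\<in>{a \<in> K. i < a}. ?f a) = (\<Prod>a\<in>{a \<in> K. i < a}. z i - z a)"
      by (rule prod.cong) (auto simp: site_factor_def)
    have f6: "(\<Prod>a\<in>{1..n} - K. ?f a) = (\<Prod>a\<in>{1..n} - K. if a < i then z i - z a + y else z i - z a)"
      by (rule prod.cong) (use i in \<open>auto simp: site_factor_def\<close>)
    note 1 = f1[unfolded f2 f3 f4 f5 f6]
    have 2: "(\<Prod>a\<in>{a \<in> K. i < a}. z i - z a) * (\<Prod>a\<in>{a \<in> K. i < a}. (z i - z a + y) / (z i - z a)) =
      (\<Prod>a\<in>{a \<in> K. i < a}. z i - z a + y)"
      unfolding prod.distrib[symmetric]
    proof (rule prod.cong[OF refl])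
      fix a assume "a \<in> {a \<in> K. i < a}"
      then have "i \<in> {1..n}" "a \<in> {1..n}" "i \<noteq> a" using i K by blast+
      then have "z i \<noteq> z a" using inj_onD[OF z, of i a] by blast
      then show "(z i - z a) * ((z i - z a + y) / (z i - z a)) = z i - z a + y" by simp
    qed
    have 3: "(\<Prod>a\<in>K - {i}. z i - z a + y) =
      (\<Prod>a\<in>{a \<in> K. a < i}. z i - z a + y) * (\<Prod>a\<in>{a \<in> K. i < a}. z i - z a + y)"
      using union[of "\<lambda>a. z i - z a + y"] .
    have 4: "site_factor n K lm z y i i (z i) = lm - of_int (wt n i K) * y"
      by (simp add: site_factor_def)
    show ?thesis
      unfolding restrict_apply' [OF i] 1 3 2[symmetric] 4 by (simp only: ac_simps)
  qed
  have "weight_term n lm z y K (restrict z K) =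
    (\<Prod>i\<in>K. (\<Prod>a = 1..n. site_factor n K lm z y i a (restrict z K i)) *
      (\<Prod>a\<in>{a \<in> K. i < a}. (z i - z a + y) / (z i - z a)))"
    unfolding weight_term_def pf P_def by (rule prod.distrib[symmetric])
  also have "\<dots> = (\<Prod>i\<in>K. (lm - of_int (wt n i K) * y) * (\<Prod>a\<in>K - {i}. z i - z a + y) *
      (\<Prod>a\<in>{1..n} - K. if a < i then z i - z a + y else z i - z a))"
    by (rule prod.cong[OF refl row])
  finally show ?thesis by (simp add: prod.distrib)
qed

section \<open>The opposite weight functions\<close>

text \<open>
  The reflection \<open>refl_idx n\<close> is \<open>s\<^sub>0\<close>, and \<open>weight_sum_opp\<close> is the function
  \<open>W\<^sup>-\<^sub>J\<close> up to the factor \<open>(- 1) ^ k * y ^ k / e\<^sub>k\<close>.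
\<close>

definition refl_idx :: "nat \<Rightarrow> nat \<Rightarrow> nat"
  where "refl_idx n i = n + 1 - i"

definition weight_sum_opp ::
    "nat \<Rightarrow> 'a::field \<Rightarrow> (nat \<Rightarrow> 'a) \<Rightarrow> 'a \<Rightarrow> nat set \<Rightarrow> 'a set \<Rightarrow> 'a"
  where "weight_sum_opp n lm z y J U =
     weight_sum n (- lm - of_int (int n - 2 * int (card J)) * y) (z \<circ> refl_idx n) y (refl_idx n ` J) U"

lemma refl_idx_in: "i \<in> {1..n} \<Longrightarrow> refl_idx n i \<in> {1..n}"
  by (auto simp: refl_idx_def)

lemma refl_idx_refl_idx: "i \<in> {1..n} \<Longrightarrow> refl_idx n (refl_idx n i) = i"
  by (auto simp: refl_idx_def)

lemma refl_idx_bij: "bij_betw (refl_idx n) {1..n} {1..n}"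
  by (rule bij_betw_byWitness[where f' = "refl_idx n"]) (auto simp: refl_idx_def)

lemma refl_idx_mem:
  assumes "I \<subseteq> {1..n}" "i \<in> {1..n}"
  shows "i \<in> refl_idx n ` I \<longleftrightarrow> refl_idx n i \<in> I"
  using assms refl_idx_refl_idx by (metis (no_types, lifting) image_iff subsetD)

lemma card_refl_idx: "I \<subseteq> {1..n} \<Longrightarrow> card (refl_idx n ` I) = card I"
  using refl_idx_bij[of n] by (intro card_image) (auto simp: bij_betw_def intro: inj_on_subset)

text \<open>Reflection turns the sites above into the sites below. The signed count over all sites
  is \<open>2 * card I - n\<close>; removing \<open>i\<close> itself, which contributes
  \<open>1\<close>, and the sites above leaves the count below.\<close>

lemma wt_refl_idx:
  assumes I: "I \<subseteq> {1..n}" and i: "i \<in> I"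
  shows "wt n (refl_idx n i) (refl_idx n ` I) = 2 * int (card I) - 1 - int n - wt n i I"
proof -
  let ?g = "\<lambda>j. if j \<in> I then 1 else - 1 :: int"
  have i1: "i \<in> {1..n}" using assms by blast
  have "wt n (refl_idx n i) (refl_idx n ` I) = (\<Sum>j\<in>{1..<i}. ?g j)"
    unfolding wt_eq_sum
  proof (rule sum.reindex_bij_witness[of _ "refl_idx n" "refl_idx n"], goal_cases)
    case (5 j)
    then have "j \<in> {1..n}" by simp
    then show ?case using refl_idx_mem[OF I] by simp
  qed (use i1 in \<open>auto simp: refl_idx_def\<close>)
  moreover have "(\<Sum>j\<in>{1..n}. ?g j) = (\<Sum>j\<in>{1..<i}. ?g j) + ?g i + (\<Sum>j\<in>{i<..n}. ?g j)"
  proof -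
    have "{1..n} = insert i ({1..<i} \<union> {i<..n})" using i1 by auto
    then have "(\<Sum>j\<in>{1..n}. ?g j) = (\<Sum>j\<in>insert i ({1..<i} \<union> {i<..n}). ?g j)" by simp
    also have "\<dots> = ?g i + ((\<Sum>j\<in>{1..<i}. ?g j) + (\<Sum>j\<in>{i<..n}. ?g j))"
      by (subst sum.insert, simp, simp, subst sum.union_disjoint) auto
    finally show ?thesis by (simp add: algebra_simps)
  qed
  moreover have "(\<Sum>j\<in>{1..n}. ?g j) = 2 * int (card I) - int n"
  proof -
    have "(\<Sum>j\<in>{1..n}. ?g j) = int (card ({1..n} \<inter> I)) - int (card ({1..n} - I))"
      by (subst sum.If_cases) (auto simp: Diff_eq)
    also have "{1..n} \<inter> I = I" using I by blast
    also have "card ({1..n} - I) = n - card I"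
      using I by (subst card_Diff_subset) (auto intro: finite_subset)
    also have "int (n - card I) = int n - int (card I)"
      using card_mono[OF finite_atLeastAtMost I] by simp
    finally show ?thesis by simp
  qed
  ultimately show ?thesis
    using i by (simp add: wt_eq_sum)
qed

lemma refl_idx_transpose:
  assumes "a \<in> {1..n}" "Suc a \<in> {1..n}" "i \<in> {1..n}"
  shows "refl_idx n (transpose a (Suc a) i) = transpose (n - a) (Suc (n - a)) (refl_idx n i)"
  using assms by (auto simp: refl_idx_def transpose_def)

lemma image_refl_idx_transpose:
  assumes a: "a \<in> {1..n}" "Suc a \<in> {1..n}" and J: "J \<subseteq> {1..n}"
  shows "refl_idx n ` transpose a (Suc a) ` J = transpose (n - a) (Suc (n - a)) ` refl_idx n ` J"
  unfolding image_image using J refl_idx_transpose[OF a] by (intro image_cong) auto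

lemma weight_sum_opp_transpose_args:
  assumes a: "a \<in> {1..n}" "Suc a \<in> {1..n}"
  shows "weight_sum n lm' ((z \<circ> transpose a (Suc a)) \<circ> refl_idx n) y K U =
    weight_sum n lm' ((z \<circ> refl_idx n) \<circ> transpose (n - a) (Suc (n - a))) y K U"
proof (rule weight_sum_cong)
  fix i assume i: "i \<in> {1..n}"
  then show "((z \<circ> transpose a (Suc a)) \<circ> refl_idx n) i =
      ((z \<circ> refl_idx n) \<circ> transpose (n - a) (Suc (n - a))) i"
    using a by (auto simp: refl_idx_def transpose_def)
qed

lemma card_transpose_image: "card (transpose a b ` K) = card K"
  by (intro card_image inj_onI) (metis transpose_involutory)

lemma transpose_image_subset:
  "a \<in> {1..n} \<Longrightarrow> Suc a \<in> {1..n} \<Longrightarrow> K \<subseteq> {1..n} \<Longrightarrow> transpose a (Suc a) ` K \<subseteq> {1..n}"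
  using transpose_Suc_bij by (metis bij_betw_imp_surj_on image_mono)

lemma wt_transpose_moved:
  assumes a: "a \<in> {1..n}" "Suc a \<in> {1..n}" and J: "a \<in> J" "Suc a \<notin> J"
  shows "wt n (Suc a) (transpose a (Suc a) ` J) = wt n a J + 1"
proof -
  have "wt n (Suc a) (transpose a (Suc a) ` J) = wt n (Suc a) J"
    using a unfolding wt_eq_sum transpose_image_mem
    by (intro sum.cong refl) (auto simp: transpose_def)
  then show ?thesis using wt_step[of a n J] J a by auto
qed

text \<open>This is \<open>weight_sum_exchange\<close> for the reflected data. Reflection reverses
  the order of the two sites, so the relation expresses \<open>J\<close>, where the lower site is
  occupied, through the swapped set; in \<open>weight_sum_exchange\<close> it is the other way
  round.\<close>

lemma weight_sum_opp_exchange: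
  fixes z :: "nat \<Rightarrow> 'a::field" and lm y :: 'a
  assumes a: "a \<in> {1..n}" "Suc a \<in> {1..n}" and J: "J \<subseteq> {1..n}" "a \<in> J" "Suc a \<notin> J"
  defines "s \<equiv> transpose a (Suc a)"
  defines "d \<equiv> z a - z (Suc a)" and "\<mu> \<equiv> lm - of_int (wt n a J) * y"
  shows "(2 * y - \<mu>) * d * weight_sum_opp n lm z y J U =
    y * (d + \<mu> - y) * weight_sum_opp n lm z y (s ` J) U +
    (y - \<mu>) * (d + y) * weight_sum_opp n lm (z \<circ> s) y (s ` J) U"
proof -
  define lm' where "lm' = - lm - of_int (int n - 2 * int (card J)) * y"
  define b where "b = n - a"
  have b: "b \<in> {1..n}" "Suc b \<in> {1..n}" using a by (auto simp: b_def)
  define s' where "s' = transpose b (Suc b)"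
  define K where "K = refl_idx n ` s ` J"
  have sJ: "s ` J \<subseteq> {1..n}"
    unfolding s_def by (rule transpose_image_subset[OF a J(1)])
  have K1: "K \<subseteq> {1..n}"
    unfolding K_def using sJ refl_idx_in by blast
  have rb: "refl_idx n b = Suc a" "refl_idx n (Suc b) = a" "refl_idx n (Suc a) = b"
    using a by (auto simp: b_def refl_idx_def)
  have "Suc a \<in> s ` J" "a \<notin> s ` J"
    using J by (auto simp: s_def transpose_image_mem)
  then have K2: "b \<in> K" "Suc b \<notin> K"
    unfolding K_def using refl_idx_mem[OF sJ b(1)] refl_idx_mem[OF sJ b(2)] rb by simp_all
  have s'K: "s' ` K = refl_idx n ` J"
    unfolding K_def s_def image_refl_idx_transpose[OF a J(1)] s'_def b_def[symmetric]
    by (simp add: image_image)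
  have cJ: "card (s ` J) = card J"
    by (simp add: s_def card_transpose_image)
  have "wt n b K = 2 * int (card J) - 1 - int n - (wt n a J + 1)"
    using wt_refl_idx[OF sJ \<open>Suc a \<in> s ` J\<close>]
    unfolding K_def rb cJ wt_transpose_moved[OF a J(2,3), folded s_def] .
  then have wb: "wt n b K = 2 * int (card J) - 2 - int n - wt n a J" by simp
  \<comment> \<open>The shift by \<open>int n - 2 * int (card J)\<close> in the dynamical parameter
    cancels the total signed count in \<open>wt_refl_idx\<close>, so \<open>n\<close> and
    \<open>card J\<close> drop out.\<close>
  have \<mu>': "lm' - of_int (wt n b K) * y = 2 * y - \<mu>"
    unfolding lm'_def \<mu>_def wb by (simp add: algebra_simps)
  have d': "(z \<circ> refl_idx n) b - (z \<circ> refl_idx n) (Suc b) = - d"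
    by (simp add: rb d_def)
  have 1: "weight_sum_opp n lm z y J U = weight_sum n lm' (z \<circ> refl_idx n) y (s' ` K) U"
    by (simp add: weight_sum_opp_def lm'_def s'K)
  have 2: "weight_sum_opp n lm z y (s ` J) U = weight_sum n lm' (z \<circ> refl_idx n) y K U"
    by (simp add: weight_sum_opp_def lm'_def cJ K_def)
  have 3: "weight_sum_opp n lm (z \<circ> s) y (s ` J) U = weight_sum n lm' ((z \<circ> refl_idx n) \<circ> s') y K U"
    unfolding weight_sum_opp_def cJ K_def[symmetric] lm'_def[symmetric]
    using weight_sum_opp_transpose_args[OF a, folded b_def, folded s_def s'_def] .
  have "(2 * y - \<mu>) * (- d) * weight_sum n lm' (z \<circ> refl_idx n) y (s' ` K) U =
    y * (- d + (2 * y - \<mu>) - y) * weight_sum n lm' (z \<circ> refl_idx n) y K U +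
    (2 * y - \<mu> - y) * (- d - y) * weight_sum n lm' ((z \<circ> refl_idx n) \<circ> s') y K U"
    using weight_sum_exchange[OF b finite_subset[OF K1 finite_atLeastAtMost] K2, of lm' y "z \<circ> refl_idx n" U]
    unfolding d' \<mu>' s'_def .
  then show ?thesis
    unfolding 1 2 3 by (simp add: algebra_simps)
qed

lemma weight_sum_opp_transpose:
  fixes z :: "nat \<Rightarrow> 'a::field" and lm y :: 'a
  assumes a: "a \<in> {1..n}" "Suc a \<in> {1..n}" and J: "J \<subseteq> {1..n}" "a \<in> J \<longleftrightarrow> Suc a \<in> J"
    and two: "(2::'a) \<noteq> 0"
  shows "weight_sum_opp n lm (z \<circ> transpose a (Suc a)) y J U = weight_sum_opp n lm z y J U"
proof -
  define b where "b = n - a"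
  have b: "b \<in> {1..n}" "Suc b \<in> {1..n}" using a by (auto simp: b_def)
  have rb: "refl_idx n b = Suc a" "refl_idx n (Suc b) = a"
    using a by (auto simp: b_def refl_idx_def)
  have fin: "finite (refl_idx n ` J)"
    using J finite_subset by blast
  have mem: "b \<in> refl_idx n ` J \<longleftrightarrow> Suc a \<in> J" "Suc b \<in> refl_idx n ` J \<longleftrightarrow> a \<in> J"
    using refl_idx_mem[OF J(1) b(1)] refl_idx_mem[OF J(1) b(2)] rb by simp_all
  have "weight_sum n lm' ((z \<circ> refl_idx n) \<circ> transpose b (Suc b)) y (refl_idx n ` J) U =
      weight_sum n lm' (z \<circ> refl_idx n) y (refl_idx n ` J) U" for lm'
    using weight_sum_transpose_both[OF b fin _ _ two, of lm' "z \<circ> refl_idx n" y U]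
      weight_sum_transpose_neither[OF b, of "refl_idx n ` J" lm' "z \<circ> refl_idx n" y U] mem J(2)
    by blast
  then show ?thesis
    unfolding weight_sum_opp_def weight_sum_opp_transpose_args[OF a] b_def .
qed

text \<open>Only the moved element changes its factor, because its weight goes up by one; this is
  the cross-multiplied ratio of the old and the new factor.\<close>

lemma C_fun_transpose:
  fixes lm y :: "'a::field"
  assumes a: "a \<in> {1..n}" "Suc a \<in> {1..n}" and K: "K \<subseteq> {1..n}" "a \<in> K" "Suc a \<notin> K"
  defines "\<mu> \<equiv> lm - of_int (wt n a K) * y"
  shows "(\<mu> - of_int r * y) * C_fun n r (transpose a (Suc a) ` K) lm y =
    (\<mu> - of_int (r + 1) * y) * C_fun n r K lm y"
proof -
  let ?s = "transpose a (Suc a)"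
  define L where "L = K - {a}"
  have KL: "K = insert a L" "a \<notin> L" "Suc a \<notin> L" "finite L"
    using K finite_subset[OF K(1)] by (auto simp: L_def)
  have "?s ` L = L"
    using KL by (force simp: transpose_def image_iff)
  then have sK: "?s ` K = insert (Suc a) L"
    by (simp add: KL(1))
  have wtL: "wt n i (?s ` K) = wt n i K" if "i \<in> L" for i
    using that KL a by (intro wt_transpose) auto
  define M where "M = (\<Prod>i\<in>L. lm - of_int (wt n i K + r) * y)"
  have "C_fun n r K lm y = (\<mu> - of_int r * y) * M"
    unfolding C_fun_def M_def \<mu>_def
    by (subst prod.remove[OF _ K(2)]) (use finite_subset[OF K(1)] in \<open>simp_all add: L_def algebra_simps\<close>)
  moreover have "C_fun n r (?s ` K) lm y = (\<mu> - of_int (r + 1) * y) * M"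
  proof -
    have "C_fun n r (?s ` K) lm y =
      (lm - of_int (wt n (Suc a) (?s ` K) + r) * y) * (\<Prod>i\<in>L. lm - of_int (wt n i (?s ` K) + r) * y)"
      unfolding C_fun_def by (subst (1) sK, rule prod.insert) (use KL in auto)
    also have "(\<Prod>i\<in>L. lm - of_int (wt n i (?s ` K) + r) * y) = M"
      unfolding M_def using wtL by simp
    finally show ?thesis
      unfolding wt_transpose_moved[OF a K(2,3)] \<mu>_def by (simp add: algebra_simps)
  qed
  ultimately show ?thesis by simp
qed

section \<open>Biorthogonality\<close>

text \<open>A set other than \<open>{1..card K}\<close> misses some \<open>m \<le> card K\<close>
  and contains something larger than \<open>m\<close>; the first element beyond \<open>m\<close>
  then has its predecessor outside the set.\<close>

lemma exists_adjacent_gap: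
  assumes K: "K \<subseteq> {1..n}" "K \<noteq> {1..card K}"
  obtains a where "a \<in> {1..n}" "Suc a \<in> {1..n}" "a \<notin> K" "Suc a \<in> K"
proof -
  have fin: "finite K" using K(1) finite_subset by blast
  have "\<not> {1..card K} \<subseteq> K"
    using card_subset_eq[OF fin, of "{1..card K}"] K(2) by auto
  then obtain m where m: "m \<in> {1..card K}" "m \<notin> K" by blast
  have "\<not> K \<subseteq> {1..card K}"
    using card_subset_eq[of "{1..card K}" K] K(2) by auto
  then obtain c where c: "c \<in> K" "c \<notin> {1..card K}" by blast
  have "c > m" using c K(1) m(1) by auto
  define b where "b = (LEAST b. b > m \<and> b \<in> K)"
  have b: "b > m" "b \<in> K"
    using LeastI[of "\<lambda>b. b > m \<and> b \<in> K" c] \<open>c > m\<close> c by (auto simp: b_def)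
  have least: "b' \<notin> K" if "m < b'" "b' < b" for b'
    using not_less_Least[of b' "\<lambda>b. b > m \<and> b \<in> K"] that by (auto simp: b_def)
  have "b - 1 \<notin> K"
    using least[of "b - 1"] m(2) b(1) by (cases "b - 1 = m") auto
  moreover have "b \<in> {1..n}" using b K(1) by blast
  moreover have "b - 1 \<in> {1..n}" "Suc (b - 1) = b" using b m(1) \<open>b \<in> {1..n}\<close> by auto
  ultimately show thesis
    using that[of "b - 1"] b(2) by metis
qed

text \<open>The summation index is a set of values, so it is the same for every ordering of
  \<open>Z\<close>. Keeping \<open>z\<close> and \<open>z'\<close> separate allows for the mixed
  pairings that the exchange relations create.\<close>

definition pairing ::
    "nat \<Rightarrow> nat \<Rightarrow> 'a set \<Rightarrow> ('a set \<Rightarrow> 'a::field) \<Rightarrow> 'a \<Rightarrow> (nat \<Rightarrow> 'a) \<Rightarrow> (nat \<Rightarrow> 'a) \<Rightarrow> 'a \<Rightarrow> nat set \<Rightarrow> nat set \<Rightarrow> 'a"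
  where "pairing n k Z \<omega> lm z z' y J K =
     (\<Sum>U | U \<subseteq> Z \<and> card U = k. weight_sum n lm z y K U * weight_sum_opp n lm z' y J U * \<omega> U)"

lemma pairing_exchange_left:
  fixes z z' :: "nat \<Rightarrow> 'a::field" and lm y :: 'a
  assumes a: "a \<in> {1..n}" "Suc a \<in> {1..n}" and K: "finite K" "a \<in> K" "Suc a \<notin> K"
  defines "s \<equiv> transpose a (Suc a)"
  defines "d \<equiv> z a - z (Suc a)" and "\<mu> \<equiv> lm - of_int (wt n a K) * y"
  shows "\<mu> * d * pairing n k Z \<omega> lm z z' y J (s ` K) =
    y * (d + \<mu> - y) * pairing n k Z \<omega> lm z z' y J K +
    (\<mu> - y) * (d - y) * pairing n k Z \<omega> lm (z \<circ> s) z' y J K"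
proof -
  have "\<mu> * d * (weight_sum n lm z y (s ` K) U * weight_sum_opp n lm z' y J U * \<omega> U) =
    y * (d + \<mu> - y) * (weight_sum n lm z y K U * weight_sum_opp n lm z' y J U * \<omega> U) +
    (\<mu> - y) * (d - y) * (weight_sum n lm (z \<circ> s) y K U * weight_sum_opp n lm z' y J U * \<omega> U)" for U
    using arg_cong[OF weight_sum_exchange[OF a K, of lm y z U],
        of "\<lambda>x. x * (weight_sum_opp n lm z' y J U * \<omega> U)"]
    unfolding s_def[symmetric] d_def[symmetric] \<mu>_def[symmetric]
    by (simp only: distrib_right mult.assoc)
  then show ?thesis
    by (simp only: pairing_def sum_distrib_left sum.distrib[symmetric])
qed

lemma linear_relation_times:
  fixes c :: "'a::comm_ring_1"
  assumes "c * x = c1 * x1 + c2 * x2"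
  shows "c * (u * x * v) = c1 * (u * x1 * v) + c2 * (u * x2 * v)"
proof -
  have "c * (u * x * v) = (c * x) * (u * v)" by (simp only: mult_ac)
  also have "\<dots> = c1 * (u * x1 * v) + c2 * (u * x2 * v)"
    unfolding assms distrib_right by (simp only: mult_ac)
  finally show ?thesis .
qed

lemma pairing_exchange_right:
  fixes z z' :: "nat \<Rightarrow> 'a::field" and lm y :: 'a
  assumes a: "a \<in> {1..n}" "Suc a \<in> {1..n}" and J: "J \<subseteq> {1..n}" "a \<in> J" "Suc a \<notin> J"
  defines "s \<equiv> transpose a (Suc a)"
  defines "d \<equiv> z' a - z' (Suc a)" and "\<mu> \<equiv> lm - of_int (wt n a J) * y"
  shows "(2 * y - \<mu>) * d * pairing n k Z \<omega> lm z z' y J K =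
    y * (d + \<mu> - y) * pairing n k Z \<omega> lm z z' y (s ` J) K +
    (y - \<mu>) * (d + y) * pairing n k Z \<omega> lm z (z' \<circ> s) y (s ` J) K"
proof -
  have "(2 * y - \<mu>) * d * (weight_sum n lm z y K U * weight_sum_opp n lm z' y J U * \<omega> U) =
    y * (d + \<mu> - y) * (weight_sum n lm z y K U * weight_sum_opp n lm z' y (s ` J) U * \<omega> U) +
    (y - \<mu>) * (d + y) * (weight_sum n lm z y K U * weight_sum_opp n lm (z' \<circ> s) y (s ` J) U * \<omega> U)" for U
    unfolding s_def d_def \<mu>_def by (rule linear_relation_times[OF weight_sum_opp_exchange[OF a J]])
  then show ?thesis
    by (simp only: pairing_def sum_distrib_left sum.distrib[symmetric])
qed

text \<open>
  The induction moves a subset away from \<open>{1..k}\<close> by adjacent transpositions. The weight \<open>\<omega>\<close> does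
  not depend on the order of the points, which is why the statement has to be proved for all
  orderings \<open>z\<close> of \<open>Z\<close> at once.
\<close>

lemma pairing_step:
  fixes lm y :: "'a::field" and Z :: "'a set"
  assumes two: "(2::'a) \<noteq> 0"
    and Zy: "\<And>u v. u \<in> Z \<Longrightarrow> v \<in> Z \<Longrightarrow> u - v + y \<noteq> 0"
    and lm: "\<And>m. lm - of_int m * y \<noteq> 0"
    and a: "a \<in> {1..n}" "Suc a \<in> {1..n}" and K: "K \<subseteq> {1..n}" "card K = k" "a \<in> K" "Suc a \<notin> K"
    and IH: "\<And>z J. bij_betw z {1..n} Z \<Longrightarrow> J \<subseteq> {1..n} \<Longrightarrow> card J = k \<Longrightarrow>
      pairing n k Z \<omega> lm z z y J K = (if J = K then C_fun n 0 K lm y * C_fun n 1 K lm y else 0)"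
    and z: "bij_betw z {1..n} Z" and J: "J \<subseteq> {1..n}" "card J = k"
  defines "s \<equiv> transpose a (Suc a)"
  shows "pairing n k Z \<omega> lm z z y J (s ` K) =
    (if J = s ` K then C_fun n 0 (s ` K) lm y * C_fun n 1 (s ` K) lm y else 0)"
proof -
  define \<mu> where "\<mu> = lm - of_int (wt n a K) * y"
  define d where "d = z a - z (Suc a)"
  define C where "C K = C_fun n 0 K lm y * C_fun n 1 K lm y" for K
  define p where "p = pairing n k Z \<omega> lm"
  have ss: "s ` s ` I = I" for I by (simp add: s_def image_image)
  have zs: "z \<circ> s \<circ> s = z" by (simp add: s_def comp_def)
  have bzs: "bij_betw (z \<circ> s) {1..n} Z"
    unfolding s_def by (rule bij_betw_trans[OF transpose_Suc_bij[OF a] z])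
  have sub: "s ` I \<subseteq> {1..n}" "card (s ` I) = card I" if "I \<subseteq> {1..n}" for I
    unfolding s_def using transpose_image_subset[OF a that] card_transpose_image by auto
  have mem: "a \<in> s ` I \<longleftrightarrow> Suc a \<in> I" "Suc a \<in> s ` I \<longleftrightarrow> a \<in> I" for I
    by (simp_all add: s_def transpose_image_mem)
  have nz: "lm - of_int m * y \<noteq> 0" "lm - of_int m * y - y \<noteq> 0" "lm - of_int m * y - 2 * y \<noteq> 0" for m
    using lm[of m] lm[of "m + 1"] lm[of "m + 2"] by (simp_all add: algebra_simps)
  have inZ: "z a \<in> Z" "z (Suc a) \<in> Z" using z a bij_betwE by blast+
  have "z a \<noteq> z (Suc a)"
    using inj_onD[OF bij_betw_imp_inj_on[OF z], of a "Suc a"] a by auto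
  then have d0: "d \<noteq> 0" by (simp add: d_def)
  have dy: "d - y \<noteq> 0"
    using Zy[OF inZ(2,1)] by (simp add: d_def algebra_simps)
  have \<mu>: "\<mu> \<noteq> 0" "\<mu> - y \<noteq> 0" "2 * y - \<mu> \<noteq> 0" unfolding \<mu>_def using nz[of "wt n a K"] by auto
  \<comment> \<open>The factor \<open>\<mu> - y\<close> occurs in the ratios for both
    \<open>r = 0\<close> and \<open>r = 1\<close> and cancels from their product.\<close>
  have CK: "\<mu> * C (s ` K) = (\<mu> - 2 * y) * C K"
  proof -
    have 1: "\<mu> * C_fun n 0 (s ` K) lm y = (\<mu> - y) * C_fun n 0 K lm y"
      using C_fun_transpose[OF a K(1,3,4), of lm y 0] by (simp add: \<mu>_def s_def)
    have 2: "(\<mu> - y) * C_fun n 1 (s ` K) lm y = (\<mu> - 2 * y) * C_fun n 1 K lm y"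
      using C_fun_transpose[OF a K(1,3,4), of lm y 1] by (simp add: \<mu>_def s_def)
    have "(\<mu> - y) * (\<mu> * C (s ` K)) = (\<mu> * C_fun n 0 (s ` K) lm y) * ((\<mu> - y) * C_fun n 1 (s ` K) lm y)"
      by (simp add: C_def mult_ac)
    also have "\<dots> = (\<mu> - y) * ((\<mu> - 2 * y) * C K)"
      unfolding 1 2 by (simp only: C_def mult.assoc mult.commute mult.left_commute)
    finally show ?thesis using \<mu> by simp
  qed
  \<comment> \<open>The last pairing is mixed and not covered by the induction hypothesis;
    \<open>mixed\<close> computes it below.\<close>
  have L: "\<mu> * d * p z z y I (s ` K) = y * (d + \<mu> - y) * p z z y I K + (\<mu> - y) * (d - y) * p (z \<circ> s) z y I K" for I
    unfolding p_def \<mu>_def d_def s_def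
    by (rule pairing_exchange_left[OF a finite_subset[OF K(1) finite_atLeastAtMost] K(3,4)])
  have IHz: "p z z y I K = (if I = K then C K else 0)" if "I \<subseteq> {1..n}" "card I = k" for I
    unfolding p_def C_def using IH[OF z that] .
  have IHs: "p (z \<circ> s) (z \<circ> s) y I K = (if I = K then C K else 0)" if "I \<subseteq> {1..n}" "card I = k" for I
    unfolding p_def C_def using IH[OF bzs that] .
  \<comment> \<open>The opposite exchange relation is applied to the second factor with ordering
    \<open>z \<circ> s\<close> and with ordering \<open>z\<close>. In both, the unmixed pairing of
    \<open>K\<close> with the swapped set is \<open>0\<close>, since that set does not contain
    \<open>a\<close>. The first relation then gives the mixed pairing at the swapped set, the second
    the one at \<open>I\<close>.\<close>
  have mixed: "(2 * y - \<mu>') * d * c = (y - \<mu>') * (d - y) * p (z \<circ> s) z y (s ` I) K \<and>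
      (2 * y - \<mu>') * d * p (z \<circ> s) z y I K = y * (d + \<mu>' - y) * p (z \<circ> s) z y (s ` I) K"
    if I: "I \<subseteq> {1..n}" "card I = k" "a \<in> I" "Suc a \<notin> I"
      and \<mu>': "\<mu>' = lm - of_int (wt n a I) * y" and c: "c = (if I = K then C K else 0)" for I \<mu>' c
  proof
    have "a \<notin> s ` I" using I mem by simp
    then have "s ` I \<noteq> K" using K by blast
    then have 0: "p (z \<circ> s) (z \<circ> s) y (s ` I) K = 0"
      using IHs[of "s ` I"] sub[OF I(1)] I(2) by simp
    have ds: "(z \<circ> s) a - (z \<circ> s) (Suc a) = - d" by (simp add: s_def d_def)
    have "(2 * y - \<mu>') * (- d) * p (z \<circ> s) (z \<circ> s) y I K =
      y * (- d + \<mu>' - y) * p (z \<circ> s) (z \<circ> s) y (s ` I) K +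
      (y - \<mu>') * (- d + y) * p (z \<circ> s) (z \<circ> s \<circ> s) y (s ` I) K"
      using pairing_exchange_right[OF a I(1,3,4), where z = "z \<circ> s" and z' = "z \<circ> s" and lm = lm and y = y
          and k = k and Z = Z and \<omega> = \<omega> and K = K, folded \<mu>' p_def, folded s_def, unfolded ds] .
    then show "(2 * y - \<mu>') * d * c = (y - \<mu>') * (d - y) * p (z \<circ> s) z y (s ` I) K"
      unfolding 0 zs IHs[OF I(1,2)] c[symmetric] by (simp add: algebra_simps)
    show "(2 * y - \<mu>') * d * p (z \<circ> s) z y I K = y * (d + \<mu>' - y) * p (z \<circ> s) z y (s ` I) K"
      using pairing_exchange_right[OF a I(1,3,4), where z = "z \<circ> s" and z' = z and lm = lm and y = y
          and k = k and Z = Z and \<omega> = \<omega> and K = K, folded \<mu>' p_def d_def, folded s_def] 0 by simp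
  qed
  have off: "p (z \<circ> s) z y I K = 0 \<and> p (z \<circ> s) z y (s ` I) K = 0"
    if I: "I \<subseteq> {1..n}" "card I = k" "a \<in> I" "Suc a \<notin> I" "I \<noteq> K" for I
  proof -
    define \<mu>' where "\<mu>' = lm - of_int (wt n a I) * y"
    have nz': "y - \<mu>' \<noteq> 0" "2 * y - \<mu>' \<noteq> 0"
      using nz(2,3)[of "wt n a I"] unfolding \<mu>'_def by auto
    have m: "(2 * y - \<mu>') * d * 0 = (y - \<mu>') * (d - y) * p (z \<circ> s) z y (s ` I) K \<and>
        (2 * y - \<mu>') * d * p (z \<circ> s) z y I K = y * (d + \<mu>' - y) * p (z \<circ> s) z y (s ` I) K"
      by (rule mixed[OF I(1-4) \<mu>'_def]) (use I(5) in simp)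
    then have "p (z \<circ> s) z y (s ` I) K = 0" using nz' dy by simp
    with m show ?thesis using nz' d0 by simp
  qed
  have M: "(2 * y - \<mu>) * d * C K = (y - \<mu>) * (d - y) * p (z \<circ> s) z y (s ` K) K \<and>
      (2 * y - \<mu>) * d * p (z \<circ> s) z y K K = y * (d + \<mu> - y) * p (z \<circ> s) z y (s ` K) K"
    by (rule mixed[OF K \<mu>_def]) simp
  note M1 = conjunct1[OF M] and M2 = conjunct2[OF M]
  have KsK: "K \<noteq> s ` K" using K mem by blast
  \<comment> \<open>If exactly one of \<open>a\<close>, \<open>Suc a\<close> lies in
    \<open>J\<close>, then \<open>J\<close> or its swap has the lower site occupied and can serve as
    \<open>I\<close> above; otherwise the second factor is insensitive to the swap.\<close>
  consider "J = K" | "J = s ` K" | "a \<in> J \<longleftrightarrow> Suc a \<in> J" | "a \<in> J" "Suc a \<notin> J" "J \<noteq> K"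
    | "a \<notin> J" "Suc a \<in> J" "J \<noteq> s ` K" by blast
  then have "p z z y J (s ` K) = (if J = s ` K then C (s ` K) else 0)"
  proof cases
    case 1
    \<comment> \<open>Multiplying by \<open>(2 * y - \<mu>) * d\<close> makes \<open>M1\<close> and
      \<open>M2\<close> applicable; both terms become multiples of the same mixed pairing, with
      opposite coefficients.\<close>
    have "(2 * y - \<mu>) * d * (\<mu> * d * p z z y K (s ` K)) =
      y * (d + \<mu> - y) * ((2 * y - \<mu>) * d * C K) +
      (\<mu> - y) * (d - y) * ((2 * y - \<mu>) * d * p (z \<circ> s) z y K K)"
      unfolding L using IHz[OF K(1,2)] by (simp add: algebra_simps)
    also have "\<dots> = 0"
      unfolding M1 M2 by (simp add: algebra_simps)
    finally have "p z z y K (s ` K) = 0"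
      using \<mu> d0 by simp
    then show ?thesis
      using KsK 1 by simp
  next
    case 2
    have "p z z y (s ` K) K = 0"
      using IHz[of "s ` K"] sub[OF K(1)] K(2) KsK by simp
    \<comment> \<open>Only the mixed pairing survives, and \<open>M1\<close> with \<open>CK\<close>
      turns it into the new diagonal entry.\<close>
    then have "\<mu> * d * p z z y (s ` K) (s ` K) = - ((y - \<mu>) * (d - y) * p (z \<circ> s) z y (s ` K) K)"
      unfolding L by (simp add: algebra_simps)
    also have "\<dots> = d * (\<mu> * C (s ` K))"
      unfolding M1[symmetric] CK by (simp add: algebra_simps)
    finally show ?thesis using 2 \<mu> d0 by simp
  next
    case 3
    have "J \<noteq> K" "J \<noteq> s ` K" using 3 K mem by blast+
    \<comment> \<open>The swap does not affect the second factor, so its points may be reordered to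
      make the mixed pairing unmixed.\<close>
    have "p (z \<circ> s) z y J K = p (z \<circ> s) (z \<circ> s) y J K"
      unfolding p_def pairing_def s_def weight_sum_opp_transpose[OF a J(1) 3 two] ..
    then have "p (z \<circ> s) z y J K = 0"
      using IHs[OF J] \<open>J \<noteq> K\<close> by simp
    then have "\<mu> * d * p z z y J (s ` K) = 0"
      unfolding L using IHz[OF J] \<open>J \<noteq> K\<close> by simp
    then show ?thesis using \<mu> d0 \<open>J \<noteq> s ` K\<close> by simp
  next
    case 4
    then have "J \<noteq> s ` K" using K mem by blast
    have "\<mu> * d * p z z y J (s ` K) = 0"
      unfolding L using IHz[OF J] 4(3) off[OF J 4] by simp
    then show ?thesis using \<mu> d0 \<open>J \<noteq> s ` K\<close> by simp
  next
    case 5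
    then have "J \<noteq> K" using K by blast
    have "s ` J \<noteq> K" using 5(3) ss by blast
    then have "p (z \<circ> s) z y (s ` s ` J) K = 0"
      using off[of "s ` J"] sub[OF J(1)] J(2) 5 mem by simp
    then have "\<mu> * d * p z z y J (s ` K) = 0"
      unfolding L using IHz[OF J] \<open>J \<noteq> K\<close> ss by simp
    then show ?thesis using \<mu> d0 5 by simp
  qed
  then show ?thesis by (simp add: p_def C_def)
qed


section \<open>Base case: the initial subset \<open>{1..k}\<close>\<close>

lemma diag_prod_image:
  fixes z :: "nat \<Rightarrow> 'a::field"
  assumes z: "inj_on z K" and K: "finite K"
  shows "y ^ card K * (\<Prod>i\<in>K. \<Prod>a\<in>K - {i}. z i - z a + y) = (\<Prod>u\<in>z ` K. \<Prod>v\<in>z ` K. u - v + y)"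
proof -
  have "(\<Prod>u\<in>z ` K. \<Prod>v\<in>z ` K. u - v + y) = (\<Prod>i\<in>K. \<Prod>a\<in>K. z i - z a + y)"
    using z by (simp add: prod.reindex)
  also have "\<dots> = (\<Prod>i\<in>K. y * (\<Prod>a\<in>K - {i}. z i - z a + y))"
    using K by (intro prod.cong refl) (simp add: prod.remove)
  also have "\<dots> = y ^ card K * (\<Prod>i\<in>K. \<Prod>a\<in>K - {i}. z i - z a + y)"
    by (simp add: prod.distrib)
  finally show ?thesis ..
qed

lemma compl_prod_image:
  fixes z :: "nat \<Rightarrow> 'a::field"
  assumes z: "bij_betw z {1..n} Z" and K: "K \<subseteq> {1..n}"
  shows "(\<Prod>u\<in>z ` K. \<Prod>v\<in>Z - z ` K. f u v) = (\<Prod>i\<in>K. \<Prod>a\<in>{1..n} - K. f (z i) (z a))"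
proof -
  have inj: "inj_on z {1..n}" and Z: "Z = z ` {1..n}" using z by (auto simp: bij_betw_def)
  have "Z - z ` K = z ` ({1..n} - K)"
    unfolding Z using inj_on_image_set_diff[OF inj Diff_subset K] by simp
  moreover have "inj_on z K" "inj_on z ({1..n} - K)"
    using inj K by (auto intro: inj_on_subset)
  ultimately show ?thesis by (simp add: prod.reindex)
qed

text \<open>No site outside \<open>{1..k}\<close> lies below an element of it, so all complementary
  factors are of the form without \<open>y\<close>. The power \<open>y ^ k\<close> supplies the
  diagonal factors \<open>u - u + y\<close> of the double product over \<open>U\<close>.\<close>

lemma weight_sum_initial:
  fixes z :: "nat \<Rightarrow> 'a::field" and lm y :: 'a
  assumes z: "bij_betw z {1..n} Z" and k: "k \<le> n"
  defines "U \<equiv> z ` {1..k}"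
  shows "y ^ k * weight_sum n lm z y {1..k} U =
    C_fun n 0 {1..k} lm y * (\<Prod>u\<in>U. \<Prod>v\<in>U. u - v + y) * (\<Prod>u\<in>U. \<Prod>v\<in>Z - U. u - v)"
proof -
  have K: "{1..k} \<subseteq> {1..n}" using k by auto
  have inj: "inj_on z {1..n}" using z by (simp add: bij_betw_def)
  have "(\<Prod>i\<in>{1..k}. \<Prod>a\<in>{1..n} - {1..k}. if a < i then z i - z a + y else z i - z a) =
      (\<Prod>u\<in>U. \<Prod>v\<in>Z - U. u - v)"
    unfolding U_def compl_prod_image[OF z K] by (intro prod.cong refl) auto
  moreover have "y ^ k * (\<Prod>i\<in>{1..k}. \<Prod>a\<in>{1..k} - {i}. z i - z a + y) = (\<Prod>u\<in>U. \<Prod>v\<in>U. u - v + y)"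
    using diag_prod_image[OF inj_on_subset[OF inj K]] by (simp add: U_def)
  ultimately show ?thesis
    unfolding U_def weight_sum_diag[OF inj K] weight_term_diag[OF inj K] C_fun_def
    by (simp add: algebra_simps)
qed

text \<open>Reflection sends \<open>{1..k}\<close> to the top \<open>k\<close> sites, so every
  complementary site now lies below and contributes \<open>+ y\<close>: this gives \<open>Q\<close>
  where \<open>weight_sum_initial\<close> gives \<open>R\<close>.\<close>

lemma weight_sum_opp_initial:
  fixes z :: "nat \<Rightarrow> 'a::field" and lm y :: 'a
  assumes z: "bij_betw z {1..n} Z" and k: "k \<le> n"
  defines "U \<equiv> z ` {1..k}"
  shows "y ^ k * weight_sum_opp n lm z y {1..k} U =
    (- 1) ^ k * C_fun n 1 {1..k} lm y * (\<Prod>u\<in>U. \<Prod>v\<in>U. u - v + y) * (\<Prod>u\<in>U. \<Prod>v\<in>Z - U. u - v + y)"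
proof -
  define T where "T = refl_idx n ` {1..k}"
  define z' where "z' = z \<circ> refl_idx n"
  define lm' where "lm' = - lm - of_int (int n - 2 * int k) * y"
  have K: "{1..k} \<subseteq> {1..n}" using k by auto
  have T: "T \<subseteq> {1..n}" unfolding T_def using K refl_idx_in by blast
  have cT: "card T = k" unfolding T_def using card_refl_idx[OF K] by simp
  have z': "bij_betw z' {1..n} Z"
    unfolding z'_def by (rule bij_betw_trans[OF refl_idx_bij z])
  have inj: "inj_on z' {1..n}" using z' by (simp add: bij_betw_def)
  have rr: "refl_idx n (refl_idx n i) = i" if "i \<in> {1..k}" for i
    using refl_idx_refl_idx K that by blast
  have U: "U = z' ` T"
    unfolding U_def z'_def T_def image_comp by (rule image_cong) (use rr in auto)
  have injr: "inj_on (refl_idx n) {1..k}" by (rule inj_on_inverseI[of _ "refl_idx n"]) (rule rr)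
  have up: "a < i" if "i \<in> T" "a \<in> {1..n} - T" for i a
  proof -
    have "refl_idx n a \<notin> {1..k}" "refl_idx n i \<in> {1..k}"
      using that refl_idx_mem[OF K, of a] refl_idx_mem[OF K, of i] T by (auto simp: T_def)
    then show ?thesis using that T by (auto simp: refl_idx_def)
  qed
  have 1: "(\<Prod>i\<in>T. \<Prod>a\<in>{1..n} - T. if a < i then z' i - z' a + y else z' i - z' a) =
      (\<Prod>u\<in>U. \<Prod>v\<in>Z - U. u - v + y)"
    unfolding U compl_prod_image[OF z' T] by (intro prod.cong refl) (use up in auto)
  have 2: "y ^ k * (\<Prod>i\<in>T. \<Prod>a\<in>T - {i}. z' i - z' a + y) = (\<Prod>u\<in>U. \<Prod>v\<in>U. u - v + y)"
    using diag_prod_image[OF inj_on_subset[OF inj T] finite_subset[OF T finite_atLeastAtMost]]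
    by (simp add: U cT)
  have 3: "(\<Prod>i\<in>T. lm' - of_int (wt n i T) * y) = (- 1) ^ k * C_fun n 1 {1..k} lm y"
  proof -
    have "(\<Prod>i\<in>T. lm' - of_int (wt n i T) * y) = (\<Prod>j\<in>{1..k}. lm' - of_int (wt n (refl_idx n j) T) * y)"
      using prod.reindex[OF injr, of "\<lambda>i. lm' - of_int (wt n i T) * y"] by (simp add: T_def comp_def)
    also have "\<dots> = (\<Prod>j\<in>{1..k}. (- 1) * (lm - of_int (wt n j {1..k} + 1) * y))"
    proof (rule prod.cong[OF refl])
      fix j assume "j \<in> {1..k}"
      then have w: "wt n (refl_idx n j) T = 2 * int k - 1 - int n - wt n j {1..k}"
        unfolding T_def using wt_refl_idx[OF K] by simp
      \<comment> \<open>The reflected weight turns the shifted parameter into minus the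
        \<open>r = 1\<close> factor of \<open>C_fun\<close>, with one sign for each of the
        \<open>k\<close> elements.\<close>
      show "lm' - of_int (wt n (refl_idx n j) T) * y = (- 1) * (lm - of_int (wt n j {1..k} + 1) * y)"
        unfolding w lm'_def by (simp add: algebra_simps)
    qed
    also have "\<dots> = (- 1) ^ k * C_fun n 1 {1..k} lm y"
      unfolding C_fun_def prod.distrib by simp
    finally show ?thesis .
  qed
  have "weight_sum_opp n lm z y {1..k} U = weight_sum n lm' z' y T U"
    by (simp add: weight_sum_opp_def lm'_def z'_def T_def)
  also have "\<dots> = ((- 1) ^ k * C_fun n 1 {1..k} lm y) * (\<Prod>i\<in>T. \<Prod>a\<in>T - {i}. z' i - z' a + y) *
      (\<Prod>u\<in>U. \<Prod>v\<in>Z - U. u - v + y)"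
    using weight_sum_diag[OF inj T, of lm' y] weight_term_diag[OF inj T, of lm' y] 1 3 by (simp add: U)
  finally show ?thesis
    unfolding 2[symmetric] by (simp add: algebra_simps)
qed

text \<open>A bijection from \<open>{1..k}\<close> that raises no index has its image inside
  \<open>{1..k}\<close>, hence equal to it.\<close>

lemma weight_sum_initial_eq_0:
  assumes z: "bij_betw z {1..n} Z" and k: "k \<le> n" and U: "U \<subseteq> Z" "card U = k" "U \<noteq> z ` {1..k}"
  shows "weight_sum n lm z y {1..k} U = 0"
proof -
  have inj: "inj_on z {1..n}" and Z: "Z = z ` {1..n}" using z by (auto simp: bij_betw_def)
  obtain A where A: "A \<subseteq> {1..n}" "U = z ` A" using U(1) unfolding Z by (meson subset_imageE)
  have cA: "card A = k"
    using card_image[OF inj_on_subset[OF inj A(1)]] A(2) U(2) by simp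
  show ?thesis
    unfolding A(2)
  proof (rule weight_sum_eq_0[OF inj A(1)])
    show "{1..k} \<subseteq> {1..n}" using k by auto
    fix \<alpha> assume \<alpha>: "bij_betw \<alpha> {1..k} A" "\<And>i. i \<in> {1..k} \<Longrightarrow> \<alpha> i \<le> i"
    have "A \<subseteq> {1..k}"
    proof
      fix x assume x: "x \<in> A"
      then obtain i where "i \<in> {1..k}" "x = \<alpha> i"
        using \<alpha>(1) by (metis bij_betw_imp_surj_on imageE)
      then have "x \<le> k" using \<alpha>(2)[of i] by simp
      then show "x \<in> {1..k}" using A(1) x by auto
    qed
    then have "A = {1..k}" using cA by (intro card_subset_eq) auto
    then show False using A(2) U(3) by simp
  qed
qed

text \<open>After reflection the point \<open>{1..k}\<close> becomes the top \<open>k\<close> sites.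
  A bijection onto them that raises no index must start from the same sites, because anything above
  a top site is a top site.\<close>

lemma weight_sum_opp_initial_eq_0:
  assumes z: "bij_betw z {1..n} Z" and k: "k \<le> n" and J: "J \<subseteq> {1..n}" "card J = k" "J \<noteq> {1..k}"
  shows "weight_sum_opp n lm z y J (z ` {1..k}) = 0"
proof -
  define T where "T = refl_idx n ` {1..k}"
  have K: "{1..k} \<subseteq> {1..n}" using k by auto
  have T: "T \<subseteq> {1..n}" unfolding T_def using K refl_idx_in by blast
  have cT: "card T = k" unfolding T_def using card_refl_idx[OF K] by simp
  have rJ: "refl_idx n ` J \<subseteq> {1..n}" using J refl_idx_in by blast
  have z': "bij_betw (z \<circ> refl_idx n) {1..n} Z"
    by (rule bij_betw_trans[OF refl_idx_bij z])
  have inj: "inj_on (z \<circ> refl_idx n) {1..n}" using z' by (simp add: bij_betw_def)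
  have rr: "refl_idx n (refl_idx n i) = i" if "i \<in> {1..n}" for i
    using refl_idx_refl_idx that by blast
  have U: "z ` {1..k} = (z \<circ> refl_idx n) ` T"
    unfolding T_def image_comp by (rule image_cong) (use rr K in auto)
  show ?thesis
    unfolding weight_sum_opp_def U
  proof (rule weight_sum_eq_0[OF inj T rJ])
    fix \<alpha> assume \<alpha>: "bij_betw \<alpha> (refl_idx n ` J) T" "\<And>i. i \<in> refl_idx n ` J \<Longrightarrow> \<alpha> i \<le> i"
    have "refl_idx n ` J \<subseteq> T"
    proof
      fix i assume i: "i \<in> refl_idx n ` J"
      then have "\<alpha> i \<in> T" using \<alpha>(1) bij_betwE by blast
      then have "refl_idx n (\<alpha> i) \<in> {1..k}"
        unfolding T_def using rr K by auto
      moreover have "refl_idx n i \<le> refl_idx n (\<alpha> i)"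
        using \<alpha>(2)[OF i] by (simp add: refl_idx_def)
      moreover have "refl_idx n i \<in> {1..n}" "i \<in> {1..n}" using i rJ refl_idx_in by blast+
      ultimately have "refl_idx n i \<in> {1..k}" by auto
      then show "i \<in> T" using refl_idx_mem[OF K \<open>i \<in> {1..n}\<close>] by (simp add: T_def)
    qed
    then have eq: "refl_idx n ` J = T"
      using card_refl_idx[OF J(1)] J(2) cT T by (intro card_subset_eq) (auto intro: finite_subset)
    have "J \<subseteq> {1..k}"
    proof
      fix j assume j: "j \<in> J"
      then obtain i where i: "i \<in> {1..k}" "refl_idx n j = refl_idx n i"
        using eq unfolding T_def by blast
      then show "j \<in> {1..k}" using rr[of i] rr[of j] j J(1) K by (metis in_mono)
    qed
    then have "J = {1..k}" using J(2) by (intro card_subset_eq) auto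
    then show False using J(3) by simp
  qed
qed

text \<open>Induction on the sum of the elements of \<open>K\<close>: an adjacent gap exhibits
  \<open>K\<close> as the swap of a set \<open>K'\<close> whose sum is lower by one, and
  \<open>pairing_step\<close> passes from \<open>K'\<close> to \<open>K\<close>. The weight
  \<open>\<omega>\<close> collects the sign, the powers of \<open>y\<close>, the two
  \<open>e_fun\<close> denominators and \<open>R * Q\<close>; it depends on \<open>U\<close> and
  \<open>Z\<close> only.\<close>

theorem weight_sum_biorthogonal:
  fixes lm y :: "'a::field" and Z :: "'a set"
  assumes two: "(2::'a) \<noteq> 0"
    and Zy: "\<And>u v. u \<in> Z \<Longrightarrow> v \<in> Z \<Longrightarrow> u - v + y \<noteq> 0"
    and lm: "\<And>m. lm - of_int m * y \<noteq> 0"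
    and y: "y \<noteq> 0"
    and z: "bij_betw z {1..n} Z"
    and J: "J \<subseteq> {1..n}" "card J = k" and K: "K \<subseteq> {1..n}" "card K = k"
  defines "\<omega> \<equiv> \<lambda>U. (- 1) ^ k * y ^ k * y ^ k / ((\<Prod>u\<in>U. \<Prod>v\<in>U. u - v + y) * (\<Prod>u\<in>U. \<Prod>v\<in>U. u - v + y) *
     ((\<Prod>u\<in>U. \<Prod>v\<in>Z - U. u - v) * (\<Prod>u\<in>U. \<Prod>v\<in>Z - U. u - v + y)))"
  shows "pairing n k Z \<omega> lm z z y J K = (if J = K then C_fun n 0 K lm y * C_fun n 1 K lm y else 0)"
  using z J K
proof (induction "\<Sum>K" arbitrary: K z J rule: less_induct)
  case less
  have fin: "finite K" using less.prems(4) finite_subset by blast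
  have k: "k \<le> n" using card_mono[OF _ less.prems(4)] less.prems(5) by simp
  show ?case
  proof (cases "K = {1..k}")
    case True
    define U0 where "U0 = z ` {1..k}"
    define E where "E = (\<Prod>u\<in>U0. \<Prod>v\<in>U0. u - v + y)"
    define R where "R = (\<Prod>u\<in>U0. \<Prod>v\<in>Z - U0. u - v)"
    define Q where "Q = (\<Prod>u\<in>U0. \<Prod>v\<in>Z - U0. u - v + y)"
    have finZ: "finite Z" using less.prems(1) bij_betw_finite by blast
    have inj: "inj_on z {1..n}" and Z: "Z = z ` {1..n}" using less.prems(1) by (auto simp: bij_betw_def)
    have U0: "U0 \<subseteq> Z" "card U0 = k"
      unfolding U0_def Z using k card_image[OF inj_on_subset[OF inj, of "{1..k}"]] by auto
    have finU: "finite U0" using finite_subset[OF U0(1) finZ] .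
    have nz: "E \<noteq> 0" "R \<noteq> 0" "Q \<noteq> 0"
      unfolding E_def R_def Q_def using finU finZ U0(1) Zy by (auto simp: prod_zero_iff subset_iff)
    have "pairing n k Z \<omega> lm z z y J K =
      (\<Sum>U | U \<subseteq> Z \<and> card U = k. if U = U0 then weight_sum n lm z y K U0 * weight_sum_opp n lm z y J U0 * \<omega> U0 else 0)"
      unfolding pairing_def
      using weight_sum_initial_eq_0[OF less.prems(1) k] by (intro sum.cong refl) (auto simp: True U0_def)
    also have "\<dots> = weight_sum n lm z y K U0 * weight_sum_opp n lm z y J U0 * \<omega> U0"
      using finZ U0 by (subst sum.delta) auto
    finally have p: "pairing n k Z \<omega> lm z z y J K = \<dots>" .
    show ?thesis
    proof (cases "J = K")
      case False
      then have "weight_sum_opp n lm z y J U0 = 0"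
        unfolding U0_def using weight_sum_opp_initial_eq_0[OF less.prems(1) k less.prems(2,3)] True by simp
      then show ?thesis using p False by simp
    next
      case eq: True
      have w0: "\<omega> U0 = (- 1) ^ k * y ^ k * y ^ k / (E * E * (R * Q))"
        by (simp add: \<omega>_def E_def R_def Q_def)
      have 1: "y ^ k * weight_sum n lm z y K U0 = C_fun n 0 K lm y * E * R"
        unfolding True U0_def E_def R_def by (rule weight_sum_initial[OF less.prems(1) k])
      have 2: "y ^ k * weight_sum_opp n lm z y K U0 = (- 1) ^ k * C_fun n 1 K lm y * E * Q"
        unfolding True U0_def E_def Q_def by (rule weight_sum_opp_initial[OF less.prems(1) k])
      have "pairing n k Z \<omega> lm z z y J K =
        (- 1) ^ k * ((y ^ k * weight_sum n lm z y K U0) * (y ^ k * weight_sum_opp n lm z y K U0)) / (E * E * (R * Q))"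
        unfolding p w0 unfolding eq by (simp add: mult_ac)
      also have "\<dots> = ((- 1) ^ k * (- 1) ^ k) * (C_fun n 0 K lm y * C_fun n 1 K lm y)"
        unfolding 1 2 using nz by (simp add: field_simps)
      also have "(- 1) ^ k * (- 1) ^ k = (1::'a)"
        by (simp flip: power_mult_distrib)
      finally show ?thesis using eq by simp
    qed
  next
    case False
    then obtain a where a: "a \<in> {1..n}" "Suc a \<in> {1..n}" "a \<notin> K" "Suc a \<in> K"
      using exists_adjacent_gap[OF less.prems(4)] less.prems(5) by metis
    define s where "s = transpose a (Suc a)"
    define K' where "K' = s ` K"
    have K': "K' \<subseteq> {1..n}" "card K' = k" "a \<in> K'" "Suc a \<notin> K'"
      unfolding K'_def s_def using transpose_image_subset[OF a(1,2) less.prems(4)] less.prems(5) a(3,4)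
      by (simp_all add: card_transpose_image transpose_image_mem)
    have sK': "s ` K' = K" by (simp add: K'_def s_def image_image)
    have "\<Sum>K' < \<Sum>K"
    proof -
      have "K' = insert a (K - {Suc a})"
        unfolding K'_def s_def using a(3,4) by (force simp: transpose_image_mem transpose_def split: if_splits)
      then have "\<Sum>K' = a + \<Sum>(K - {Suc a})" using fin a(3) by simp
      moreover have "\<Sum>K = Suc a + \<Sum>(K - {Suc a})" using sum.remove[OF fin a(4), of "\<lambda>x. x"] by simp
      ultimately show ?thesis by simp
    qed
    from pairing_step[OF two Zy lm a(1,2) K' less.hyps[OF this _ _ _ K'(1,2)] less.prems(1-3), folded s_def, unfolded sK']
    show ?thesis by blast
  qed
qed

section \<open>Substitution\<close>

definition subst_mon :: "(var \<Rightarrow> pol) \<Rightarrow> (var \<Rightarrow>\<^sub>0 nat) \<Rightarrow> pol"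
  where "subst_mon \<sigma> m = (\<Prod>v \<in> Poly_Mapping.keys m. \<sigma> v ^ Poly_Mapping.lookup m v)"

lemma subst_eq: "subst \<sigma> p = (\<Sum>m \<in> Poly_Mapping.keys p. Const (Poly_Mapping.lookup p m) * subst_mon \<sigma> m)"
  by (simp add: subst_def subst_mon_def)

lemma Const_simps:
  "Const 0 = 0" "Const 1 = 1" "Const (a + b) = Const a + Const b" "Const (a * b) = Const a * Const b"
  by (simp_all add: Const_def single_add mult_single)

text \<open>The support of a sum can shrink by cancellation, so the two sides of an identity are
  compared over a common finite superset, where the extra coefficients are \<open>0\<close>.\<close>

lemma subst_superset:
  assumes "finite S" "Poly_Mapping.keys p \<subseteq> S"
  shows "subst \<sigma> p = (\<Sum>m \<in> S. Const (Poly_Mapping.lookup p m) * subst_mon \<sigma> m)"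
  unfolding subst_eq by (rule sum.mono_neutral_left) (use assms in \<open>auto simp: in_keys_iff Const_simps\<close>)

lemma subst_mon_superset:
  assumes "finite S" "Poly_Mapping.keys m \<subseteq> S"
  shows "subst_mon \<sigma> m = (\<Prod>v \<in> S. \<sigma> v ^ Poly_Mapping.lookup m v)"
  unfolding subst_mon_def by (rule prod.mono_neutral_left) (use assms in \<open>auto simp: in_keys_iff\<close>)

lemma subst_mon_add: "subst_mon \<sigma> (m + m') = subst_mon \<sigma> m * subst_mon \<sigma> m'"
proof -
  let ?S = "Poly_Mapping.keys m \<union> Poly_Mapping.keys m'"
  have "finite ?S" by simp
  then show ?thesis
    using keys_add[of m m']
    by (simp add: subst_mon_superset[of ?S] lookup_add power_add prod.distrib)
qed

lemma subst_add: "subst \<sigma> (p + q) = subst \<sigma> p + subst \<sigma> q"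
proof -
  let ?S = "Poly_Mapping.keys p \<union> Poly_Mapping.keys q"
  have "finite ?S" by simp
  then show ?thesis
    using keys_add[of p q]
    by (simp add: subst_superset[of ?S] lookup_add Const_simps distrib_right sum.distrib)
qed

lemma subst_0 [simp]: "subst \<sigma> 0 = 0"
  by (simp add: subst_def)

lemma subst_sum: "subst \<sigma> (\<Sum>i\<in>A. f i) = (\<Sum>i\<in>A. subst \<sigma> (f i))"
  by (induction A rule: infinite_finite_induct) (simp_all add: subst_add)

lemma subst_single: "subst \<sigma> (Poly_Mapping.single m c) = Const c * subst_mon \<sigma> m"
  by (cases "c = 0") (simp_all add: subst_eq Const_simps)

lemma pol_expand: "p = (\<Sum>m \<in> Poly_Mapping.keys p. Poly_Mapping.single m (Poly_Mapping.lookup p m))"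
  by (rule poly_mapping_eqI)
    (auto simp: lookup_sum lookup_single when_def in_keys_iff sum.delta)

lemma subst_mult: "subst \<sigma> (p * q) = subst \<sigma> p * subst \<sigma> q"
proof -
  let ?P = "Poly_Mapping.keys p" and ?Q = "Poly_Mapping.keys q"
  let ?p = "Poly_Mapping.lookup p" and ?q = "Poly_Mapping.lookup q"
  have "p * q = (\<Sum>m\<in>?P. \<Sum>m'\<in>?Q. Poly_Mapping.single (m + m') (?p m * ?q m'))"
    by (subst (1) pol_expand[of p], subst (1) pol_expand[of q]) (simp add: sum_product mult_single)
  then have "subst \<sigma> (p * q) = (\<Sum>m\<in>?P. \<Sum>m'\<in>?Q. Const (?p m * ?q m') * subst_mon \<sigma> (m + m'))"
    by (simp add: subst_sum subst_single)
  also have "\<dots> = subst \<sigma> p * subst \<sigma> q"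
    by (simp add: subst_eq sum_product subst_mon_add Const_simps mult_ac)
  finally show ?thesis .
qed

lemma subst_Const [simp]: "subst \<sigma> (Const c) = Const c"
  by (simp add: Const_def[of c] subst_single) (simp add: Const_def subst_mon_def)

lemma subst_Var [simp]: "subst \<sigma> (Var v) = \<sigma> v"
  by (simp add: Var_def subst_single Const_simps subst_mon_def)

lemma subst_1 [simp]: "subst \<sigma> 1 = 1"
  using subst_Const[of \<sigma> 1] by (simp add: Const_simps)

lemma subst_uminus: "subst \<sigma> (- p) = - subst \<sigma> p"
  using subst_add[of \<sigma> p "- p"] by (simp add: eq_neg_iff_add_eq_0 add.commute)

lemma subst_diff: "subst \<sigma> (p - q) = subst \<sigma> p - subst \<sigma> q"
  using subst_add[of \<sigma> p "- q"] by (simp add: subst_uminus)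

lemma subst_power: "subst \<sigma> (p ^ n) = subst \<sigma> p ^ n"
  by (induction n) (simp_all add: subst_mult)

lemma subst_prod: "subst \<sigma> (\<Prod>i\<in>A. f i) = (\<Prod>i\<in>A. subst \<sigma> (f i))"
  by (induction A rule: infinite_finite_induct) (simp_all add: subst_mult)

lemmas subst_hom = subst_add subst_mult subst_uminus subst_diff subst_power subst_prod subst_sum

lemma subst_subst: "subst \<sigma> (subst \<tau> p) = subst (\<lambda>v. subst \<sigma> (\<tau> v)) p"
  by (simp add: subst_def[of \<tau>] subst_hom) (simp add: subst_def)

lemma subst_cong:
  assumes "p \<in> pols_in V" "\<And>v. v \<in> V \<Longrightarrow> \<sigma> v = \<tau> v"
  shows "subst \<sigma> p = subst \<tau> p"
  unfolding subst_def
proof (intro sum.cong refl arg_cong2[where f = "(*)"] prod.cong)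
  fix m v assume "m \<in> Poly_Mapping.keys p" "v \<in> Poly_Mapping.keys m"
  then have "v \<in> V" using assms(1) by (auto simp: pols_in_def)
  then show "\<sigma> v ^ Poly_Mapping.lookup m v = \<tau> v ^ Poly_Mapping.lookup m v"
    by (simp add: assms(2))
qed

lemma prod_single:
  "finite A \<Longrightarrow> (\<Prod>v\<in>A. Poly_Mapping.single (f v) 1 :: pol) = Poly_Mapping.single (\<Sum>v\<in>A. f v) 1"
  by (induction A rule: finite_induct) (simp_all add: mult_single)

lemma power_single: "(Poly_Mapping.single m 1 :: pol) ^ k = Poly_Mapping.single (\<Sum>i<k. m) 1"
  by (induction k) (simp_all add: mult_single add.commute)

lemma lookup_sum_const: "Poly_Mapping.lookup (\<Sum>i<(k::nat). m) v = k * Poly_Mapping.lookup m v"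
  by (simp add: lookup_sum)

lemma subst_mon_Var: "subst_mon Var m = Poly_Mapping.single m 1"
proof -
  have "subst_mon Var m =
    Poly_Mapping.single (\<Sum>v\<in>Poly_Mapping.keys m. \<Sum>i<Poly_Mapping.lookup m v. Poly_Mapping.single v 1) 1"
    by (simp add: subst_mon_def Var_def power_single prod_single)
  also have "(\<Sum>v\<in>Poly_Mapping.keys m. \<Sum>i<Poly_Mapping.lookup m v. Poly_Mapping.single v 1) = m"
    by (rule poly_mapping_eqI)
      (auto simp: lookup_sum[of _ "Poly_Mapping.keys m"] lookup_sum_const lookup_single when_def in_keys_iff
        if_distrib[of "\<lambda>x. _ * x"] sum.delta cong: if_cong)
  finally show ?thesis .
qed

lemma subst_Var_id [simp]: "subst Var p = p"
  unfolding subst_eq subst_mon_Var Const_def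
  by (simp add: mult_single flip: pol_expand)

section \<open>Polynomials in a set of variables\<close>

lemma pols_in_add: "p \<in> pols_in V \<Longrightarrow> q \<in> pols_in V \<Longrightarrow> p + q \<in> pols_in V"
  unfolding pols_in_def using keys_add[of p q] by blast

lemma pols_in_0 [simp]: "0 \<in> pols_in V" by (simp add: pols_in_def)

lemma pols_in_Const [simp]: "Const c \<in> pols_in V"
  by (simp add: pols_in_def Const_def)

lemma pols_in_1 [simp]: "1 \<in> pols_in V"
  using pols_in_Const[of 1 V] by (simp add: Const_simps)

lemma pols_in_Var: "v \<in> V \<Longrightarrow> Var v \<in> pols_in V"
  by (simp add: pols_in_def Var_def)

lemma pols_in_uminus: "p \<in> pols_in V \<Longrightarrow> - p \<in> pols_in V"
proof -
  have "Poly_Mapping.keys (- p) = Poly_Mapping.keys p" by (auto simp: in_keys_iff)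
  then show "p \<in> pols_in V \<Longrightarrow> - p \<in> pols_in V" by (simp add: pols_in_def)
qed

lemma pols_in_diff: "p \<in> pols_in V \<Longrightarrow> q \<in> pols_in V \<Longrightarrow> p - q \<in> pols_in V"
  using pols_in_add[of p V "- q"] pols_in_uminus by simp

lemma pols_in_mult: "p \<in> pols_in V \<Longrightarrow> q \<in> pols_in V \<Longrightarrow> p * q \<in> pols_in V"
  unfolding pols_in_def
proof (intro CollectI ballI)
  fix m assume p: "p \<in> {p. \<forall>m\<in>Poly_Mapping.keys p. Poly_Mapping.keys m \<subseteq> V}"
    and q: "q \<in> {p. \<forall>m\<in>Poly_Mapping.keys p. Poly_Mapping.keys m \<subseteq> V}"
    and "m \<in> Poly_Mapping.keys (p * q)"
  then obtain a b where ab: "m = a + b" "a \<in> Poly_Mapping.keys p" "b \<in> Poly_Mapping.keys q"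
    using keys_mult[of p q] by blast
  then show "Poly_Mapping.keys m \<subseteq> V" using p q keys_add[of a b] by blast
qed

lemma pols_in_sum: "(\<And>i. i \<in> A \<Longrightarrow> f i \<in> pols_in V) \<Longrightarrow> (\<Sum>i\<in>A. f i) \<in> pols_in V"
  by (induction A rule: infinite_finite_induct) (auto intro: pols_in_add)

lemma pols_in_prod: "(\<And>i. i \<in> A \<Longrightarrow> f i \<in> pols_in V) \<Longrightarrow> (\<Prod>i\<in>A. f i) \<in> pols_in V"
  by (induction A rule: infinite_finite_induct) (auto intro: pols_in_mult)

lemma pols_in_power: "p \<in> pols_in V \<Longrightarrow> p ^ k \<in> pols_in V"
  by (induction k) (auto intro: pols_in_mult)

lemma pols_in_mono: "p \<in> pols_in V \<Longrightarrow> V \<subseteq> W \<Longrightarrow> p \<in> pols_in W"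
  by (fastforce simp: pols_in_def)

lemma subst_in_pols_in:
  assumes "p \<in> pols_in W" "\<And>v. v \<in> W \<Longrightarrow> \<sigma> v \<in> pols_in V"
  shows "subst \<sigma> p \<in> pols_in V"
  unfolding subst_def using assms
  by (intro pols_in_sum pols_in_mult pols_in_prod pols_in_power pols_in_Const) (auto simp: pols_in_def[of W])

lemmas pols_in_intros = pols_in_add pols_in_mult pols_in_diff pols_in_uminus pols_in_sum pols_in_prod
  pols_in_power pols_in_0 pols_in_1 pols_in_Const pols_in_Var

section \<open>Nonvanishing linear forms\<close>

lemma Const_eq_0_iff [simp]: "Const c = 0 \<longleftrightarrow> c = 0"
  by (metis Const_def inj_single injD single_zero)

text \<open>Nonvanishing is tested by specialization: sending one variable of a linear form to
  \<open>1\<close> and all others to \<open>0\<close> leaves a nonzero constant.\<close>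

lemma nonzero_if_subst: "subst \<sigma> p \<noteq> 0 \<Longrightarrow> p \<noteq> 0"
  by auto

lemma zz_diff_nonzero: "i \<noteq> j \<Longrightarrow> zz i - zz j \<noteq> 0"
  using nonzero_if_subst[of "\<lambda>v. if v = VZ i then 1 else 0" "Var (VZ i) - Var (VZ j)"]
  by (simp add: subst_diff flip: to_fract_diff del: to_fract_diff)

lemma zz_diff_plus_yy_nonzero: "zz i - zz j + yy \<noteq> 0"
  using nonzero_if_subst[of "\<lambda>v. if v = VY then 1 else 0" "Var (VZ i) - Var (VZ j) + Var VY"]
  by (simp add: subst_diff subst_add del: to_fract_diff to_fract_add flip: to_fract_diff to_fract_add)

lemma zz_diff_minus_yy_nonzero: "zz i - zz j - yy \<noteq> 0"
  using zz_diff_plus_yy_nonzero[of j i] by (simp add: algebra_simps)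

lemma yy_nonzero: "yy \<noteq> 0"
  using zz_diff_plus_yy_nonzero[of i i] by simp

lemma of_int_to_fract: "of_int m = to_fract (of_int m :: 'a::idom)"
proof (cases m)
  case (nonneg n)
  have "of_nat n = to_fract (of_nat n :: 'a)" by (induction n) simp_all
  then show ?thesis using nonneg by simp
next
  case (neg n)
  have "of_nat n = to_fract (of_nat n :: 'a)" for n by (induction n) simp_all
  then show ?thesis using neg by (metis of_int_minus of_int_of_nat_eq to_fract_uminus)
qed

lemma lam_plus_nonzero: "lam + of_int m * yy \<noteq> 0"
proof -
  have "lam + of_int m * yy = to_fract (Var VLam + of_int m * Var VY)"
    by (simp only: to_fract_add to_fract_mult of_int_to_fract)
  moreover have "Var VLam + of_int m * Var VY \<noteq> 0"
    using nonzero_if_subst[of "\<lambda>v. if v = VLam then 1 else 0" "Var VLam + of_int m * Var VY"]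
    by (simp add: subst_add subst_mult)
  ultimately show ?thesis by (metis to_fract_eq_0_iff)
qed

lemma lam_minus_nonzero: "lam - of_int m * yy \<noteq> 0"
  using lam_plus_nonzero[of "- m"] by simp

lemma two_rat_fun_nonzero: "(2::rat_fun) \<noteq> 0"
proof -
  have "to_fract (Const (1 + 1)) = (1 + 1 :: rat_fun)"
    by (simp only: Const_simps to_fract_add to_fract_1)
  moreover have "Const (1 + 1) \<noteq> 0"
    by (simp only: Const_eq_0_iff) simp
  ultimately show ?thesis by (metis one_add_one to_fract_eq_0_iff)
qed

lemma zz_inj: "inj_on zz A"
  using zz_diff_nonzero by (intro inj_onI) fastforce

section \<open>The coefficient rings\<close>

text \<open>The common shape of \<open>L_zy\<close> and \<open>L_lamy\<close>, for which closure
  under products is shown once.\<close>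

definition fractions :: "pol set \<Rightarrow> rat_fun set \<Rightarrow> rat_fun set"
  where "fractions A S = {to_fract f / d | f d. f \<in> A \<and> d \<in> S}"

lemma fractions_mult:
  assumes mult: "\<And>d d'. d \<in> S \<Longrightarrow> d' \<in> S \<Longrightarrow> d * d' \<in> S"
    and x: "x \<in> fractions (pols_in V) S" "x' \<in> fractions (pols_in V) S"
  shows "x * x' \<in> fractions (pols_in V) S"
proof -
  obtain f d where f: "x = to_fract f / d" "f \<in> pols_in V" "d \<in> S"
    using x(1) by (auto simp: fractions_def)
  obtain f' d' where f': "x' = to_fract f' / d'" "f' \<in> pols_in V" "d' \<in> S"
    using x(2) by (auto simp: fractions_def)
  have "x * x' = to_fract (f * f') / (d * d')"
    by (simp add: f f')
  then show ?thesis
    using f f' mult[OF f(3) f'(3)] unfolding fractions_def by (blast intro: pols_in_mult)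
qed

definition zy_denoms :: "nat \<Rightarrow> rat_fun set"
  where "zy_denoms n = {(\<Prod>(i, j) \<in> {(i, j) \<in> {1..n} \<times> {1..n}. i \<noteq> j}. (zz i - zz j) ^ k i j) *
        (\<Prod>(i, j) \<in> {1..n} \<times> {1..n}. (zz i - zz j - yy) ^ l i j) | k l. True}"

definition lamy_denoms :: "rat_fun set"
  where "lamy_denoms = {(\<Prod>l\<leftarrow>ls. lam + of_int l * yy) | ls. True}"

definition zy_vars :: "nat \<Rightarrow> var set"
  where "zy_vars n = insert VY (VZ ` {1..n})"

lemma L_zy_eq: "L_zy n = fractions (pols_in (zy_vars n)) (zy_denoms n)"
  unfolding L_zy_def fractions_def zy_denoms_def zy_vars_def by blast

lemma L_lamy_eq: "L_lamy = fractions (pols_in {VLam, VY}) lamy_denoms"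
  unfolding L_lamy_def fractions_def lamy_denoms_def by blast

lemma to_fract_prod: "to_fract (\<Prod>i\<in>A. f i) = (\<Prod>i\<in>A. to_fract (f i))"
  by (induction A rule: infinite_finite_induct) simp_all

lemma to_fract_power: "to_fract (p ^ k) = to_fract p ^ k"
  by (induction k) simp_all

lemma zy_denoms_props:
  assumes "d \<in> zy_denoms n"
  shows "d \<noteq> 0 \<and> (\<exists>f. f \<in> pols_in (zy_vars n) \<and> d = to_fract f)"
proof -
  obtain k l where d: "d = (\<Prod>(i, j) \<in> {(i, j) \<in> {1..n} \<times> {1..n}. i \<noteq> j}. (zz i - zz j) ^ k i j) *
        (\<Prod>(i, j) \<in> {1..n} \<times> {1..n}. (zz i - zz j - yy) ^ l i j)"
    using assms by (auto simp: zy_denoms_def)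
  let ?A = "{(i, j) \<in> {1..n} \<times> {1..n}. i \<noteq> j}"
  have fin: "finite ?A" by (rule finite_subset[of _ "{1..n} \<times> {1..n}"]) auto
  have nz: "(\<Prod>(i, j) \<in> ?A. (zz i - zz j) ^ k i j) \<noteq> 0"
      "(\<Prod>(i, j) \<in> {1..n} \<times> {1..n}. (zz i - zz j - yy) ^ l i j) \<noteq> 0"
    using fin zz_diff_nonzero zz_diff_minus_yy_nonzero by (auto simp: prod_zero_iff)
  let ?f = "(\<Prod>(i, j) \<in> ?A. (Var (VZ i) - Var (VZ j)) ^ k i j) *
        (\<Prod>(i, j) \<in> {1..n} \<times> {1..n}. (Var (VZ i) - Var (VZ j) - Var VY) ^ l i j)"
  have "d = to_fract ?f"
    unfolding d by (simp add: to_fract_prod to_fract_power case_prod_unfold)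
  moreover have "?f \<in> pols_in (zy_vars n)"
    by (intro pols_in_mult pols_in_prod; clarsimp; intro pols_in_power pols_in_diff pols_in_Var)
      (auto simp: zy_vars_def)
  moreover have "d \<noteq> 0"
    unfolding d by (rule no_zero_divisors[OF nz])
  ultimately show ?thesis by blast
qed

lemma zy_denoms_mult: "d \<in> zy_denoms n \<Longrightarrow> d' \<in> zy_denoms n \<Longrightarrow> d * d' \<in> zy_denoms n"
proof -
  assume "d \<in> zy_denoms n" "d' \<in> zy_denoms n"
  then obtain k l k' l' where
    "d = (\<Prod>(i, j) \<in> {(i, j) \<in> {1..n} \<times> {1..n}. i \<noteq> j}. (zz i - zz j) ^ k i j) *
        (\<Prod>(i, j) \<in> {1..n} \<times> {1..n}. (zz i - zz j - yy) ^ l i j)"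
    "d' = (\<Prod>(i, j) \<in> {(i, j) \<in> {1..n} \<times> {1..n}. i \<noteq> j}. (zz i - zz j) ^ k' i j) *
        (\<Prod>(i, j) \<in> {1..n} \<times> {1..n}. (zz i - zz j - yy) ^ l' i j)"
    by (auto simp: zy_denoms_def)
  then have "d * d' = (\<Prod>(i, j) \<in> {(i, j) \<in> {1..n} \<times> {1..n}. i \<noteq> j}. (zz i - zz j) ^ (k i j + k' i j)) *
        (\<Prod>(i, j) \<in> {1..n} \<times> {1..n}. (zz i - zz j - yy) ^ (l i j + l' i j))"
    by (simp add: power_add prod.distrib case_prod_unfold mult_ac)
  then show ?thesis
    unfolding zy_denoms_def
    by (intro CollectI exI[of _ "\<lambda>i j. k i j + k' i j"] exI[of _ "\<lambda>i j. l i j + l' i j"]) simp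
qed

lemma lamy_denoms_mult: "d \<in> lamy_denoms \<Longrightarrow> d' \<in> lamy_denoms \<Longrightarrow> d * d' \<in> lamy_denoms"
proof -
  assume "d \<in> lamy_denoms" "d' \<in> lamy_denoms"
  then obtain ls ls' where "d = (\<Prod>l\<leftarrow>ls. lam + of_int l * yy)" "d' = (\<Prod>l\<leftarrow>ls'. lam + of_int l * yy)"
    by (auto simp: lamy_denoms_def)
  then have "d * d' = (\<Prod>l\<leftarrow>ls @ ls'. lam + of_int l * yy)" by simp
  then show ?thesis unfolding lamy_denoms_def by blast
qed

lemma L_zy_mult: "x \<in> L_zy n \<Longrightarrow> x' \<in> L_zy n \<Longrightarrow> x * x' \<in> L_zy n"
  unfolding L_zy_eq by (rule fractions_mult[OF zy_denoms_mult])

lemma L_lamy_mult: "x \<in> L_lamy \<Longrightarrow> x' \<in> L_lamy \<Longrightarrow> x * x' \<in> L_lamy"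
  unfolding L_lamy_eq by (rule fractions_mult[OF lamy_denoms_mult])

lemma zy_denoms_1: "1 \<in> zy_denoms n"
  unfolding zy_denoms_def by (intro CollectI exI[of _ "\<lambda>_ _. 0"]) simp

lemma lamy_denoms_1: "1 \<in> lamy_denoms"
  unfolding lamy_denoms_def by (intro CollectI exI[of _ "[]"]) simp

lemma L_zy_pol: "f \<in> pols_in (zy_vars n) \<Longrightarrow> to_fract f \<in> L_zy n"
  unfolding L_zy_eq fractions_def by (intro CollectI exI[of _ f] exI[of _ 1]) (simp add: zy_denoms_1)

lemma L_lamy_pol: "f \<in> pols_in {VLam, VY} \<Longrightarrow> to_fract f \<in> L_lamy"
  unfolding L_lamy_eq fractions_def by (intro CollectI exI[of _ f] exI[of _ 1]) (simp add: lamy_denoms_1)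

lemma L_zy_inverse: "d \<in> zy_denoms n \<Longrightarrow> 1 / d \<in> L_zy n"
  unfolding L_zy_eq fractions_def by (intro CollectI exI[of _ 1] exI[of _ d]) simp

lemma zy_denoms_diff:
  assumes ij: "i \<in> {1..n}" "j \<in> {1..n}" "i \<noteq> j"
  shows "zz i - zz j \<in> zy_denoms n"
proof -
  let ?A = "{(i, j) \<in> {1..n} \<times> {1..n}. i \<noteq> j}"
  have fin: "finite ?A" by (rule finite_subset[of _ "{1..n} \<times> {1..n}"]) auto
  have "(\<Prod>(a, b) \<in> ?A. (zz a - zz b) ^ (if (a, b) = (i, j) then 1 else 0)) =
    (\<Prod>p \<in> ?A. if p = (i, j) then zz i - zz j else 1)"
    by (intro prod.cong refl) (auto simp: case_prod_unfold prod_eq_iff)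
  also have "\<dots> = zz i - zz j" using ij fin by (subst prod.delta) auto
  finally have eq: "(\<Prod>(a, b) \<in> ?A. (zz a - zz b) ^ (if (a, b) = (i, j) then 1 else 0)) = zz i - zz j" .
  show ?thesis
    unfolding zy_denoms_def
    by (intro CollectI exI[of _ "\<lambda>a b. if (a, b) = (i, j) then 1 else 0"] exI[of _ "\<lambda>_ _. 0"])
      (simp only: eq, simp)
qed

lemma zy_denoms_diff_yy:
  assumes ij: "i \<in> {1..n}" "j \<in> {1..n}"
  shows "zz i - zz j - yy \<in> zy_denoms n"
proof -
  have "(\<Prod>(a, b) \<in> {1..n} \<times> {1..n}. (zz a - zz b - yy) ^ (if (a, b) = (i, j) then 1 else 0)) =
    (\<Prod>p \<in> {1..n} \<times> {1..n}. if p = (i, j) then zz i - zz j - yy else 1)"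
    by (intro prod.cong refl) (auto simp: case_prod_unfold prod_eq_iff)
  also have "\<dots> = zz i - zz j - yy" using ij by (subst prod.delta) auto
  finally have eq: "(\<Prod>(a, b) \<in> {1..n} \<times> {1..n}. (zz a - zz b - yy) ^ (if (a, b) = (i, j) then 1 else 0)) =
    zz i - zz j - yy" .
  show ?thesis
    unfolding zy_denoms_def
    by (intro CollectI exI[of _ "\<lambda>_ _. 0"] exI[of _ "\<lambda>a b. if (a, b) = (i, j) then 1 else 0"])
      (simp only: eq, simp)
qed

lemma L_set_prod: "a \<in> L_lamy \<Longrightarrow> b \<in> L_zy n \<Longrightarrow> a * b \<in> L_set n"
  unfolding L_set_def
  by (intro CollectI exI[of _ "1::nat"] exI[of _ "\<lambda>_. a"] exI[of _ "\<lambda>_. b"]) simp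

lemma L_set_0 [simp]: "0 \<in> L_set n"
  unfolding L_set_def by (intro CollectI exI[of _ "0::nat"]) simp

lemma L_set_add:
  assumes "x \<in> L_set n" "x' \<in> L_set n"
  shows "x + x' \<in> L_set n"
proof -
  obtain m :: nat and a b where 1: "x = (\<Sum>i<m. a i * b i)" "\<forall>i<m. a i \<in> L_lamy" "\<forall>i<m. b i \<in> L_zy n"
    using assms(1) unfolding L_set_def by blast
  obtain m' :: nat and a' b' where 2: "x' = (\<Sum>i<m'. a' i * b' i)" "\<forall>i<m'. a' i \<in> L_lamy" "\<forall>i<m'. b' i \<in> L_zy n"
    using assms(2) unfolding L_set_def by blast
  define c where "c i = (if i < m then a i else a' (i - m))" for i
  define d where "d i = (if i < m then b i else b' (i - m))" for i
  have "x + x' = (\<Sum>i<m + m'. c i * d i)"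
  proof -
    have "(\<Sum>i<m + m'. c i * d i) = (\<Sum>i\<in>{0..<m}. c i * d i) + (\<Sum>i\<in>{m..<m + m'}. c i * d i)"
      by (simp add: lessThan_atLeast0 sum.atLeastLessThan_concat)
    also have "(\<Sum>i\<in>{m..<m + m'}. c i * d i) = (\<Sum>i\<in>{0..<m'}. c (i + m) * d (i + m))"
      using sum.shift_bounds_nat_ivl[of "\<lambda>i. c i * d i" 0 m m'] by (simp add: add.commute)
    finally show ?thesis
      unfolding 1(1) 2(1) by (simp add: c_def d_def lessThan_atLeast0)
  qed
  then show ?thesis
    unfolding L_set_def using 1(2,3) 2(2,3)
    by (intro CollectI exI[of _ "m + m'"] exI[of _ c] exI[of _ d]) (auto simp: c_def d_def)
qed

lemma L_set_sum: "(\<And>i. i \<in> A \<Longrightarrow> f i \<in> L_set n) \<Longrightarrow> (\<Sum>i\<in>A. f i) \<in> L_set n"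
  by (induction A rule: infinite_finite_induct) (auto intro: L_set_add)

lemma L_set_mult:
  assumes "x \<in> L_set n" "x' \<in> L_set n"
  shows "x * x' \<in> L_set n"
proof -
  obtain m :: nat and a b where 1: "x = (\<Sum>i<m. a i * b i)" "\<forall>i<m. a i \<in> L_lamy" "\<forall>i<m. b i \<in> L_zy n"
    using assms(1) unfolding L_set_def by blast
  obtain m' :: nat and a' b' where 2: "x' = (\<Sum>i<m'. a' i * b' i)" "\<forall>i<m'. a' i \<in> L_lamy" "\<forall>i<m'. b' i \<in> L_zy n"
    using assms(2) unfolding L_set_def by blast
  have "x * x' = (\<Sum>i<m. \<Sum>j<m'. (a i * a' j) * (b i * b' j))"
    unfolding 1 2 sum_product by (simp add: mult_ac)
  also have "\<dots> \<in> L_set n"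
    using 1 2 by (intro L_set_sum L_set_prod L_lamy_mult L_zy_mult) auto
  finally show ?thesis .
qed

lemma L_set_zy: "x \<in> L_zy n \<Longrightarrow> x \<in> L_set n"
  using L_set_prod[of 1 x n] L_lamy_pol[of 1] by simp

lemma L_set_lamy: "x \<in> L_lamy \<Longrightarrow> x \<in> L_set n"
  using L_set_prod[of x 1 n] L_zy_pol[of 1] by simp

lemma L_set_pol: "f \<in> pols_in (zy_vars n) \<Longrightarrow> to_fract f \<in> L_set n"
  by (intro L_set_zy L_zy_pol)

lemma L_set_1 [simp]: "1 \<in> L_set n"
  using L_set_pol[of 1 n] by simp

lemma L_set_uminus: "x \<in> L_set n \<Longrightarrow> - x \<in> L_set n"
  using L_set_mult[OF L_set_pol[of "- 1" n], of x] by (simp add: pols_in_uminus)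

lemma L_set_diff: "x \<in> L_set n \<Longrightarrow> x' \<in> L_set n \<Longrightarrow> x - x' \<in> L_set n"
  using L_set_add[of x n "- x'"] L_set_uminus by simp

lemma L_set_prod_closed: "(\<And>i. i \<in> A \<Longrightarrow> f i \<in> L_set n) \<Longrightarrow> (\<Prod>i\<in>A. f i) \<in> L_set n"
  by (induction A rule: infinite_finite_induct) (auto intro: L_set_mult)

lemma L_set_power: "x \<in> L_set n \<Longrightarrow> x ^ k \<in> L_set n"
  by (induction k) (auto intro: L_set_mult)

lemma L_set_of_int: "of_int m \<in> L_set n"
proof -
  have "of_nat k \<in> L_set n" for k by (induction k) (auto intro: L_set_add)
  then show ?thesis by (cases m) (auto intro: L_set_uminus simp del: of_nat_Suc)
qed

lemma L_set_vars: "lam \<in> L_set n" "yy \<in> L_set n" "i \<in> {1..n} \<Longrightarrow> zz i \<in> L_set n"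
proof -
  show "lam \<in> L_set n" by (intro L_set_lamy L_lamy_pol pols_in_Var) simp
  show "yy \<in> L_set n" by (intro L_set_pol pols_in_Var) (simp add: zy_vars_def)
  show "zz i \<in> L_set n" if "i \<in> {1..n}"
    using that by (intro L_set_pol pols_in_Var) (simp add: zy_vars_def)
qed

text \<open>The maps are over a ring, not a field, so every division must be by an element whose
  inverse lies in the ring again. The discriminant, \<open>R_fun\<close>, \<open>Q_fun\<close>,
  \<open>C_fun\<close> and the values of \<open>e_fun\<close> at fixed points turn out to be of this
  kind.\<close>

definition L_units :: "nat \<Rightarrow> rat_fun set"
  where "L_units n = {d. d \<noteq> 0 \<and> d \<in> L_set n \<and> 1 / d \<in> L_set n}"

lemma L_units_mult: "d \<in> L_units n \<Longrightarrow> d' \<in> L_units n \<Longrightarrow> d * d' \<in> L_units n"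
  using L_set_mult[of "1 / d" n "1 / d'"] by (auto simp: L_units_def intro: L_set_mult)

lemma L_units_1: "1 \<in> L_units n"
  by (simp add: L_units_def)

lemma L_units_prod: "(\<And>i. i \<in> A \<Longrightarrow> f i \<in> L_units n) \<Longrightarrow> (\<Prod>i\<in>A. f i) \<in> L_units n"
  by (induction A rule: infinite_finite_induct) (auto intro: L_units_mult L_units_1)

lemma L_units_uminus: "d \<in> L_units n \<Longrightarrow> - d \<in> L_units n"
  using L_set_uminus[of "1 / d" n] by (auto simp: L_units_def intro: L_set_uminus)

lemma L_units_zy: "d \<in> zy_denoms n \<Longrightarrow> d \<in> L_units n"
  using zy_denoms_props[of d n] by (auto simp: L_units_def intro: L_set_pol L_set_zy L_zy_inverse)

lemma L_units_diff: "i \<in> {1..n} \<Longrightarrow> j \<in> {1..n} \<Longrightarrow> i \<noteq> j \<Longrightarrow> zz i - zz j \<in> L_units n"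
  by (intro L_units_zy zy_denoms_diff)

lemma L_units_diff_yy: "i \<in> {1..n} \<Longrightarrow> j \<in> {1..n} \<Longrightarrow> zz i - zz j + yy \<in> L_units n"
  using L_units_uminus[OF L_units_zy[OF zy_denoms_diff_yy[of j n i]]] by (simp add: algebra_simps)

lemma L_units_lam: "lam - of_int m * yy \<in> L_units n"
proof -
  have "1 / (lam - of_int m * yy) = to_fract 1 / (\<Prod>l\<leftarrow>[- m]. lam + of_int l * yy)" by simp
  then have "1 / (lam - of_int m * yy) \<in> L_lamy"
    unfolding L_lamy_eq fractions_def lamy_denoms_def
    by (intro CollectI exI[of _ 1] exI[of _ "\<Prod>l\<leftarrow>[- m]. lam + of_int l * yy"] conjI pols_in_1 exI[of _ "[- m]"]) auto
  moreover have "lam - of_int m * yy \<in> L_set n"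
    by (intro L_set_diff L_set_mult L_set_of_int L_set_vars)
  ultimately show ?thesis
    using lam_minus_nonzero[of m] L_set_lamy by (simp add: L_units_def)
qed

lemma L_set_divide: "x \<in> L_set n \<Longrightarrow> d \<in> L_units n \<Longrightarrow> x / d \<in> L_set n"
  using L_set_mult[of x n "1 / d"] by (simp add: L_units_def)

section \<open>Extension of scalars\<close>

lemma L_simps [simp]:
  "carrier (L n) = L_set n" "a \<oplus>\<^bsub>L n\<^esub> b = a + b" "a \<otimes>\<^bsub>L n\<^esub> b = a * b" "r \<odot>\<^bsub>L n\<^esub> a = to_fract r * a"
  by (simp_all add: L_def)

lemma carrier_Czy [simp]: "carrier (Czy n) = pols_in (zy_vars n)"
  by (simp add: Czy_def ring_on_def zy_vars_def)

text \<open>Linear extension of h \<otimes> c \<mapsto> c \<rho>(h) to formal sums. With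
  \<open>\<rho>\<close> the restriction to a fixed point this is the function inside
  \<open>restr\<close>.\<close>

definition val :: "('m \<Rightarrow> rat_fun) \<Rightarrow> (('m \<times> rat_fun) \<Rightarrow>\<^sub>0 int) \<Rightarrow> rat_fun"
  where "val \<rho> x = (\<Sum>(h, c) \<in> Poly_Mapping.keys x. of_int (Poly_Mapping.lookup x (h, c)) * c * \<rho> h)"

lemma val_superset:
  assumes "finite S" "Poly_Mapping.keys x \<subseteq> S"
  shows "val \<rho> x = (\<Sum>p \<in> S. of_int (Poly_Mapping.lookup x p) * snd p * \<rho> (fst p))"
  unfolding val_def case_prod_unfold
  by (rule sum.mono_neutral_cong_left) (use assms in \<open>auto simp: in_keys_iff\<close>)

lemma val_add: "val \<rho> (x + y) = val \<rho> x + val \<rho> y"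
proof -
  let ?S = "Poly_Mapping.keys x \<union> Poly_Mapping.keys y"
  have "finite ?S" by simp
  then show ?thesis
    using keys_add[of x y]
    by (simp add: val_superset[of ?S] lookup_add distrib_right sum.distrib)
qed

lemma val_0 [simp]: "val \<rho> 0 = 0"
  by (simp add: val_def)

lemma val_uminus: "val \<rho> (- x) = - val \<rho> x"
  using val_add[of \<rho> x "- x"] by (simp add: eq_neg_iff_add_eq_0 add.commute)

lemma val_diff: "val \<rho> (x - y) = val \<rho> x - val \<rho> y"
  using val_add[of \<rho> x "- y"] by (simp add: val_uminus)

lemma val_sum: "val \<rho> (\<Sum>i\<in>A. f i) = (\<Sum>i\<in>A. val \<rho> (f i))"
  by (induction A rule: infinite_finite_induct) (simp_all add: val_add)

lemma val_frag_of [simp]: "val \<rho> (frag_of (h, c)) = c * \<rho> h"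
  by (simp add: val_def)

lemma val_frag_extend:
  assumes "Poly_Mapping.keys x \<subseteq> S"
    and "\<And>h a. (h, a) \<in> S \<Longrightarrow> g a * \<rho> (f h) = c * (a * \<rho>' h)"
  shows "val \<rho> (frag_extend (\<lambda>(h, a). frag_of (f h, g a)) x) = c * val \<rho>' x"
  using assms(1)
proof (induction x rule: frag_induction)
  case (one p)
  then show ?case using assms(2) by (cases p) simp
qed (simp_all add: frag_extend_diff val_diff right_diff_distrib)

text \<open>Closure of the carrier under sums and scalars places the defining relations of the
  tensor product among the formal sums over the carrier, so that they generate a subgroup. Both
  \<open>HT n k\<close> and \<open>HX n\<close> are instances.\<close>

locale scalar_ext =
  fixes n :: nat and M :: "(pol, 'm) module"
  assumes M_add: "\<lbrakk>m \<in> carrier M; m' \<in> carrier M\<rbrakk> \<Longrightarrow> m \<oplus>\<^bsub>M\<^esub> m' \<in> carrier M"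
    and M_smult: "\<lbrakk>r \<in> pols_in (zy_vars n); m \<in> carrier M\<rbrakk> \<Longrightarrow> r \<odot>\<^bsub>M\<^esub> m \<in> carrier M"
begin

abbreviation "rels \<equiv> tensor_rels (Czy n) M (L n)"
abbreviation "ker \<equiv> tensor_ker (Czy n) M (L n)"
abbreviation "cls \<equiv> tensor_class (Czy n) M (L n)"
abbreviation "T \<equiv> tensor_ext (Czy n) M (L n)"

definition chains :: "(('m \<times> rat_fun) \<Rightarrow>\<^sub>0 int) set"
  where "chains = {x. Poly_Mapping.keys x \<subseteq> carrier M \<times> L_set n}"

lemma chains_intros:
  "0 \<in> chains" "x \<in> chains \<Longrightarrow> y \<in> chains \<Longrightarrow> x + y \<in> chains"
  "x \<in> chains \<Longrightarrow> y \<in> chains \<Longrightarrow> x - y \<in> chains" "x \<in> chains \<Longrightarrow> - x \<in> chains"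
  "m \<in> carrier M \<Longrightarrow> a \<in> L_set n \<Longrightarrow> frag_of (m, a) \<in> chains"
  using keys_add[of x y] keys_diff[of x y] by (auto simp: chains_def)

lemma chains_sum: "(\<And>i. i \<in> A \<Longrightarrow> f i \<in> chains) \<Longrightarrow> (\<Sum>i\<in>A. f i) \<in> chains"
  by (induction A rule: infinite_finite_induct) (auto intro: chains_intros)

lemma rels_chains: "rels \<subseteq> chains"
  unfolding tensor_rels_def
  by (auto intro!: chains_intros M_add M_smult L_set_add L_set_mult L_set_pol)

lemma carrier_free: "carrier (tensor_free M (L n)) = chains"
  by (auto simp: tensor_free_def chains_def)

lemma free_comm_group: "comm_group (tensor_free M (L n))"
  unfolding tensor_free_def by (rule abelian_free_Abelian_group)

lemma ker_subgroup: "subgroup ker (tensor_free M (L n))"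
  unfolding tensor_ker_def
  using rels_chains group.generate_is_subgroup[OF comm_group.axioms(2)[OF free_comm_group]]
  by (simp add: carrier_free)

lemma ker_chains: "ker \<subseteq> chains"
  using subgroup.subset[OF ker_subgroup] by (simp add: carrier_free)

lemma ker_0: "0 \<in> ker"
  using subgroup.one_closed[OF ker_subgroup] by (simp add: tensor_free_def)

lemma ker_add: "x \<in> ker \<Longrightarrow> y \<in> ker \<Longrightarrow> x + y \<in> ker"
  using subgroup.m_closed[OF ker_subgroup] by (simp add: tensor_free_def)

lemma ker_uminus: "x \<in> ker \<Longrightarrow> - x \<in> ker"
proof -
  assume x: "x \<in> ker"
  then have "Poly_Mapping.keys x \<subseteq> carrier M \<times> carrier (L n)"
    using ker_chains by (auto simp: chains_def)
  then show "- x \<in> ker"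
    using subgroup.m_inv_closed[OF ker_subgroup x] by (simp add: tensor_free_def)
qed

lemma ker_diff: "x \<in> ker \<Longrightarrow> y \<in> ker \<Longrightarrow> x - y \<in> ker"
  using ker_add[of x "- y"] ker_uminus by simp

lemma ker_sum: "(\<And>i. i \<in> A \<Longrightarrow> f i \<in> ker) \<Longrightarrow> (\<Sum>i\<in>A. f i) \<in> ker"
  by (induction A rule: infinite_finite_induct) (auto intro: ker_add ker_0)

lemma ker_trans: "x - y \<in> ker \<Longrightarrow> y - w \<in> ker \<Longrightarrow> x - w \<in> ker"
  using ker_add[of "x - y" "y - w"] by simp

lemma ker_sym: "x - y \<in> ker \<Longrightarrow> y - x \<in> ker"
  using ker_uminus[of "x - y"] by simp

lemma rels_ker: "rels \<subseteq> ker"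
  unfolding tensor_ker_def by (auto intro: generate.incl)

lemma ker_induct [consumes 1, case_names rel zero add uminus]:
  assumes x: "x \<in> ker"
    and rel: "\<And>r. r \<in> rels \<Longrightarrow> P r" and zero: "P 0"
    and add: "\<And>x y. P x \<Longrightarrow> P y \<Longrightarrow> P (x + y)" and um: "\<And>x. P x \<Longrightarrow> P (- x)"
  shows "P x"
  using x unfolding tensor_ker_def
proof (induction rule: generate.induct)
  case one then show ?case using zero by (simp add: tensor_free_def)
next
  case (incl h) then show ?case by (rule rel)
next
  case (inv h)
  then have "Poly_Mapping.keys h \<subseteq> carrier M \<times> carrier (L n)"
    using rels_chains by (auto simp: chains_def)
  then show ?case using um[OF rel[OF inv]] by (simp add: tensor_free_def)
next
  case (eng h1 h2) then show ?case using add by (simp add: tensor_free_def)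
qed

lemma ker_add_left:
  assumes "m \<in> carrier M" "m' \<in> carrier M" "a \<in> L_set n"
  shows "frag_of (m \<oplus>\<^bsub>M\<^esub> m', a) - (frag_of (m, a) + frag_of (m', a)) \<in> ker"
proof -
  have "frag_of (m \<oplus>\<^bsub>M\<^esub> m', a) - frag_of (m, a) - frag_of (m', a) \<in> rels"
    unfolding tensor_rels_def using assms by auto
  then show ?thesis using rels_ker by (auto simp: diff_diff_eq)
qed

lemma ker_add_right:
  assumes "m \<in> carrier M" "a \<in> L_set n" "a' \<in> L_set n"
  shows "frag_of (m, a + a') - (frag_of (m, a) + frag_of (m, a')) \<in> ker"
proof -
  have "frag_of (m, a \<oplus>\<^bsub>L n\<^esub> a') - frag_of (m, a) - frag_of (m, a') \<in> rels"
    unfolding tensor_rels_def using assms by auto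
  then show ?thesis using rels_ker by (auto simp: diff_diff_eq)
qed

lemma ker_smult:
  assumes "r \<in> pols_in (zy_vars n)" "m \<in> carrier M" "a \<in> L_set n"
  shows "frag_of (r \<odot>\<^bsub>M\<^esub> m, a) - frag_of (m, to_fract r * a) \<in> ker"
proof -
  have "frag_of (r \<odot>\<^bsub>M\<^esub> m, a) - frag_of (m, r \<odot>\<^bsub>L n\<^esub> a) \<in> rels"
    unfolding tensor_rels_def using assms by auto
  then show ?thesis using rels_ker by auto
qed

lemma ker_zero_right:
  assumes "m \<in> carrier M"
  shows "frag_of (m, 0) \<in> ker"
  using ker_uminus[OF ker_add_right[OF assms L_set_0 L_set_0]] by simp

lemma ker_diff_right:
  assumes "m \<in> carrier M" "a \<in> L_set n" "a' \<in> L_set n"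
  shows "frag_of (m, a - a') - (frag_of (m, a) - frag_of (m, a')) \<in> ker"
  using ker_uminus[OF ker_add_right[OF assms(1) L_set_diff[OF assms(2,3)] assms(3)]]
  by (simp add: algebra_simps)

text \<open>Turns cosets into congruences: from here on identities between tensors are memberships
  of differences in \<open>ker\<close>.\<close>

lemma cls_eq: "cls x = {y. y - x \<in> ker}"
proof -
  have "cls x = (\<Union>h\<in>ker. {h + x})"
    by (simp add: tensor_class_def r_coset_def tensor_free_def)
  also have "\<dots> = {y. y - x \<in> ker}"
    by (auto simp: diff_eq_eq intro: bexI[of _ "_ - x"])
  finally show ?thesis .
qed

lemma cls_eq_iff: "cls x = cls y \<longleftrightarrow> x - y \<in> ker"
proof
  assume eq: "cls x = cls y"
  have "x \<in> cls x" using ker_0 by (simp add: cls_eq)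
  then have "x \<in> cls y" by (simp only: eq)
  then show "x - y \<in> ker" by (simp add: cls_eq)
next
  assume xy: "x - y \<in> ker"
  have "w - x \<in> ker \<longleftrightarrow> w - y \<in> ker" for w
    using ker_trans[OF _ xy, of w] ker_trans[OF _ ker_sym[OF xy], of w] by meson
  then show "cls x = cls y" by (simp add: cls_eq)
qed

lemma carrier_T: "carrier T = cls ` chains"
  unfolding tensor_ext_def tensor_class_def
  by (auto simp: FactGroup_def RCOSETS_def carrier_free)

lemma cls_add: "cls x \<oplus>\<^bsub>T\<^esub> cls y = cls (x + y)"
proof -
  have "cls x \<oplus>\<^bsub>T\<^esub> cls y = (\<Union>a\<in>cls x. \<Union>b\<in>cls y. {a + b})"
    by (simp add: tensor_ext_def FactGroup_def set_mult_def tensor_free_def)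
  also have "\<dots> = cls (x + y)"
  proof (intro equalityI subsetI)
    fix u assume "u \<in> cls (x + y)"
    then have "(u - y) - x \<in> ker" by (simp add: cls_eq algebra_simps)
    then have "u - y \<in> cls x" "y \<in> cls y" using ker_0 by (auto simp: cls_eq)
    then show "u \<in> (\<Union>a\<in>cls x. \<Union>b\<in>cls y. {a + b})" by force
  next
    fix u assume "u \<in> (\<Union>a\<in>cls x. \<Union>b\<in>cls y. {a + b})"
    then obtain a b where "u = a + b" "a - x \<in> ker" "b - y \<in> ker" by (auto simp: cls_eq)
    then show "u \<in> cls (x + y)" using ker_add[of "a - x" "b - y"] by (simp add: cls_eq algebra_simps)
  qed
  finally show ?thesis .
qed

lemma zero_T: "\<zero>\<^bsub>T\<^esub> = cls 0"
  by (simp add: tensor_ext_def FactGroup_def cls_eq)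

lemma T_elem: "X \<in> carrier T \<Longrightarrow> \<exists>x\<in>chains. X = cls x"
  unfolding carrier_T by blast

lemma cls_in: "x \<in> chains \<Longrightarrow> cls x \<in> carrier T"
  unfolding carrier_T by (rule imageI)

lemma abelian_monoid_T: "abelian_monoid T"
proof (rule abelian_monoidI)
  fix X Y assume "X \<in> carrier T" "Y \<in> carrier T"
  then obtain x y where xy: "X = cls x" "Y = cls y" "x \<in> chains" "y \<in> chains"
    using T_elem by meson
  show "X \<oplus>\<^bsub>T\<^esub> Y \<in> carrier T"
    unfolding xy cls_add by (rule cls_in[OF chains_intros(2)[OF xy(3,4)]])
  show "X \<oplus>\<^bsub>T\<^esub> Y = Y \<oplus>\<^bsub>T\<^esub> X"
    unfolding xy cls_add by (simp only: add.commute)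
  fix Z assume "Z \<in> carrier T"
  then obtain z where z: "Z = cls z" using T_elem by meson
  show "X \<oplus>\<^bsub>T\<^esub> Y \<oplus>\<^bsub>T\<^esub> Z = X \<oplus>\<^bsub>T\<^esub> (Y \<oplus>\<^bsub>T\<^esub> Z)"
    unfolding xy z cls_add by (simp only: add.assoc)
next
  fix X assume "X \<in> carrier T"
  then obtain x where x: "X = cls x" using T_elem by meson
  show "\<zero>\<^bsub>T\<^esub> \<oplus>\<^bsub>T\<^esub> X = X"
    unfolding x zero_T cls_add by simp
qed (unfold zero_T, rule cls_in[OF chains_intros(1)])

text \<open>\<open>tensor_map\<close> is a union over all representatives; the hypothesis on
  \<open>ker\<close> makes the cosets in this union equal.\<close>

lemma tensor_map_cls:
  assumes M': "scalar_ext n M'"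
    and ker: "\<And>x. x \<in> ker \<Longrightarrow>
      frag_extend (\<lambda>(m, a). frag_of (f m, g a)) x \<in> tensor_ker (Czy n) M' (L n)"
  shows "tensor_map (Czy n) M' (L n) f g (cls x) =
    tensor_class (Czy n) M' (L n) (frag_extend (\<lambda>(m, a). frag_of (f m, g a)) x)"
proof -
  let ?\<Phi> = "frag_extend (\<lambda>(m, a). frag_of (f m, g a))"
  have "tensor_class (Czy n) M' (L n) (?\<Phi> y) = tensor_class (Czy n) M' (L n) (?\<Phi> x)" if "y \<in> cls x" for y
    using ker[of "y - x"] that
    by (simp add: scalar_ext.cls_eq_iff[OF M'] cls_eq frag_extend_diff)
  moreover have "x \<in> cls x" using ker_0 by (simp add: cls_eq)
  ultimately show ?thesis unfolding tensor_map_def by blast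
qed

text \<open>The relations generate \<open>ker\<close>, and a pair of linear maps sends each relation
  to a relation of the same kind.\<close>

lemma ker_map:
  assumes M': "scalar_ext n M'"
    and f: "\<And>m. m \<in> carrier M \<Longrightarrow> f m \<in> carrier M'"
    and f_add: "\<And>m m'. m \<in> carrier M \<Longrightarrow> m' \<in> carrier M \<Longrightarrow> f (m \<oplus>\<^bsub>M\<^esub> m') = f m \<oplus>\<^bsub>M'\<^esub> f m'"
    and f_smult: "\<And>r m. r \<in> pols_in (zy_vars n) \<Longrightarrow> m \<in> carrier M \<Longrightarrow> f (r \<odot>\<^bsub>M\<^esub> m) = r \<odot>\<^bsub>M'\<^esub> f m"
    and g: "\<And>a. a \<in> L_set n \<Longrightarrow> g a \<in> L_set n"
    and g_add: "\<And>a a'. a \<in> L_set n \<Longrightarrow> a' \<in> L_set n \<Longrightarrow> g (a + a') = g a + g a'"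
    and g_mult: "\<And>r a. r \<in> pols_in (zy_vars n) \<Longrightarrow> a \<in> L_set n \<Longrightarrow> g (to_fract r * a) = to_fract r * g a"
    and x: "x \<in> ker"
  shows "frag_extend (\<lambda>(m, a). frag_of (f m, g a)) x \<in> tensor_ker (Czy n) M' (L n)"
  using x
proof (induction rule: ker_induct)
  case (rel r)
  then show ?case
    unfolding tensor_rels_def
    using scalar_ext.ker_add_left[OF M'] scalar_ext.ker_add_right[OF M'] scalar_ext.ker_smult[OF M']
    by (auto simp: frag_extend_diff frag_extend_add f f_add f_smult g g_add g_mult diff_diff_eq M_add M_smult
        L_set_add L_set_mult L_set_pol)
qed (simp_all add: frag_extend_add frag_extend_minus
    scalar_ext.ker_0[OF M'] scalar_ext.ker_add[OF M'] scalar_ext.ker_uminus[OF M'])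

lemma smult_cls:
  assumes c: "c \<in> L_set n"
  shows "c \<odot>\<^bsub>T\<^esub> cls x = cls (frag_extend (\<lambda>(m, a). frag_of (m, c * a)) x)"
proof -
  have "c \<odot>\<^bsub>T\<^esub> cls x = tensor_map (Czy n) M (L n) id (\<lambda>a. c * a) (cls x)"
    by (simp add: tensor_ext_def)
  also have "\<dots> = cls (frag_extend (\<lambda>(m, a). frag_of (id m, c * a)) x)"
    by (rule tensor_map_cls[OF scalar_ext_axioms], rule ker_map[OF scalar_ext_axioms])
      (simp_all add: c L_set_mult distrib_left mult.left_commute)
  finally show ?thesis by simp
qed

lemma chains_frag_extend:
  assumes x: "x \<in> chains" and f: "\<And>m. m \<in> carrier M \<Longrightarrow> f m \<in> carrier M'"
    and g: "\<And>a. a \<in> L_set n \<Longrightarrow> g a \<in> L_set n" and M': "scalar_ext n M'"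
  shows "frag_extend (\<lambda>(m, a). frag_of (f m, g a)) x \<in> scalar_ext.chains n M'"
  using x unfolding chains_def mem_Collect_eq
proof (induction x rule: frag_induction)
  case zero
  then show ?case using scalar_ext.chains_intros(1)[OF M'] by simp
next
  case (one p)
  then show ?case using scalar_ext.chains_intros(5)[OF M'] f g by (cases p) auto
next
  case (diff a b)
  then show ?case using scalar_ext.chains_intros(3)[OF M'] by (simp add: frag_extend_diff)
qed

end

section \<open>Evaluation of tensors by linear functionals\<close>

definition rval :: "('m \<Rightarrow> rat_fun) \<Rightarrow> (('m \<times> rat_fun) \<Rightarrow>\<^sub>0 int) set \<Rightarrow> rat_fun"
  where "rval \<rho> X = the_elem (val \<rho> ` X)"

context scalar_ext
begin

definition lin_fun :: "('m \<Rightarrow> rat_fun) \<Rightarrow> bool"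
  where "lin_fun \<rho> \<longleftrightarrow>
     (\<forall>m\<in>carrier M. \<forall>m'\<in>carrier M. \<rho> (m \<oplus>\<^bsub>M\<^esub> m') = \<rho> m + \<rho> m') \<and>
     (\<forall>r\<in>pols_in (zy_vars n). \<forall>m\<in>carrier M. \<rho> (r \<odot>\<^bsub>M\<^esub> m) = to_fract r * \<rho> m) \<and>
     (\<forall>m\<in>carrier M. \<rho> m \<in> L_set n)"

lemma val_ker:
  assumes \<rho>: "lin_fun \<rho>" and x: "x \<in> ker"
  shows "val \<rho> x = 0"
  using x
proof (induction rule: ker_induct)
  case (rel r)
  then show ?case
    unfolding tensor_rels_def using \<rho>
    by (auto simp: lin_fun_def val_diff distrib_left distrib_right mult_ac)
qed (simp_all add: val_add val_uminus)

text \<open>A linear functional kills \<open>ker\<close>, hence is constant on each coset, and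
  \<open>the_elem\<close> in \<open>rval\<close> picks that constant.\<close>

lemma rval_cls:
  assumes \<rho>: "lin_fun \<rho>"
  shows "rval \<rho> (cls x) = val \<rho> x"
proof -
  have "val \<rho> ` cls x = (\<lambda>_. val \<rho> x) ` cls x"
  proof (rule image_cong[OF refl])
    fix y assume "y \<in> cls x"
    then have "y - x \<in> ker" by (simp add: cls_eq)
    from val_ker[OF \<rho> this] show "val \<rho> y = val \<rho> x" by (simp add: val_diff)
  qed
  also have "\<dots> = {val \<rho> x}"
    by (rule image_constant[of x]) (simp add: cls_eq ker_0)
  finally show ?thesis by (simp add: rval_def)
qed

lemma val_in_L:
  assumes \<rho>: "lin_fun \<rho>" and x: "x \<in> chains"
  shows "val \<rho> x \<in> L_set n"
  unfolding val_def case_prod_unfold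
proof (rule L_set_sum)
  fix p assume "p \<in> Poly_Mapping.keys x"
  then have "fst p \<in> carrier M" "snd p \<in> L_set n" using x by (auto simp: chains_def)
  moreover then have "\<rho> (fst p) \<in> L_set n" using \<rho> by (simp add: lin_fun_def)
  ultimately show "of_int (Poly_Mapping.lookup x (fst p, snd p)) * snd p * \<rho> (fst p) \<in> L_set n"
    by (intro L_set_mult L_set_of_int)
qed

lemma rval_add:
  assumes "lin_fun \<rho>" "X \<in> carrier T" "Y \<in> carrier T"
  shows "rval \<rho> (X \<oplus>\<^bsub>T\<^esub> Y) = rval \<rho> X + rval \<rho> Y"
proof -
  obtain x y where "X = cls x" "Y = cls y" using assms(2,3) T_elem by meson
  then show ?thesis by (simp only: cls_add rval_cls[OF assms(1)] val_add)
qed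

lemma rval_smult:
  assumes "lin_fun \<rho>" "c \<in> L_set n" "X \<in> carrier T"
  shows "rval \<rho> (c \<odot>\<^bsub>T\<^esub> X) = c * rval \<rho> X"
proof -
  obtain x where x: "X = cls x" "x \<in> chains" using assms(3) T_elem by meson
  have "val \<rho> (frag_extend (\<lambda>(m, a). frag_of (m, c * a)) x) = c * val \<rho> x"
    by (rule val_frag_extend[where S = UNIV and f = "\<lambda>m. m"]) simp_all
  then show ?thesis by (simp only: x(1) smult_cls[OF assms(2)] rval_cls[OF assms(1)])
qed

lemma rval_in_L: "lin_fun \<rho> \<Longrightarrow> X \<in> carrier T \<Longrightarrow> rval \<rho> X \<in> L_set n"
proof -
  assume \<rho>: "lin_fun \<rho>" and "X \<in> carrier T"
  then obtain x where x: "X = cls x" "x \<in> chains" using T_elem by meson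
  then show ?thesis by (simp only: rval_cls[OF \<rho>] val_in_L[OF \<rho>])
qed

lemma T_add_closed: "X \<in> carrier T \<Longrightarrow> Y \<in> carrier T \<Longrightarrow> X \<oplus>\<^bsub>T\<^esub> Y \<in> carrier T"
  using abelian_monoid.a_closed[OF abelian_monoid_T] .

lemma T_smult_closed:
  assumes "c \<in> L_set n" "X \<in> carrier T"
  shows "c \<odot>\<^bsub>T\<^esub> X \<in> carrier T"
proof -
  obtain x where x: "X = cls x" "x \<in> chains" using assms(2) T_elem by meson
  show ?thesis
    unfolding x(1) smult_cls[OF assms(1)]
    by (rule cls_in, rule chains_frag_extend[where f = "\<lambda>m. m", OF x(2) _ _ scalar_ext_axioms])
      (simp_all add: assms(1) L_set_mult)
qed

lemma T_finsum_closed: "(\<And>i. i \<in> A \<Longrightarrow> f i \<in> carrier T) \<Longrightarrow> finsum T f A \<in> carrier T"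
  by (rule abelian_monoid.finsum_closed[OF abelian_monoid_T]) auto

lemma rval_zero: "lin_fun \<rho> \<Longrightarrow> rval \<rho> \<zero>\<^bsub>T\<^esub> = 0"
  by (simp only: zero_T rval_cls val_0)

lemma rval_finsum:
  assumes \<rho>: "lin_fun \<rho>" and "finite A" "\<And>i. i \<in> A \<Longrightarrow> f i \<in> carrier T"
  shows "rval \<rho> (finsum T f A) = (\<Sum>i\<in>A. rval \<rho> (f i))"
  using assms(2,3)
proof (induction A rule: finite_induct)
  case empty
  then show ?case
    by (simp add: abelian_monoid.finsum_empty[OF abelian_monoid_T] rval_zero[OF \<rho>])
next
  case (insert i A)
  have "finsum T f (insert i A) = f i \<oplus>\<^bsub>T\<^esub> finsum T f A"
    using insert by (intro abelian_monoid.finsum_insert[OF abelian_monoid_T]) auto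
  moreover have "finsum T f A \<in> carrier T" using insert by (intro T_finsum_closed) auto
  ultimately show ?case using insert by (simp add: rval_add[OF \<rho>])
qed

end

text \<open>Abstract form of fixed point localization. The functionals \<open>\<rho> i\<close> and
  the elements \<open>b i\<close> are dual up to the units \<open>d i\<close>, and
  \<open>expand\<close> says that the \<open>b i\<close> span after extension of scalars. Then the
  \<open>\<rho> i\<close> are coordinates: \<open>T_eqI\<close> is their joint injectivity,
  \<open>T_exists\<close> their joint surjectivity.\<close>

locale localized = scalar_ext n M for n and M :: "(pol, 'm) module" +
  fixes idx :: "'i set" and \<rho> :: "'i \<Rightarrow> 'm \<Rightarrow> rat_fun" and b :: "'i \<Rightarrow> 'm" and d :: "'i \<Rightarrow> rat_fun"
  assumes finite_idx: "finite idx"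
    and lin: "i \<in> idx \<Longrightarrow> lin_fun (\<rho> i)"
    and b_in: "i \<in> idx \<Longrightarrow> b i \<in> carrier M"
    and d_unit: "i \<in> idx \<Longrightarrow> d i \<in> L_units n"
    and dual: "\<lbrakk>i \<in> idx; j \<in> idx\<rbrakk> \<Longrightarrow> \<rho> i (b j) = (if i = j then d i else 0)"
    and expand: "\<lbrakk>h \<in> carrier M; c \<in> L_set n\<rbrakk> \<Longrightarrow>
      frag_of (h, c) - (\<Sum>i\<in>idx. frag_of (b i, c * \<rho> i h / d i)) \<in> ker"
begin

lemma expand_chain:
  assumes "x \<in> chains"
  shows "x - (\<Sum>i\<in>idx. frag_of (b i, val (\<rho> i) x / d i)) \<in> ker"
proof -
  have "x \<in> chains \<and> x - (\<Sum>i\<in>idx. frag_of (b i, val (\<rho> i) x / d i)) \<in> ker"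
    using assms unfolding chains_def mem_Collect_eq
  proof (induction x rule: frag_induction)
    case zero
    have "(\<Sum>i\<in>idx. frag_of (b i, 0)) \<in> ker"
      by (intro ker_sum ker_zero_right b_in)
    then show ?case using ker_uminus by simp
  next
    case (one p)
    then show ?case using expand by (cases p) auto
  next
    case (diff x y)
    then have x: "x \<in> chains" "y \<in> chains" by (auto simp: chains_def)
    \<comment> \<open>Formal sums are not additive in the second slot, so splitting the coefficient
      of a difference costs an element of \<open>ker\<close>.\<close>
    have "(\<Sum>i\<in>idx. frag_of (b i, val (\<rho> i) (x - y) / d i)) -
      ((\<Sum>i\<in>idx. frag_of (b i, val (\<rho> i) x / d i)) - (\<Sum>i\<in>idx. frag_of (b i, val (\<rho> i) y / d i))) \<in> ker"
      unfolding sum_subtractf[symmetric]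
    proof (rule ker_sum)
      fix i assume i: "i \<in> idx"
      show "frag_of (b i, val (\<rho> i) (x - y) / d i) -
        (frag_of (b i, val (\<rho> i) x / d i) - frag_of (b i, val (\<rho> i) y / d i)) \<in> ker"
        unfolding val_diff diff_divide_distrib
        using i lin x by (intro ker_diff_right b_in L_set_divide val_in_L d_unit)
    qed
    from ker_diff[OF ker_diff[OF conjunct2[OF diff(1)] conjunct2[OF diff(2)]] this]
    show ?case using diff keys_diff[of x y] by (auto simp: algebra_simps)
  qed
  then show ?thesis ..
qed

lemma T_eqI:
  assumes "X \<in> carrier T" "Y \<in> carrier T" "\<And>i. i \<in> idx \<Longrightarrow> rval (\<rho> i) X = rval (\<rho> i) Y"
  shows "X = Y"
proof -
  obtain x y where x: "X = cls x" "x \<in> chains" and y: "Y = cls y" "y \<in> chains"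
    using assms(1,2) T_elem by meson
  have "val (\<rho> i) x = val (\<rho> i) y" if "i \<in> idx" for i
    using assms(3)[OF that] x(1) y(1) rval_cls[OF lin[OF that]] by simp
  then have s: "(\<Sum>i\<in>idx. frag_of (b i, val (\<rho> i) x / d i)) = (\<Sum>i\<in>idx. frag_of (b i, val (\<rho> i) y / d i))"
    by (intro sum.cong refl) simp
  have "x - y \<in> ker"
    using ker_trans[OF expand_chain[OF x(2)] ker_sym[OF expand_chain[OF y(2), folded s]]] .
  then show ?thesis unfolding x(1) y(1) cls_eq_iff .
qed

lemma T_exists:
  assumes "\<And>i. i \<in> idx \<Longrightarrow> w i \<in> L_set n"
  obtains X where "X \<in> carrier T" "\<And>i. i \<in> idx \<Longrightarrow> rval (\<rho> i) X = w i"
proof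
  let ?x = "\<Sum>i\<in>idx. frag_of (b i, w i / d i)"
  show "cls ?x \<in> carrier T"
    by (intro cls_in chains_sum chains_intros(5) b_in L_set_divide assms d_unit)
  fix i assume i: "i \<in> idx"
  have "rval (\<rho> i) (cls ?x) = (\<Sum>j\<in>idx. w j / d j * \<rho> i (b j))"
    by (simp add: rval_cls[OF lin[OF i]] val_sum)
  also have "\<dots> = (\<Sum>j\<in>idx. if j = i then w i / d i * d i else 0)"
    using i by (intro sum.cong refl) (auto simp: dual)
  also have "\<dots> = w i"
    using i d_unit[OF i] finite_idx by (simp add: L_units_def)
  finally show "rval (\<rho> i) (cls ?x) = w i" .
qed

end

lemma restr_eq_rval: "restr n I = rval (\<lambda>h. fp_HT n I (h (card I)))"
  by (rule ext) (simp add: restr_def rval_def val_def[abs_def])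

section \<open>The equivariant cohomology rings\<close>

lemma map_poly_subst_coeff: "coeff (map_poly (subst \<sigma>) p) j = subst \<sigma> (coeff p j)"
  by (simp add: coeff_map_poly)

lemma map_poly_subst_mult: "map_poly (subst \<sigma>) (p * q) = map_poly (subst \<sigma>) p * map_poly (subst \<sigma>) q"
  by (rule poly_eqI) (simp add: map_poly_subst_coeff coeff_mult subst_hom)

lemma map_poly_subst_diff: "map_poly (subst \<sigma>) (p - q) = map_poly (subst \<sigma>) p - map_poly (subst \<sigma>) q"
  by (rule poly_eqI) (simp add: map_poly_subst_coeff subst_hom)

lemma map_poly_subst_prod: "map_poly (subst \<sigma>) (\<Prod>i\<in>A. f i) = (\<Prod>i\<in>A. map_poly (subst \<sigma>) (f i))"
proof (induction A rule: infinite_finite_induct)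
  case (insert i A)
  then show ?case by (simp add: map_poly_subst_mult)
qed (simp_all add: map_poly_pCons one_pCons)

lemma map_poly_subst_linear: "map_poly (subst \<sigma>) [:- Var v, 1:] = [:- \<sigma> v, 1:]"
  by (simp add: map_poly_pCons subst_uminus)

lemma subst_coh_relation:
  "map_poly (subst \<sigma>) (coh_relation n k) =
     (\<Prod>i = 1..k. [:- \<sigma> (VG1 i), 1:]) * (\<Prod>i = 1..n - k. [:- \<sigma> (VG2 i), 1:])
     - (\<Prod>i = 1..n. [:- \<sigma> (VZ i), 1:])"
  by (simp only: coh_relation_def map_poly_subst_mult map_poly_subst_diff map_poly_subst_prod
      map_poly_subst_linear)

definition coh_vars :: "nat \<Rightarrow> nat \<Rightarrow> var set"
  where "coh_vars n k = VG1 ` {1..k} \<union> VG2 ` {1..n - k} \<union> VZ ` {1..n} \<union> {VY}"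

lemma invariants_eq:
  "invariants n k = {f \<in> pols_in (coh_vars n k).
     \<forall>\<pi> \<rho>. \<pi> permutes {1..k} \<longrightarrow> \<rho> permutes {1..n - k} \<longrightarrow> subst (perm_vars \<pi> \<rho>) f = f}"
  by (simp add: invariants_def coh_vars_def)

lemma zy_vars_subset: "zy_vars n \<subseteq> coh_vars n k"
  by (auto simp: zy_vars_def coh_vars_def)

lemma invariants_closed:
  "0 \<in> invariants n k" "1 \<in> invariants n k"
  "f \<in> invariants n k \<Longrightarrow> g \<in> invariants n k \<Longrightarrow> f + g \<in> invariants n k"
  "f \<in> invariants n k \<Longrightarrow> g \<in> invariants n k \<Longrightarrow> f - g \<in> invariants n k"
  "f \<in> invariants n k \<Longrightarrow> g \<in> invariants n k \<Longrightarrow> f * g \<in> invariants n k"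
  "f \<in> invariants n k \<Longrightarrow> - f \<in> invariants n k"
  by (auto simp: invariants_eq subst_hom intro: pols_in_add pols_in_diff pols_in_mult pols_in_uminus)

lemma invariants_sum: "(\<And>i. i \<in> A \<Longrightarrow> f i \<in> invariants n k) \<Longrightarrow> (\<Sum>i\<in>A. f i) \<in> invariants n k"
  by (induction A rule: infinite_finite_induct) (auto intro: invariants_closed)

lemma subst_perm_vars_zy: "f \<in> pols_in (zy_vars n) \<Longrightarrow> subst (perm_vars \<pi> \<rho>) f = f"
  by (rule trans[OF subst_cong[of f "zy_vars n" _ Var] subst_Var_id]) (auto simp: zy_vars_def perm_vars_def)

lemma pols_in_zy_invariants: "f \<in> pols_in (zy_vars n) \<Longrightarrow> f \<in> invariants n k"
  using zy_vars_subset[of n k] by (auto simp: invariants_eq subst_perm_vars_zy intro: pols_in_mono)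

definition restrict_vars :: "var set \<Rightarrow> var \<Rightarrow> pol"
  where "restrict_vars V v = (if v \<in> V then Var v else 0)"

lemma subst_restrict_vars: "p \<in> pols_in V \<Longrightarrow> subst (restrict_vars V) p = p"
  using subst_cong[of p V "restrict_vars V" Var] by (simp add: restrict_vars_def)

lemma subst_restrict_vars_in: "subst (restrict_vars V) p \<in> pols_in V"
  by (rule subst_in_pols_in[of p UNIV]) (auto simp: restrict_vars_def pols_in_Var pols_in_def[of UNIV])

text \<open>Sending all variables outside \<open>coh_vars n k\<close> to \<open>0\<close> fixes the
  relation, and the result of that substitution can contain no others.\<close>

lemma coh_relation_coeff_in: "coeff (coh_relation n k) j \<in> pols_in (coh_vars n k)"
proof -
  have "map_poly (subst (restrict_vars (coh_vars n k))) (coh_relation n k) = coh_relation n k"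
    unfolding subst_coh_relation unfolding coh_relation_def
    by (intro arg_cong2[where f = "(-)"] arg_cong2[where f = "(*)"] prod.cong refl)
      (auto simp: restrict_vars_def coh_vars_def)
  then have "coeff (coh_relation n k) j = subst (restrict_vars (coh_vars n k)) (coeff (coh_relation n k) j)"
    by (metis map_poly_subst_coeff)
  then show ?thesis
    using subst_restrict_vars_in[of "coh_vars n k" "coeff (coh_relation n k) j"] by simp
qed

lemma coh_relation_coeff_invariant:
  assumes "\<pi> permutes {1..k}" "\<rho> permutes {1..n - k}"
  shows "subst (perm_vars \<pi> \<rho>) (coeff (coh_relation n k) j) = coeff (coh_relation n k) j"
proof -
  have "(\<Prod>i = 1..k. [:- Var (VG1 (\<pi> i)), 1:]) = (\<Prod>i = 1..k. [:- Var (VG1 i), 1:])"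
    by (rule prod.reindex_bij_betw[OF permutes_imp_bij[OF assms(1)]])
  moreover have "(\<Prod>i = 1..n - k. [:- Var (VG2 (\<rho> i)), 1:]) = (\<Prod>i = 1..n - k. [:- Var (VG2 i), 1:])"
    by (rule prod.reindex_bij_betw[OF permutes_imp_bij[OF assms(2)]])
  ultimately have "map_poly (subst (perm_vars \<pi> \<rho>)) (coh_relation n k) = coh_relation n k"
    unfolding subst_coh_relation unfolding coh_relation_def perm_vars_def by simp
  then show ?thesis by (metis map_poly_subst_coeff)
qed

lemma coh_relation_coeff_invariants: "coeff (coh_relation n k) j \<in> invariants n k"
  by (auto simp: invariants_eq coh_relation_coeff_in coh_relation_coeff_invariant)

lemma subsets_of_cardD:
  assumes "I \<in> subsets_of_card n k"
  shows "I \<subseteq> {1..n}" "card I = k" "finite I" "finite ({1..n} - I)" "card ({1..n} - I) = n - k"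
  using assms finite_subset[of I "{1..n}"] card_Diff_subset[of I "{1..n}"]
  by (auto simp: subsets_of_card_def)

lemma finite_subsets_of_card: "finite (subsets_of_card n k)"
  by (rule finite_subset[of _ "Pow {1..n}"]) (auto simp: subsets_of_card_def)

text \<open>At the fixed point the two groups of Chern roots become the points of \<open>I\<close>
  and of its complement, so the two products merge into the product over all
  \<open>z\<close>.\<close>

lemma subst_fp_coh_relation:
  assumes I: "I \<in> subsets_of_card n k"
  shows "subst (fp_vars n I) (coeff (coh_relation n k) j) = 0"
proof -
  note ID = subsets_of_cardD[OF I]
  have "(\<Prod>i = 1..k. [:- Var (VZ (nth_elt I i)), 1:]) = (\<Prod>a\<in>I. [:- Var (VZ a), 1:])"
    by (rule prod.reindex_bij_betw[OF nth_elt_bij[OF ID(3,2)]])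
  moreover have "(\<Prod>i = 1..n - k. [:- Var (VZ (nth_elt ({1..n} - I) i)), 1:]) =
      (\<Prod>a\<in>{1..n} - I. [:- Var (VZ a), 1:])"
    by (rule prod.reindex_bij_betw[OF nth_elt_bij[OF ID(4,5)]])
  moreover have "(\<Prod>a\<in>I. [:- Var (VZ a), 1:]) * (\<Prod>a\<in>{1..n} - I. [:- Var (VZ a), 1:]) =
      (\<Prod>a = 1..n. [:- Var (VZ a), 1:])"
    using prod.subset_diff[OF ID(1) finite_atLeastAtMost, of "\<lambda>a. [:- Var (VZ a), 1:]"]
    by (simp add: mult.commute)
  ultimately have "map_poly (subst (fp_vars n I)) (coh_relation n k) = 0"
    unfolding subst_coh_relation fp_vars_def by simp
  then show ?thesis by (metis map_poly_subst_coeff coeff_0)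
qed

lemma ring_on_simps [simp]:
  "carrier (ring_on S) = S" "x \<oplus>\<^bsub>ring_on S\<^esub> y = x + y" "x \<otimes>\<^bsub>ring_on S\<^esub> y = x * y"
  "\<zero>\<^bsub>ring_on S\<^esub> = 0" "\<one>\<^bsub>ring_on S\<^esub> = 1"
  by (simp_all add: ring_on_def)

lemma cring_ring_on:
  fixes S :: "'a::comm_ring_1 set"
  assumes "0 \<in> S" "1 \<in> S" "\<And>x y. x \<in> S \<Longrightarrow> y \<in> S \<Longrightarrow> x + y \<in> S"
    "\<And>x y. x \<in> S \<Longrightarrow> y \<in> S \<Longrightarrow> x * y \<in> S" "\<And>x. x \<in> S \<Longrightarrow> - x \<in> S"
  shows "cring (ring_on S)"
proof (rule cringI)
  show "abelian_group (ring_on S)"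
    by (rule abelian_groupI) (use assms in \<open>auto simp: add_ac intro!: bexI[of _ "- _"]\<close>)
  show "comm_monoid (ring_on S)"
    by (rule comm_monoidI) (use assms in \<open>auto simp: mult_ac\<close>)
qed (simp add: distrib_right)

context
  fixes n k :: nat
begin

abbreviation "invR \<equiv> ring_on (invariants n k)"

lemma cring_invR: "cring invR"
  by (rule cring_ring_on) (rule invariants_closed | assumption)+

lemma ring_invR: "ring invR"
  using cring_invR by (rule cring.axioms(1))

lemma coh_gens: "{coeff (coh_relation n k) j | j. True} \<subseteq> invariants n k"
  using coh_relation_coeff_invariants by blast

lemma coh_ideal_ideal: "ideal (coh_ideal n k) invR"
  unfolding coh_ideal_def using coh_gens by (intro ring.genideal_ideal[OF ring_invR]) simp

lemma coh_ideal_gen: "coeff (coh_relation n k) j \<in> coh_ideal n k"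
  unfolding coh_ideal_def using ring.genideal_self[OF ring_invR, of "{coeff (coh_relation n k) j | j. True}"] coh_gens
  by auto

lemma coh_ideal_add: "f \<in> coh_ideal n k \<Longrightarrow> g \<in> coh_ideal n k \<Longrightarrow> f + g \<in> coh_ideal n k"
  using additive_subgroup.a_closed[OF ideal.axioms(1)[OF coh_ideal_ideal]] by simp

lemma coh_ideal_0: "0 \<in> coh_ideal n k"
  using additive_subgroup.zero_closed[OF ideal.axioms(1)[OF coh_ideal_ideal]] by simp

lemma coh_ideal_mult: "f \<in> coh_ideal n k \<Longrightarrow> g \<in> invariants n k \<Longrightarrow> g * f \<in> coh_ideal n k"
  using ideal.I_l_closed[OF coh_ideal_ideal] by simp

lemma coh_ideal_uminus: "f \<in> coh_ideal n k \<Longrightarrow> - f \<in> coh_ideal n k"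
  using coh_ideal_mult[of f "- 1"] invariants_closed(2,6) by simp

lemma coh_ideal_sum: "(\<And>i. i \<in> A \<Longrightarrow> f i \<in> coh_ideal n k) \<Longrightarrow> (\<Sum>i\<in>A. f i) \<in> coh_ideal n k"
  by (induction A rule: infinite_finite_induct) (auto intro: coh_ideal_add coh_ideal_0)

text \<open>The invariants vanishing at the fixed point form an ideal that contains the generators,
  and \<open>coh_ideal\<close> is the least such ideal.\<close>

lemma coh_ideal_vanish:
  assumes f: "f \<in> coh_ideal n k" and I: "I \<in> subsets_of_card n k"
  shows "subst (fp_vars n I) f = 0"
proof -
  define J where "J = {f \<in> invariants n k. subst (fp_vars n I) f = 0}"
  have "ideal J invR"
  proof (rule idealI[OF ring_invR])
    show "subgroup J (add_monoid invR)"
    proof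
      fix x assume x: "x \<in> J"
      have "\<ominus>\<^bsub>invR\<^esub> x = - x"
        using x invariants_closed(6)
        by (intro abelian_group.minus_equality[OF ring.is_abelian_group[OF ring_invR]]) (auto simp: J_def)
      then have "inv\<^bsub>add_monoid invR\<^esub> x = - x" by (simp add: a_inv_def)
      then show "inv\<^bsub>add_monoid invR\<^esub> x \<in> J"
        using x by (auto simp: J_def subst_hom intro: invariants_closed)
    qed (auto simp: J_def subst_hom intro: invariants_closed)
  qed (auto simp: J_def subst_hom intro: invariants_closed)
  then have "coh_ideal n k \<subseteq> J"
    unfolding coh_ideal_def
    by (rule ring.genideal_minimal[OF ring_invR])
      (auto simp: J_def coh_relation_coeff_invariants subst_fp_coh_relation[OF I])
  then show ?thesis using f by (auto simp: J_def)
qed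

lemma coh_class_eq: "coh_class n k f = {g. g - f \<in> coh_ideal n k}"
proof -
  have "coh_class n k f = (\<Union>h\<in>coh_ideal n k. {h + f})"
    by (simp add: coh_class_def a_r_coset_def')
  also have "\<dots> = {g. g - f \<in> coh_ideal n k}"
    by (auto simp: diff_eq_eq intro: bexI[of _ "_ - f"])
  finally show ?thesis .
qed

lemma coh_class_eqI:
  assumes "f - g \<in> coh_ideal n k"
  shows "coh_class n k f = coh_class n k g"
proof -
  have "h - f \<in> coh_ideal n k \<longleftrightarrow> h - g \<in> coh_ideal n k" for h
    using coh_ideal_add[OF _ assms, of "h - f"] coh_ideal_add[OF _ coh_ideal_uminus[OF assms], of "h - g"]
    by auto
  then show ?thesis by (simp add: coh_class_eq)
qed

lemma HT_carrier: "carrier (HT n k) = coh_class n k ` invariants n k"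
  unfolding HT_def Let_def by (auto simp: FactRing_def A_RCOSETS_def' coh_class_def)

lemma HT_add:
  assumes "f \<in> invariants n k" "g \<in> invariants n k"
  shows "coh_class n k f \<oplus>\<^bsub>HT n k\<^esub> coh_class n k g = coh_class n k (f + g)"
  using ring_hom_add[OF ideal.rcos_ring_hom[OF coh_ideal_ideal], of f g] assms
  by (simp add: HT_def Let_def coh_class_def)

lemma HT_smult:
  assumes "r \<in> invariants n k" "f \<in> invariants n k"
  shows "r \<odot>\<^bsub>HT n k\<^esub> coh_class n k f = coh_class n k (r * f)"
  using ring_hom_mult[OF ideal.rcos_ring_hom[OF coh_ideal_ideal], of r f] assms
  by (simp add: HT_def Let_def coh_class_def)

lemma HT_zero: "\<zero>\<^bsub>HT n k\<^esub> = coh_class n k 0"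
  by (simp add: HT_def Let_def FactRing_def coh_class_eq)

text \<open>Restriction is well defined on classes: representatives differ by elements of the ideal,
  which vanish at the fixed point.\<close>

lemma fp_HT_coh_class:
  assumes I: "I \<in> subsets_of_card n k"
  shows "fp_HT n I (coh_class n k f) = fp_pol n I f"
proof -
  have "fp_pol n I ` coh_class n k f = (\<lambda>_. fp_pol n I f) ` coh_class n k f"
  proof (rule image_cong[OF refl])
    fix g assume "g \<in> coh_class n k f"
    then have "subst (fp_vars n I) (g - f) = 0"
      by (intro coh_ideal_vanish[OF _ I]) (simp add: coh_class_eq)
    then show "fp_pol n I g = fp_pol n I f" by (simp add: fp_pol_def subst_diff)
  qed
  also have "\<dots> = {fp_pol n I f}"
    by (rule image_constant[of f]) (simp add: coh_class_eq coh_ideal_0)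
  finally show ?thesis by (simp add: fp_HT_def)
qed

lemma HT_scalar_ext: "scalar_ext n (HT n k)"
  by standard (auto simp: HT_carrier HT_add HT_smult pols_in_zy_invariants invariants_closed)

lemma fp_pol_in_L:
  assumes I: "I \<in> subsets_of_card n k" and f: "f \<in> invariants n k"
  shows "subst (fp_vars n I) f \<in> pols_in (zy_vars n)"
proof (rule subst_in_pols_in)
  show "f \<in> pols_in (coh_vars n k)" using f by (simp add: invariants_eq)
  fix v assume v: "v \<in> coh_vars n k"
  note ID = subsets_of_cardD[OF I]
  have "nth_elt I i \<in> {1..n}" if "i \<in> {1..k}" for i
    using bij_betwE[OF nth_elt_bij[OF ID(3,2)]] that ID(1) by blast
  moreover have "nth_elt ({1..n} - I) i \<in> {1..n}" if "i \<in> {1..n - k}" for i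
    using bij_betwE[OF nth_elt_bij[OF ID(4,5)]] that by blast
  ultimately have "\<exists>w\<in>zy_vars n. fp_vars n I v = Var w"
    using v by (auto simp: coh_vars_def fp_vars_def zy_vars_def)
  then show "fp_vars n I v \<in> pols_in (zy_vars n)" using pols_in_Var by auto
qed

lemma subst_zy_id:
  "f \<in> pols_in (zy_vars n) \<Longrightarrow> subst (fp_vars n I) f = f"
  by (rule trans[OF subst_cong[of f "zy_vars n" _ Var] subst_Var_id]) (auto simp: zy_vars_def fp_vars_def)

end

section \<open>Localization at the fixed points\<close>

text \<open>Lagrange interpolation of the constant \<open>1\<close>, multiplied by all the
  denominators \<open>c a\<close>. The difference of the two sides is a polynomial in
  \<open>x\<close> of degree below \<open>card A\<close> that vanishes at the \<open>card A\<close>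
  distinct points \<open>z a\<close>.\<close>

lemma lagrange_idom:
  fixes z :: "nat \<Rightarrow> 'a::idom"
  assumes A: "finite A" "A \<noteq> {}" and z: "inj_on z A"
  defines "c \<equiv> \<lambda>a. \<Prod>b\<in>A - {a}. z a - z b"
  shows "(\<Sum>a\<in>A. (\<Prod>a'\<in>A - {a}. c a') * (\<Prod>b\<in>A - {a}. x - z b)) = (\<Prod>a\<in>A. c a)"
proof -
  define q where "q = (\<Sum>a\<in>A. smult (\<Prod>a'\<in>A - {a}. c a') (\<Prod>b\<in>A - {a}. [:- z b, 1:])) - [:\<Prod>a\<in>A. c a:]"
  have pq: "poly q x = (\<Sum>a\<in>A. (\<Prod>a'\<in>A - {a}. c a') * (\<Prod>b\<in>A - {a}. x - z b)) - (\<Prod>a\<in>A. c a)" for x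
    by (simp add: q_def poly_sum poly_prod)
  have "degree (\<Prod>b\<in>A - {a}. [:- z b, 1:]) \<le> card A - 1" if "a \<in> A" for a
  proof -
    have "degree (\<Prod>b\<in>A - {a}. [:- z b, 1:]) \<le> (\<Sum>b\<in>A - {a}. (degree \<circ> (\<lambda>b. [:- z b, 1:])) b)"
      by (rule degree_prod_sum_le) (use A in simp)
    also have "\<dots> = card A - 1" using that A by simp
    finally show ?thesis .
  qed
  then have "degree (\<Sum>a\<in>A. smult (\<Prod>a'\<in>A - {a}. c a') (\<Prod>b\<in>A - {a}. [:- z b, 1:])) \<le> card A - 1"
    using A by (intro degree_sum_le order.trans[OF degree_smult_le]) auto
  then have deg: "degree q \<le> card A - 1"
    unfolding q_def by (intro degree_diff_le) auto
  have root: "poly q (z a) = 0" if a: "a \<in> A" for a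
  proof -
    have "(\<Sum>a'\<in>A. (\<Prod>a''\<in>A - {a'}. c a'') * (\<Prod>b\<in>A - {a'}. z a - z b)) =
      (\<Sum>a'\<in>A. if a' = a then (\<Prod>a''\<in>A - {a}. c a'') * c a else 0)"
    proof (rule sum.cong[OF refl])
      fix a' assume a': "a' \<in> A"
      show "(\<Prod>a''\<in>A - {a'}. c a'') * (\<Prod>b\<in>A - {a'}. z a - z b) =
          (if a' = a then (\<Prod>a''\<in>A - {a}. c a'') * c a else 0)"
      proof (cases "a' = a")
        case False
        then have "(\<Prod>b\<in>A - {a'}. z a - z b) = 0"
          using a A by (intro prod_zero) auto
        then show ?thesis using False by simp
      qed (simp add: c_def)
    qed
    also have "\<dots> = (\<Prod>a\<in>A. c a)"
      using a A by (simp add: prod.remove[OF A(1) a] mult.commute)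
    finally show ?thesis by (simp add: pq)
  qed
  have "q = 0"
  proof (rule ccontr)
    assume q: "q \<noteq> 0"
    have "z ` A \<subseteq> {x. poly q x = 0}" using root by auto
    then have "card (z ` A) \<le> card {x. poly q x = 0}"
      using poly_roots_finite[OF q] by (rule card_mono[rotated])
    also have "\<dots> \<le> degree q" by (rule card_poly_roots_bound[OF q])
    finally show False
      using deg card_image[OF z] A card_gt_0_iff[of A] by linarith
  qed
  then show ?thesis using pq[of x] by simp
qed

text \<open>Applied with \<open>R x y\<close> meaning \<open>(x - y) * e \<in> coh_span n k\<close>,
  that is, equality modulo the relations after multiplication by an interpolation
  idempotent.\<close>

lemma subst_congruence:
  assumes refl: "\<And>x. R x x" and add: "\<And>x y x' y'. R x y \<Longrightarrow> R x' y' \<Longrightarrow> R (x + x') (y + y')"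
    and mult: "\<And>x y x' y'. R x y \<Longrightarrow> R x' y' \<Longrightarrow> R (x * x') (y * y')"
    and f: "f \<in> pols_in V" and V: "\<And>v. v \<in> V \<Longrightarrow> R (\<sigma> v) (\<tau> v)"
  shows "R (subst \<sigma> f) (subst \<tau> f)"
proof -
  have sum: "R (\<Sum>i\<in>A. g i) (\<Sum>i\<in>A. h i)" if "\<And>i. i \<in> A \<Longrightarrow> R (g i) (h i)"
    for A :: "(var \<Rightarrow>\<^sub>0 nat) set" and g h
    using that by (induction A rule: infinite_finite_induct) (auto intro: refl add)
  have prod: "R (\<Prod>i\<in>A. g i) (\<Prod>i\<in>A. h i)" if "\<And>i. i \<in> A \<Longrightarrow> R (g i) (h i)" for A :: "var set" and g h
    using that by (induction A rule: infinite_finite_induct) (auto intro: refl mult)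
  have pow: "R (x ^ m) (y ^ m)" if "R x y" for x y and m :: nat
    using that by (induction m) (auto intro: refl mult)
  show ?thesis
    unfolding subst_def
    by (intro sum mult prod refl pow V) (use f in \<open>auto simp: pols_in_def\<close>)
qed

text \<open>The ideal generated by the relations in the ring of all polynomials. The interpolation
  idempotents are not invariant, so the computation takes place here, and
  \<open>span_invariant_imp_ideal\<close> brings the outcome back to
  \<open>coh_ideal\<close>.\<close>

definition coh_span :: "nat \<Rightarrow> nat \<Rightarrow> pol set"
  where "coh_span n k = {p. \<exists>q. p = (\<Sum>j\<le>degree (coh_relation n k). q j * coeff (coh_relation n k) j)}"

lemma coh_span_add: "p \<in> coh_span n k \<Longrightarrow> p' \<in> coh_span n k \<Longrightarrow> p + p' \<in> coh_span n k"
proof -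
  assume "p \<in> coh_span n k" "p' \<in> coh_span n k"
  then obtain q q' where "p = (\<Sum>j\<le>degree (coh_relation n k). q j * coeff (coh_relation n k) j)"
    "p' = (\<Sum>j\<le>degree (coh_relation n k). q' j * coeff (coh_relation n k) j)"
    by (auto simp: coh_span_def)
  then have "p + p' = (\<Sum>j\<le>degree (coh_relation n k). (q j + q' j) * coeff (coh_relation n k) j)"
    by (simp add: distrib_right sum.distrib)
  then show ?thesis unfolding coh_span_def by (intro CollectI exI[of _ "\<lambda>j. q j + q' j"])
qed

lemma coh_span_mult: "p \<in> coh_span n k \<Longrightarrow> r * p \<in> coh_span n k"
proof -
  assume "p \<in> coh_span n k"
  then obtain q where "p = (\<Sum>j\<le>degree (coh_relation n k). q j * coeff (coh_relation n k) j)"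
    by (auto simp: coh_span_def)
  then have "r * p = (\<Sum>j\<le>degree (coh_relation n k). (r * q j) * coeff (coh_relation n k) j)"
    by (simp add: sum_distrib_left mult.assoc)
  then show ?thesis unfolding coh_span_def by (intro CollectI exI[of _ "\<lambda>j. r * q j"])
qed

lemma coh_span_0: "0 \<in> coh_span n k"
  unfolding coh_span_def by (intro CollectI exI[of _ "\<lambda>_. 0"]) simp

lemma coh_span_uminus: "p \<in> coh_span n k \<Longrightarrow> - p \<in> coh_span n k"
  using coh_span_mult[of p n k "- 1"] by simp

lemma coh_span_diff: "p \<in> coh_span n k \<Longrightarrow> p' \<in> coh_span n k \<Longrightarrow> p - p' \<in> coh_span n k"
  using coh_span_add[of p n k "- p'"] coh_span_uminus by simp

lemma coh_span_sum: "(\<And>i. i \<in> A \<Longrightarrow> f i \<in> coh_span n k) \<Longrightarrow> (\<Sum>i\<in>A. f i) \<in> coh_span n k"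
  by (induction A rule: infinite_finite_induct) (auto intro: coh_span_add coh_span_0)

text \<open>Used with \<open>u\<close> a Chern root, where the product over the Chern roots
  vanishes, and with \<open>u\<close> one of the \<open>z\<close>, where the product over the
  \<open>z\<close> vanishes.\<close>

lemma coh_span_poly: "poly (coh_relation n k) u \<in> coh_span n k"
  unfolding coh_span_def poly_altdef
  by (intro CollectI exI[of _ "\<lambda>j. u ^ j"]) (simp add: mult.commute)

text \<open>The Chern roots of both groups in one sequence, so that a map \<open>s\<close> on
  \<open>{1..n}\<close> encodes a choice of point for all of them.\<close>

definition gam :: "nat \<Rightarrow> nat \<Rightarrow> pol"
  where "gam k i = (if i \<le> k then Var (VG1 i) else Var (VG2 (i - k)))"

abbreviation zv :: "nat \<Rightarrow> pol" where "zv a \<equiv> Var (VZ a)"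

definition disc :: "nat \<Rightarrow> pol"
  where "disc n = (\<Prod>a = 1..n. \<Prod>b\<in>{1..n} - {a}. zv a - zv b)"

lemma poly_coh_relation:
  assumes "k \<le> n"
  shows "poly (coh_relation n k) u = (\<Prod>i = 1..n. u - gam k i) - (\<Prod>a = 1..n. u - zv a)"
proof -
  have 1: "(\<Prod>i = 1..k. u - Var (VG1 i)) = (\<Prod>i = 1..k. u - gam k i)"
    by (rule prod.cong) (auto simp: gam_def)
  have 2: "(\<Prod>i = 1..n - k. u - Var (VG2 i)) = (\<Prod>i = k + 1..n. u - gam k i)"
    by (rule prod.reindex_bij_witness[of _ "\<lambda>i. i - k" "\<lambda>i. i + k"]) (use assms in \<open>auto simp: gam_def\<close>)
  have "{1..n} = {1..k} \<union> {k + 1..n}" using assms by auto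
  then have "(\<Prod>i = 1..n. u - gam k i) = (\<Prod>i = 1..k. u - gam k i) * (\<Prod>i = k + 1..n. u - gam k i)"
    by (simp only:) (rule prod.union_disjoint, auto)
  then show ?thesis
    using 1 2 by (simp add: coh_relation_def poly_prod)
qed

definition eval_vars :: "nat \<Rightarrow> (nat \<Rightarrow> nat) \<Rightarrow> var \<Rightarrow> pol"
  where "eval_vars k s v = (case v of VG1 i \<Rightarrow> zv (s i) | VG2 i \<Rightarrow> zv (s (k + i)) | _ \<Rightarrow> Var v)"

text \<open>
  Up to a power of the discriminant, \<open>idem n k s\<close> is the Lagrange idempotent of the point
  \<open>\<gamma> i = z (s i)\<close>; here \<open>s\<close> is any map, and the idempotents of noninjective maps turn out to be
  torsion in the cohomology ring.
\<close>

definition idem :: "nat \<Rightarrow> nat \<Rightarrow> (nat \<Rightarrow> nat) \<Rightarrow> pol"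
  where "idem n k s = (\<Prod>i = 1..n. (\<Prod>a\<in>{1..n} - {s i}. \<Prod>b\<in>{1..n} - {a}. zv a - zv b) *
     (\<Prod>b\<in>{1..n} - {s i}. gam k i - zv b))"

lemma zv_inj: "inj_on zv A"
  using zz_inj[of A] unfolding inj_on_def by auto

text \<open>Each of the \<open>n\<close> Chern roots gives one copy of \<open>lagrange_idom\<close>
  with value \<open>disc n\<close>; the product of the copies is expanded over all maps
  \<open>s\<close>.\<close>

lemma sum_idem:
  assumes "n \<ge> 1"
  shows "(\<Sum>s\<in>{1..n} \<rightarrow>\<^sub>E {1..n}. idem n k s) = disc n ^ n"
proof -
  have "(\<Sum>s\<in>{1..n} \<rightarrow>\<^sub>E {1..n}. idem n k s) =
    (\<Prod>i = 1..n. \<Sum>a = 1..n. (\<Prod>a'\<in>{1..n} - {a}. \<Prod>b\<in>{1..n} - {a'}. zv a' - zv b) *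
     (\<Prod>b\<in>{1..n} - {a}. gam k i - zv b))"
    unfolding idem_def by (rule prod_sum_PiE[symmetric]) auto
  also have "\<dots> = (\<Prod>i = 1..n. disc n)"
  proof (rule prod.cong[OF refl])
    fix i
    show "(\<Sum>a = 1..n. (\<Prod>a'\<in>{1..n} - {a}. \<Prod>b\<in>{1..n} - {a'}. zv a' - zv b) *
     (\<Prod>b\<in>{1..n} - {a}. gam k i - zv b)) = disc n"
      unfolding disc_def by (rule lagrange_idom) (use assms zv_inj in auto)
  qed
  finally show ?thesis by simp
qed

context
  fixes n k :: nat
  assumes k: "k \<le> n"
begin

text \<open>\<open>idem n k s\<close> contains all factors \<open>gam k i - zv b\<close> except the
  one for \<open>b = s i\<close>; supplying it completes the product to minus the value of the
  relation at \<open>gam k i\<close>.\<close>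

lemma gam_idem:
  assumes s: "s \<in> {1..n} \<rightarrow>\<^sub>E {1..n}" and i: "i \<in> {1..n}"
  shows "(gam k i - zv (s i)) * idem n k s \<in> coh_span n k"
proof -
  have si: "s i \<in> {1..n}" using s i by auto
  have "(\<Prod>a = 1..n. gam k i - zv a) = - poly (coh_relation n k) (gam k i)"
  proof -
    have "(\<Prod>i' = 1..n. gam k i - gam k i') = 0"
      by (rule prod_zero) (use i in auto)
    then show ?thesis by (simp add: poly_coh_relation[OF k])
  qed
  then have 1: "(\<Prod>a = 1..n. gam k i - zv a) \<in> coh_span n k"
    using coh_span_uminus[OF coh_span_poly] by simp
  have 2: "(\<Prod>a = 1..n. gam k i - zv a) = (gam k i - zv (s i)) * (\<Prod>b\<in>{1..n} - {s i}. gam k i - zv b)"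
    by (rule prod.remove[OF _ si]) simp
  define r where "r = (\<Prod>a\<in>{1..n} - {s i}. \<Prod>b\<in>{1..n} - {a}. zv a - zv b)"
  define r' where "r' = (\<Prod>i\<in>{1..n} - {i}. (\<Prod>a\<in>{1..n} - {s i}. \<Prod>b\<in>{1..n} - {a}. zv a - zv b) *
     (\<Prod>b\<in>{1..n} - {s i}. gam k i - zv b))"
  have 3: "idem n k s = r * (\<Prod>b\<in>{1..n} - {s i}. gam k i - zv b) * r'"
    unfolding idem_def r_def r'_def by (rule prod.remove[OF _ i]) simp
  have "(gam k i - zv (s i)) * idem n k s = (r * r') * (\<Prod>a = 1..n. gam k i - zv a)"
    unfolding 2 3 by (simp only: mult_ac)
  then show ?thesis using coh_span_mult[OF 1] by simp
qed

text \<open>On the idempotent each Chern root acts as the point \<open>zv (s i)\<close>; since this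
  is compatible with sums and products, it extends from variables to all polynomials.\<close>

lemma eval_idem:
  assumes s: "s \<in> {1..n} \<rightarrow>\<^sub>E {1..n}" and f: "f \<in> pols_in (coh_vars n k)"
  shows "(f - subst (eval_vars k s) f) * idem n k s \<in> coh_span n k"
proof -
  define e where "e = idem n k s"
  have "(subst Var f - subst (eval_vars k s) f) * e \<in> coh_span n k"
  proof (rule subst_congruence[where R = "\<lambda>x y. (x - y) * e \<in> coh_span n k", OF _ _ _ f])
    fix x y x' y' :: pol assume xy: "(x - y) * e \<in> coh_span n k" "(x' - y') * e \<in> coh_span n k"
    have "(x + x' - (y + y')) * e = (x - y) * e + (x' - y') * e" by (simp add: algebra_simps)
    then show "(x + x' - (y + y')) * e \<in> coh_span n k" using coh_span_add[OF xy] by simp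
    have "(x * x' - y * y') * e = x * ((x' - y') * e) + y' * ((x - y) * e)" by (simp add: algebra_simps)
    then show "(x * x' - y * y') * e \<in> coh_span n k"
      using coh_span_add[OF coh_span_mult[OF xy(2)] coh_span_mult[OF xy(1)]] by simp
  next
    fix v assume v: "v \<in> coh_vars n k"
    then consider i where "v = VG1 i" "i \<in> {1..k}" | i where "v = VG2 i" "i \<in> {1..n - k}"
      | "Var v = eval_vars k s v"
      by (auto simp: coh_vars_def eval_vars_def)
    then show "(Var v - eval_vars k s v) * e \<in> coh_span n k"
    proof cases
      case 1
      then show ?thesis using gam_idem[OF s, of i] k by (simp add: eval_vars_def gam_def e_def)
    next
      case 2
      then have "k + i \<in> {1..n}" "\<not> k + i \<le> k" using k by auto
      then show ?thesis
        using gam_idem[OF s, of "k + i"] 2(1) by (simp only: eval_vars_def gam_def e_def var.case if_False add_diff_cancel_left')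
    next
      case 3
      then show ?thesis by (simp add: coh_span_0)
    qed
  qed (simp add: coh_span_0)
  then show ?thesis by (simp add: e_def)
qed

text \<open>A noninjective \<open>s\<close> misses some \<open>c\<close>. The product
  \<open>F\<close> of the \<open>zv c - gam k i\<close> is the relation at \<open>zv c\<close>,
  hence acts as \<open>0\<close>, while on the idempotent it acts as \<open>\<delta>\<close>, a
  product of \<open>n\<close> differences each dividing the discriminant. So
  \<open>disc n ^ n\<close>, a multiple of \<open>\<delta>\<close>, kills the idempotent.\<close>

lemma disc_idem_noninjective:
  assumes s: "s \<in> {1..n} \<rightarrow>\<^sub>E {1..n}" and "\<not> inj_on s {1..n}"
  shows "disc n ^ n * idem n k s \<in> coh_span n k"
proof -
  have "s ` {1..n} \<noteq> {1..n}"
    using assms(2) eq_card_imp_inj_on[of "{1..n}" s] by fastforce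
  then obtain c where c: "c \<in> {1..n}" "c \<notin> s ` {1..n}" using s by blast
  define F where "F = (\<Prod>i = 1..n. zv c - gam k i)"
  define \<delta> where "\<delta> = (\<Prod>i = 1..n. zv c - zv (s i))"
  have "(\<Prod>a = 1..n. zv c - zv a) = 0"
    by (rule prod_zero) (use c in auto)
  then have "F = poly (coh_relation n k) (zv c)"
    by (simp add: poly_coh_relation[OF k] F_def)
  then have "F \<in> coh_span n k" using coh_span_poly by simp
  then have 1: "F * idem n k s \<in> coh_span n k" using coh_span_mult by (simp add: mult.commute)
  have gv: "gam k i \<in> pols_in (coh_vars n k)" if "i \<in> {1..n}" for i
  proof (cases "i \<le> k")
    case True
    then show ?thesis using that by (auto simp: gam_def coh_vars_def intro!: pols_in_Var)
  next
    case False
    then have "i - k \<in> {1..n - k}" using that k by auto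
    then show ?thesis using False by (auto simp: gam_def coh_vars_def intro!: pols_in_Var)
  qed
  have "F \<in> pols_in (coh_vars n k)"
    unfolding F_def using c(1) by (intro pols_in_prod pols_in_diff gv pols_in_Var) (auto simp: coh_vars_def)
  moreover have "subst (eval_vars k s) F = \<delta>"
    unfolding F_def \<delta>_def subst_prod
    by (intro prod.cong refl) (auto simp: subst_diff gam_def eval_vars_def)
  ultimately have "(F - \<delta>) * idem n k s \<in> coh_span n k" using eval_idem[OF s] by metis
  from coh_span_diff[OF 1 this] have 2: "\<delta> * idem n k s \<in> coh_span n k"
    by (simp add: algebra_simps)
  have "zv c - zv (s i) dvd disc n" if "i \<in> {1..n}" for i
  proof -
    have "s i \<in> {1..n} - {c}" using that s c(2) by blast
    then have "zv c - zv (s i) dvd (\<Prod>b\<in>{1..n} - {c}. zv c - zv b)"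
      by (intro dvd_prodI) auto
    also have "\<dots> dvd disc n"
      unfolding disc_def using dvd_prodI[of "{1..n}" c "\<lambda>a. \<Prod>b\<in>{1..n} - {a}. zv a - zv b"] c(1) by simp
    finally show ?thesis .
  qed
  then have "\<delta> dvd (\<Prod>i = 1..n. disc n)"
    unfolding \<delta>_def by (rule prod_dvd_prod)
  then obtain m where "disc n ^ n = \<delta> * m" by auto
  then have "disc n ^ n * idem n k s = m * (\<delta> * idem n k s)" by (simp add: mult_ac)
  then show ?thesis using coh_span_mult[OF 2] by (simp only:)
qed

text \<open>One power \<open>disc n ^ n\<close> decomposes \<open>f\<close> into its products with
  the idempotents; the second is spent on the idempotents of noninjective maps. For bijective
  \<open>s\<close> the idempotent evaluates \<open>f\<close> at \<open>s\<close>, which gives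
  \<open>0\<close> by hypothesis.\<close>

lemma vanishing_imp_span:
  assumes n: "n \<ge> 1" and f: "f \<in> pols_in (coh_vars n k)"
    and van: "\<And>s. bij_betw s {1..n} {1..n} \<Longrightarrow> subst (eval_vars k s) f = 0"
  shows "disc n ^ n * disc n ^ n * f \<in> coh_span n k"
proof -
  have "disc n ^ n * disc n ^ n * f = (\<Sum>s\<in>{1..n} \<rightarrow>\<^sub>E {1..n}. disc n ^ n * (f * idem n k s))"
    by (simp add: sum_idem[OF n, of k, symmetric] sum_distrib_left sum_distrib_right mult_ac)
  also have "\<dots> \<in> coh_span n k"
  proof (rule coh_span_sum)
    fix s assume s: "s \<in> {1..n} \<rightarrow>\<^sub>E {1..n}"
    show "disc n ^ n * (f * idem n k s) \<in> coh_span n k"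
    proof (cases "inj_on s {1..n}")
      case True
      have "s ` {1..n} \<subseteq> {1..n}" using s by auto
      then have "bij_betw s {1..n} {1..n}"
        using True endo_inj_surj[of "{1..n}" s] by (simp add: bij_betw_def)
      then show ?thesis using eval_idem[OF s f] by (intro coh_span_mult[of "f * _"]) (simp add: van)
    next
      case False
      then show ?thesis using coh_span_mult[OF disc_idem_noninjective[OF s False], of f] by (simp add: mult_ac)
    qed
  qed
  finally show ?thesis .
qed

text \<open>Fixed point substitution lists a set and its complement in increasing order;
  \<open>s\<close> lists them in another order, and the difference is an element of S_k \<times>
  S_(n-k), which an invariant does not notice.\<close>

lemma eval_vars_eq_fp:
  assumes s: "bij_betw s {1..n} {1..n}" and f: "f \<in> invariants n k"
  shows "subst (eval_vars k s) f = subst (fp_vars n (s ` {1..k})) f"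
    and "s ` {1..k} \<in> subsets_of_card n k"
proof -
  define I where "I = s ` {1..k}"
  have kn: "{1..k} \<subseteq> {1..n}" using k by auto
  have inj: "inj_on s {1..n}" and im: "s ` {1..n} = {1..n}" using s by (auto simp: bij_betw_def)
  have "I \<subseteq> {1..n}" unfolding I_def using kn im by blast
  moreover have "card I = k" unfolding I_def using card_image[OF inj_on_subset[OF inj kn]] by simp
  ultimately show I: "s ` {1..k} \<in> subsets_of_card n k" by (simp add: subsets_of_card_def I_def)
  note ID = subsets_of_cardD[OF I, folded I_def]
  have compl: "{1..n} - I = s ` {k + 1..n}"
  proof -
    have "{1..n} - I = s ` ({1..n} - {1..k})"
      unfolding I_def using inj_on_image_set_diff[OF inj Diff_subset kn] im by simp
    also have "{1..n} - {1..k} = {k + 1..n}" by auto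
    finally show ?thesis .
  qed
  define \<pi> where "\<pi> i = (if i \<in> {1..k} then inv_into {1..k} (nth_elt I) (s i) else i)" for i
  define \<rho> where "\<rho> i = (if i \<in> {1..n - k} then inv_into {1..n - k} (nth_elt ({1..n} - I)) (s (k + i)) else i)" for i
  have b1: "bij_betw s {1..k} I" unfolding I_def by (rule inj_on_imp_bij_betw[OF inj_on_subset[OF inj kn]])
  have b2: "bij_betw (\<lambda>i. s (k + i)) {1..n - k} ({1..n} - I)"
  proof -
    have "bij_betw ((+) k) {1..n - k} {k + 1..n}"
      by (rule bij_betwI[where g = "\<lambda>i. i - k"]) (use k in auto)
    moreover have "bij_betw s {k + 1..n} ({1..n} - I)"
      unfolding compl by (rule inj_on_imp_bij_betw) (rule inj_on_subset[OF inj], auto)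
    ultimately show ?thesis using bij_betw_trans by (fastforce simp: comp_def)
  qed
  note e1 = nth_elt_bij[OF ID(3,2)] and e2 = nth_elt_bij[OF ID(4,5)]
  have "bij_betw \<pi> {1..k} {1..k}"
    using bij_betw_trans[OF b1 bij_betw_inv_into[OF e1]]
    by (rule bij_betw_cong[THEN iffD1, rotated]) (simp add: \<pi>_def)
  then have \<pi>: "\<pi> permutes {1..k}" by (rule bij_imp_permutes) (auto simp: \<pi>_def)
  have "bij_betw \<rho> {1..n - k} {1..n - k}"
    using bij_betw_trans[OF b2 bij_betw_inv_into[OF e2]]
    by (rule bij_betw_cong[THEN iffD1, rotated]) (simp add: \<rho>_def)
  then have \<rho>: "\<rho> permutes {1..n - k}" by (rule bij_imp_permutes) (auto simp: \<rho>_def)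
  have n1: "nth_elt I (\<pi> i) = s i" if "i \<in> {1..k}" for i
    using bij_betw_inv_into_right[OF e1] bij_betwE[OF b1] that by (simp add: \<pi>_def)
  have n2: "nth_elt ({1..n} - I) (\<rho> i) = s (k + i)" if "i \<in> {1..n - k}" for i
    using bij_betw_inv_into_right[OF e2] bij_betwE[OF b2] that by (simp add: \<rho>_def)
  have "subst (fp_vars n I) f = subst (fp_vars n I) (subst (perm_vars \<pi> \<rho>) f)"
    using f \<pi> \<rho> by (simp add: invariants_eq)
  also have "\<dots> = subst (\<lambda>v. subst (fp_vars n I) (perm_vars \<pi> \<rho> v)) f"
    by (rule subst_subst)
  also have "\<dots> = subst (eval_vars k s) f"
  proof (rule subst_cong)
    show "f \<in> pols_in (coh_vars n k)" using f by (simp add: invariants_eq)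
    fix v assume "v \<in> coh_vars n k"
    then show "subst (fp_vars n I) (perm_vars \<pi> \<rho> v) = eval_vars k s v"
      using n1 n2 by (auto simp: coh_vars_def perm_vars_def fp_vars_def eval_vars_def)
  qed
  finally show "subst (eval_vars k s) f = subst (fp_vars n (s ` {1..k})) f" by (simp add: I_def)
qed

section \<open>Descent to invariants by averaging\<close>

definition reynolds :: "pol \<Rightarrow> pol"
  where "reynolds q = (\<Sum>\<pi> | \<pi> permutes {1..k}. \<Sum>\<rho> | \<rho> permutes {1..n - k}.
     subst (perm_vars \<pi> \<rho>) (subst (restrict_vars (coh_vars n k)) q))"

text \<open>Variables outside \<open>coh_vars n k\<close> are set to \<open>0\<close> first, because
  the multipliers in \<open>coh_span\<close> are arbitrary polynomials. Composing with a fixed pair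
  of permutations then only reindexes the double sum.\<close>

lemma reynolds_invariant: "reynolds q \<in> invariants n k"
proof -
  have "subst (perm_vars \<pi> \<rho>) q' \<in> pols_in (coh_vars n k)"
    if "\<pi> permutes {1..k}" "\<rho> permutes {1..n - k}" "q' \<in> pols_in (coh_vars n k)" for \<pi> \<rho> q'
  proof (rule subst_in_pols_in[OF that(3)])
    fix v assume "v \<in> coh_vars n k"
    then have "\<exists>w\<in>coh_vars n k. perm_vars \<pi> \<rho> v = Var w"
      using permutes_in_image[OF that(1)] permutes_in_image[OF that(2)]
      by (auto simp: coh_vars_def perm_vars_def)
    then show "perm_vars \<pi> \<rho> v \<in> pols_in (coh_vars n k)" using pols_in_Var by auto
  qed
  then have 1: "reynolds q \<in> pols_in (coh_vars n k)"
    unfolding reynolds_def by (intro pols_in_sum) (auto simp: subst_restrict_vars_in)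
  have "subst (perm_vars \<alpha> \<beta>) (reynolds q) = reynolds q"
    if \<alpha>: "\<alpha> permutes {1..k}" and \<beta>: "\<beta> permutes {1..n - k}" for \<alpha> \<beta>
  proof -
    define q' where "q' = subst (restrict_vars (coh_vars n k)) q"
    have comp: "subst (perm_vars \<alpha> \<beta>) (subst (perm_vars \<pi> \<rho>) q') = subst (perm_vars (\<alpha> \<circ> \<pi>) (\<beta> \<circ> \<rho>)) q'" for \<pi> \<rho>
      unfolding subst_subst by (rule arg_cong[where f = "\<lambda>\<sigma>. subst \<sigma> q'"])
        (auto simp: perm_vars_def fun_eq_iff split: var.split)
    have "subst (perm_vars \<alpha> \<beta>) (reynolds q) = (\<Sum>\<pi> | \<pi> permutes {1..k}. \<Sum>\<rho> | \<rho> permutes {1..n - k}.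
        subst (perm_vars (\<alpha> \<circ> \<pi>) (\<beta> \<circ> \<rho>)) q')"
      unfolding reynolds_def q'_def[symmetric] subst_sum comp ..
    also have "\<dots> = (\<Sum>\<pi> | \<pi> permutes {1..k}. \<Sum>\<rho> | \<rho> permutes {1..n - k}. subst (perm_vars (\<alpha> \<circ> \<pi>) \<rho>) q')"
      by (rule sum.cong[OF refl], rule setum_permutations_compose_left[OF \<beta>, symmetric])
    also have "\<dots> = (\<Sum>\<pi> | \<pi> permutes {1..k}. \<Sum>\<rho> | \<rho> permutes {1..n - k}. subst (perm_vars \<pi> \<rho>) q')"
      by (rule setum_permutations_compose_left[OF \<alpha>, symmetric])
    finally show ?thesis by (simp add: reynolds_def q'_def)
  qed
  with 1 show ?thesis by (simp add: invariants_eq)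
qed

text \<open>The coefficients of the relation are invariant, so averaging acts on the multipliers
  \<open>q j\<close> alone and makes them invariant, while it multiplies \<open>p\<close> by the
  group order \<open>N\<close>.\<close>

lemma span_invariant_imp_ideal:
  assumes p: "p \<in> invariants n k" "p \<in> coh_span n k"
  shows "p \<in> coh_ideal n k"
proof -
  define N where "N = card {\<pi>. \<pi> permutes {1..k}} * card {\<rho>. \<rho> permutes {1..n - k}}"
  have N: "N \<noteq> 0" unfolding N_def by (simp add: card_permutations)
  let ?c = "coeff (coh_relation n k)"
  obtain q where q: "p = (\<Sum>j\<le>degree (coh_relation n k). q j * ?c j)"
    using p(2) by (auto simp: coh_span_def)
  have "subst (perm_vars \<pi> \<rho>) (subst (restrict_vars (coh_vars n k)) p) = p"
    if "\<pi> permutes {1..k}" "\<rho> permutes {1..n - k}" for \<pi> \<rho>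
    using that p(1) by (simp add: invariants_eq subst_restrict_vars)
  then have "of_nat N * p = reynolds p"
    unfolding reynolds_def N_def by (simp add: mult.assoc)
  also have "\<dots> = (\<Sum>j\<le>degree (coh_relation n k). reynolds (q j) * ?c j)"
  proof -
    have "subst (perm_vars \<pi> \<rho>) (subst (restrict_vars (coh_vars n k)) p) =
      (\<Sum>j\<le>degree (coh_relation n k). subst (perm_vars \<pi> \<rho>) (subst (restrict_vars (coh_vars n k)) (q j)) * ?c j)"
      if "\<pi> permutes {1..k}" "\<rho> permutes {1..n - k}" for \<pi> \<rho>
      unfolding q subst_sum subst_mult
      using that by (simp add: subst_restrict_vars[OF coh_relation_coeff_in] coh_relation_coeff_invariant)
    then have "reynolds p = (\<Sum>\<pi> | \<pi> permutes {1..k}. \<Sum>\<rho> | \<rho> permutes {1..n - k}.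
      \<Sum>j\<le>degree (coh_relation n k). subst (perm_vars \<pi> \<rho>) (subst (restrict_vars (coh_vars n k)) (q j)) * ?c j)"
      unfolding reynolds_def by (intro sum.cong refl) simp
    also have "\<dots> = (\<Sum>j\<le>degree (coh_relation n k). reynolds (q j) * ?c j)"
      unfolding reynolds_def sum_distrib_right
      by (subst sum.swap[of _ "{..degree (coh_relation n k)}"], subst sum.swap[of _ "{..degree (coh_relation n k)}"]) simp
    finally show ?thesis .
  qed
  finally have Np: "of_nat N * p = (\<Sum>j\<le>degree (coh_relation n k). reynolds (q j) * ?c j)" .
  \<comment> \<open>Division by the group order is possible because the scalars are the complex
    numbers.\<close>
  have "of_nat m = Const (of_nat m)" for m by (induction m) (simp_all add: Const_simps)
  then have "Const (1 / of_nat N) * of_nat N = 1"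
    using N by (metis Const_simps(2,4) nonzero_eq_divide_eq of_nat_eq_0_iff)
  then have "Const (1 / of_nat N) * (of_nat N * p) = p"
    by (simp flip: mult.assoc)
  moreover have "Const (1 / of_nat N) * (of_nat N * p) \<in> coh_ideal n k"
    unfolding Np
    by (intro coh_ideal_mult coh_ideal_sum coh_ideal_gen reynolds_invariant pols_in_zy_invariants pols_in_Const)
  ultimately show ?thesis by (simp only:)
qed

text \<open>As the discriminant is a unit of \<open>L_set n\<close>, such a class dies after
  extension of scalars: this is the injectivity half of localization.\<close>

theorem vanishing_imp_torsion:
  assumes n: "n \<ge> 1" and f: "f \<in> invariants n k"
    and van: "\<And>I. I \<in> subsets_of_card n k \<Longrightarrow> subst (fp_vars n I) f = 0"
  shows "disc n ^ n * disc n ^ n * f \<in> coh_ideal n k"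
proof (rule span_invariant_imp_ideal)
  show "disc n ^ n * disc n ^ n * f \<in> coh_span n k"
    using eval_vars_eq_fp[OF _ f] van f by (intro vanishing_imp_span[OF n]) (auto simp: invariants_eq)
  have "disc n \<in> pols_in (zy_vars n)"
    unfolding disc_def by (intro pols_in_prod pols_in_diff pols_in_Var) (auto simp: zy_vars_def)
  then show "disc n ^ n * disc n ^ n * f \<in> invariants n k"
    by (intro invariants_closed f pols_in_zy_invariants pols_in_power)
qed

end

section \<open>Classes supported at a single fixed point\<close>

lemma L_units_nonzero: "d \<in> L_units n \<Longrightarrow> d \<noteq> 0"
  by (simp add: L_units_def)

lemma (in scalar_ext) ker_trans_add_right:
  "x - (u + v) \<in> ker \<Longrightarrow> v - w \<in> ker \<Longrightarrow> x - (u + w) \<in> ker"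
  using ker_add[of "x - (u + v)" "v - w"] by (simp add: algebra_simps)

lemma (in scalar_ext) ker_trans_add_left:
  "x - (u + v) \<in> ker \<Longrightarrow> u - w \<in> ker \<Longrightarrow> x - (w + v) \<in> ker"
  using ker_add[of "x - (u + v)" "u - w"] by (simp add: algebra_simps)

text \<open>The restriction of \<open>loc_pol n I\<close> to the fixed point of \<open>J\<close>;
  for \<open>J = I\<close> it is the polynomial form of \<open>R_fun n I\<close>.\<close>

definition fp_compl :: "nat \<Rightarrow> nat set \<Rightarrow> nat set \<Rightarrow> pol"
  where "fp_compl n I J = (\<Prod>a\<in>J. \<Prod>b\<in>{1..n} - I. zv a - zv b)"

text \<open>Represents a class that restricts to \<open>0\<close> at every other fixed point of the
  component of \<open>I\<close>.\<close>

definition loc_pol :: "nat \<Rightarrow> nat set \<Rightarrow> pol"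
  where "loc_pol n I = (\<Prod>i = 1..card I. \<Prod>b\<in>{1..n} - I. Var (VG1 i) - zv b)"

text \<open>The quotient of the discriminant by \<open>R_fun n I\<close>; it keeps the coefficients
  in \<open>HT_expand\<close> polynomial.\<close>

definition disc_cofactor :: "nat \<Rightarrow> nat set \<Rightarrow> pol"
  where "disc_cofactor n I = (\<Prod>a\<in>{1..n} - I. \<Prod>b\<in>{1..n} - {a}. zv a - zv b) *
     (\<Prod>a\<in>I. \<Prod>b\<in>I - {a}. zv a - zv b)"

lemma disc_cofactor:
  assumes "I \<subseteq> {1..n}"
  shows "disc n = disc_cofactor n I * fp_compl n I I"
proof -
  have fin: "finite I" using assms finite_subset by blast
  have "(\<Prod>a\<in>I. \<Prod>b\<in>{1..n} - {a}. zv a - zv b) =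
      (\<Prod>a\<in>I. (\<Prod>b\<in>I - {a}. zv a - zv b) * (\<Prod>b\<in>{1..n} - I. zv a - zv b))"
  proof (rule prod.cong[OF refl])
    fix a assume "a \<in> I"
    then have "{1..n} - {a} = (I - {a}) \<union> ({1..n} - I)" using assms by auto
    then show "(\<Prod>b\<in>{1..n} - {a}. zv a - zv b) =
        (\<Prod>b\<in>I - {a}. zv a - zv b) * (\<Prod>b\<in>{1..n} - I. zv a - zv b)"
      by (simp only:) (rule prod.union_disjoint, use fin in auto)
  qed
  then show ?thesis
    unfolding disc_def disc_cofactor_def fp_compl_def
    by (subst prod.subset_diff[OF assms]) (simp_all add: prod.distrib mult_ac)
qed

lemma to_fract_fp_compl: "to_fract (fp_compl n I I) = R_fun n I"
  by (simp add: fp_compl_def R_fun_def to_fract_prod)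

lemma R_fun_unit: "I \<subseteq> {1..n} \<Longrightarrow> R_fun n I \<in> L_units n"
  unfolding R_fun_def by (intro L_units_prod L_units_diff) auto

lemma disc_unit: "to_fract (disc n) \<in> L_units n"
proof -
  have "to_fract (disc n) = (\<Prod>a = 1..n. \<Prod>b\<in>{1..n} - {a}. zz a - zz b)"
    by (simp add: disc_def to_fract_prod)
  then show ?thesis by (simp only:) (intro L_units_prod L_units_diff, auto)
qed

lemma disc_zy: "disc n \<in> pols_in (zy_vars n)"
  unfolding disc_def by (intro pols_in_prod pols_in_diff pols_in_Var) (auto simp: zy_vars_def)

lemma disc_cofactor_zy: "I \<subseteq> {1..n} \<Longrightarrow> disc_cofactor n I \<in> pols_in (zy_vars n)"
  unfolding disc_cofactor_def
  by (intro pols_in_prod pols_in_mult pols_in_diff pols_in_Var) (auto simp: zy_vars_def)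

lemma loc_pol_invariant:
  assumes I: "I \<in> subsets_of_card n k"
  shows "loc_pol n I \<in> invariants n k"
proof -
  note ID = subsets_of_cardD[OF I]
  have "loc_pol n I \<in> pols_in (coh_vars n k)"
    unfolding loc_pol_def ID(2) by (intro pols_in_prod pols_in_diff pols_in_Var) (auto simp: coh_vars_def)
  moreover have "subst (perm_vars \<pi> \<rho>) (loc_pol n I) = loc_pol n I" if "\<pi> permutes {1..k}" for \<pi> \<rho>
  proof -
    have "subst (perm_vars \<pi> \<rho>) (loc_pol n I) = (\<Prod>i = 1..k. \<Prod>b\<in>{1..n} - I. Var (VG1 (\<pi> i)) - zv b)"
      by (simp add: loc_pol_def ID(2) subst_hom perm_vars_def)
    also have "\<dots> = loc_pol n I"
      unfolding loc_pol_def ID(2)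
      by (rule prod.reindex_bij_betw[OF permutes_imp_bij[OF that], of "\<lambda>i. \<Prod>b\<in>{1..n} - I. Var (VG1 i) - zv b"])
    finally show ?thesis .
  qed
  ultimately show ?thesis by (simp add: invariants_eq)
qed

text \<open>For \<open>J \<noteq> I\<close> of the same size some element of \<open>J\<close> lies
  outside \<open>I\<close>, and its difference with itself is one of the factors.\<close>

lemma subst_fp_loc_pol:
  assumes I: "I \<in> subsets_of_card n k" and J: "J \<in> subsets_of_card n k"
  shows "subst (fp_vars n J) (loc_pol n I) = (if I = J then fp_compl n I I else 0)"
proof -
  note ID = subsets_of_cardD[OF I] and JD = subsets_of_cardD[OF J]
  have "subst (fp_vars n J) (loc_pol n I) = (\<Prod>i = 1..k. \<Prod>b\<in>{1..n} - I. zv (nth_elt J i) - zv b)"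
    by (simp add: loc_pol_def ID(2) subst_hom fp_vars_def)
  also have "\<dots> = fp_compl n I J"
    unfolding fp_compl_def
    by (rule prod.reindex_bij_betw[OF nth_elt_bij[OF JD(3,2)], of "\<lambda>a. \<Prod>b\<in>{1..n} - I. zv a - zv b"])
  also have "\<dots> = (if I = J then fp_compl n I I else 0)"
  proof (cases "I = J")
    case False
    then have "\<not> J \<subseteq> I" using card_subset_eq[of I J] ID JD by metis
    then obtain a where a: "a \<in> J" "a \<notin> I" by blast
    then have "(\<Prod>b\<in>{1..n} - I. zv a - zv b) = 0"
      using JD(1) ID(4) by (intro prod_zero) auto
    then have "fp_compl n I J = 0"
      unfolding fp_compl_def using a JD(3) by (intro prod_zero) auto
    then show ?thesis using False by simp
  qed simp
  finally show ?thesis .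
qed

lemma fp_pol_loc_pol:
  assumes "I \<in> subsets_of_card n k" "J \<in> subsets_of_card n k"
  shows "fp_pol n J (loc_pol n I) = (if I = J then R_fun n I else 0)"
  by (simp add: fp_pol_def subst_fp_loc_pol[OF assms] to_fract_fp_compl)

text \<open>The polynomial \<open>disc n * f\<close> and the combination of the
  \<open>loc_pol n I\<close> with coefficients \<open>r I\<close> agree at all fixed points, so
  their difference \<open>g\<close> is torsion. A polynomial multiplier crosses the tensor sign, and
  \<open>D * disc n\<close> is a unit of \<open>L_set n\<close>, so it can be divided off
  there.\<close>

lemma HT_expand:
  assumes n: "n \<ge> 1" and k: "k \<le> n" and f: "f \<in> invariants n k" and c: "c \<in> L_set n"
  shows "frag_of (coh_class n k f, c) -
    (\<Sum>I\<in>subsets_of_card n k. frag_of (coh_class n k (loc_pol n I), c * fp_pol n I f / R_fun n I))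
    \<in> tensor_ker (Czy n) (HT n k) (L n)"
proof -
  interpret scalar_ext n "HT n k" by (rule HT_scalar_ext)
  let ?S = "subsets_of_card n k"
  define D where "D = disc n ^ n * disc n ^ n"
  have Dzy: "D \<in> pols_in (zy_vars n)"
    unfolding D_def by (intro pols_in_mult pols_in_power disc_zy)
  have Dunit: "to_fract (D * disc n) \<in> L_units n"
  proof -
    have pow: "to_fract (disc n) ^ m \<in> L_units n" for m
      by (induction m) (auto intro: L_units_mult L_units_1 disc_unit)
    have "to_fract (D * disc n) = to_fract (disc n) ^ n * to_fract (disc n) ^ n * to_fract (disc n)"
      by (simp add: D_def to_fract_power)
    then show ?thesis by (simp only:) (intro L_units_mult pow disc_unit)
  qed
  \<comment> \<open>Chosen so that \<open>r I\<close> times the restriction of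
    \<open>loc_pol n I\<close> to its own point is \<open>disc n\<close> times the restriction of
    \<open>f\<close>.\<close>
  define r where "r I = disc_cofactor n I * subst (fp_vars n I) f" for I
  have rzy: "r I \<in> pols_in (zy_vars n)" if "I \<in> ?S" for I
    unfolding r_def by (intro pols_in_mult disc_cofactor_zy fp_pol_in_L[OF that f]) (rule subsets_of_cardD[OF that])
  define g where "g = disc n * f - (\<Sum>I\<in>?S. r I * loc_pol n I)"
  have Drinv: "D * r I * loc_pol n I \<in> invariants n k" if "I \<in> ?S" for I
    using that by (intro invariants_closed loc_pol_invariant pols_in_zy_invariants Dzy rzy)
  have ginv: "g \<in> invariants n k"
    unfolding g_def
    by (intro invariants_closed invariants_sum f pols_in_zy_invariants disc_zy rzy loc_pol_invariant)
  have "subst (fp_vars n J) g = 0" if J: "J \<in> ?S" for J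
  proof -
    have "subst (fp_vars n J) (\<Sum>I\<in>?S. r I * loc_pol n I) =
      (\<Sum>I\<in>?S. if I = J then r J * fp_compl n J J else 0)"
      unfolding subst_sum
    proof (rule sum.cong[OF refl])
      fix I assume I: "I \<in> ?S"
      show "subst (fp_vars n J) (r I * loc_pol n I) = (if I = J then r J * fp_compl n J J else 0)"
        using subst_zy_id[OF rzy[OF I]] subst_fp_loc_pol[OF I J] by (simp add: subst_mult)
    qed
    also have "\<dots> = r J * fp_compl n J J"
      using J by (simp add: finite_subsets_of_card)
    also have "\<dots> = disc n * subst (fp_vars n J) f"
      unfolding r_def using disc_cofactor[OF subsets_of_cardD(1)[OF J]] by (simp add: mult_ac)
    finally show ?thesis
      using subst_zy_id[OF disc_zy] by (simp add: g_def subst_diff subst_mult)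
  qed
  from vanishing_imp_torsion[OF k n ginv this]
  have "D * g \<in> coh_ideal n k" by (simp add: D_def)
  moreover have "D * g = (D * disc n) * f - (\<Sum>I\<in>?S. D * r I * loc_pol n I)"
    by (simp add: g_def right_diff_distrib sum_distrib_left mult.assoc)
  ultimately have eq: "coh_class n k ((D * disc n) * f) = coh_class n k (\<Sum>I\<in>?S. D * r I * loc_pol n I)"
    by (intro coh_class_eqI) simp
  \<comment> \<open>Anticipates the multiplier: moving \<open>D * disc n\<close> from the class to
    the coefficient restores \<open>c\<close>.\<close>
  define c' where "c' = c / to_fract (D * disc n)"
  have c': "c' \<in> L_set n" unfolding c'_def by (rule L_set_divide[OF c Dunit])
  have Dn: "D * disc n \<in> pols_in (zy_vars n)" by (intro pols_in_mult Dzy disc_zy)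
  have nz: "to_fract (D * disc n) \<noteq> 0" by (rule L_units_nonzero[OF Dunit])
  have cl: "coh_class n k h \<in> carrier (HT n k)" if "h \<in> invariants n k" for h
    using that by (simp add: HT_carrier)
  have cD: "to_fract (D * disc n) * c' = c" unfolding c'_def using nz by simp
  have "frag_of (coh_class n k ((D * disc n) * f), c') - frag_of (coh_class n k f, c) \<in> ker"
    using ker_smult[OF Dn cl[OF f] c'] unfolding HT_smult[OF pols_in_zy_invariants[OF Dn] f] cD .
  then have 1: "frag_of (coh_class n k f, c) - frag_of (coh_class n k (\<Sum>I\<in>?S. D * r I * loc_pol n I), c') \<in> ker"
    unfolding eq by (rule ker_sym)
  have sumrule: "frag_of (coh_class n k (\<Sum>I\<in>A. h I), c') - (\<Sum>I\<in>A. frag_of (coh_class n k (h I), c')) \<in> ker"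
    if "finite A" "\<And>I. I \<in> A \<Longrightarrow> h I \<in> invariants n k" for A :: "nat set set" and h
    using that
  proof (induction A rule: finite_induct)
    case empty
    have "frag_of (coh_class n k 0 \<oplus>\<^bsub>HT n k\<^esub> coh_class n k 0, c') -
        (frag_of (coh_class n k 0, c') + frag_of (coh_class n k 0, c')) \<in> ker"
      by (intro ker_add_left cl invariants_closed c')
    then have "frag_of (coh_class n k 0, c') - (frag_of (coh_class n k 0, c') + frag_of (coh_class n k 0, c')) \<in> ker"
      by (simp only: HT_add[OF invariants_closed(1) invariants_closed(1)] add_0)
    from ker_uminus[OF this] show ?case by simp
  next
    case (insert I A)
    have hA: "(\<Sum>I\<in>A. h I) \<in> invariants n k" "h I \<in> invariants n k"
      using insert by (auto intro: invariants_sum)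
    have "frag_of (coh_class n k (h I) \<oplus>\<^bsub>HT n k\<^esub> coh_class n k (\<Sum>I\<in>A. h I), c') -
        (frag_of (coh_class n k (h I), c') + frag_of (coh_class n k (\<Sum>I\<in>A. h I), c')) \<in> ker"
      by (intro ker_add_left cl hA c')
    moreover have "frag_of (coh_class n k (\<Sum>I\<in>A. h I), c') - (\<Sum>I\<in>A. frag_of (coh_class n k (h I), c')) \<in> ker"
      using insert by blast
    ultimately have "frag_of (coh_class n k (h I + (\<Sum>I\<in>A. h I)), c') -
        (frag_of (coh_class n k (h I), c') + (\<Sum>I\<in>A. frag_of (coh_class n k (h I), c'))) \<in> ker"
      unfolding HT_add[OF hA(2,1)] by (rule ker_trans_add_right)
    then show ?case using insert.hyps by simp
  qed
  have 2: "frag_of (coh_class n k (\<Sum>I\<in>?S. D * r I * loc_pol n I), c') -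
      (\<Sum>I\<in>?S. frag_of (coh_class n k (D * r I * loc_pol n I), c')) \<in> ker"
    by (rule sumrule[OF finite_subsets_of_card Drinv])
  have 3: "(\<Sum>I\<in>?S. frag_of (coh_class n k (D * r I * loc_pol n I), c')) -
      (\<Sum>I\<in>?S. frag_of (coh_class n k (loc_pol n I), c * fp_pol n I f / R_fun n I)) \<in> ker"
    unfolding sum_subtractf[symmetric]
  proof (rule ker_sum)
    fix I assume I: "I \<in> ?S"
    have Dr: "D * r I \<in> pols_in (zy_vars n)" by (intro pols_in_mult Dzy rzy I)
    have Rnz: "R_fun n I \<noteq> 0" using R_fun_unit[OF subsets_of_cardD(1)[OF I]] by (simp add: L_units_def)
    have "to_fract (D * r I) * c' = c * fp_pol n I f / R_fun n I"
    proof -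
      have "to_fract (disc n) = to_fract (disc_cofactor n I) * R_fun n I"
        unfolding disc_cofactor[OF subsets_of_cardD(1)[OF I]] by (simp add: to_fract_fp_compl)
      then have "to_fract (D * r I) * R_fun n I = to_fract (D * disc n) * fp_pol n I f"
        by (simp add: r_def fp_pol_def mult_ac)
      then have "to_fract (D * r I) * c' * R_fun n I = c * fp_pol n I f"
      proof -
        assume eq: "to_fract (D * r I) * R_fun n I = to_fract (D * disc n) * fp_pol n I f"
        have "to_fract (D * r I) * c' * R_fun n I = (to_fract (D * r I) * R_fun n I) * c'"
          by (simp only: mult_ac)
        also have "\<dots> = (to_fract (D * disc n) * c') * fp_pol n I f"
          unfolding eq by (simp only: mult_ac)
        finally show ?thesis unfolding cD .
      qed
      then show ?thesis using Rnz by (simp add: field_simps)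
    qed
    then show "frag_of (coh_class n k (D * r I * loc_pol n I), c') -
        frag_of (coh_class n k (loc_pol n I), c * fp_pol n I f / R_fun n I) \<in> ker"
      using ker_smult[OF Dr cl[OF loc_pol_invariant[OF I]] c']
      unfolding HT_smult[OF pols_in_zy_invariants[OF Dr] loc_pol_invariant[OF I]] by simp
  qed
  show ?thesis by (rule ker_trans[OF 1 ker_trans[OF 2 3]])
qed

lemma HT_localized:
  assumes n: "n \<ge> 1" and k: "k \<le> n"
  shows "localized n (HT n k) (subsets_of_card n k) (fp_HT n) (\<lambda>I. coh_class n k (loc_pol n I)) (R_fun n)"
proof -
  interpret scalar_ext n "HT n k" by (rule HT_scalar_ext)
  show ?thesis
  proof
    show "finite (subsets_of_card n k)" by (rule finite_subsets_of_card)
    fix I assume I: "I \<in> subsets_of_card n k"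
    show "lin_fun (fp_HT n I)"
      unfolding lin_fun_def
      using I fp_pol_in_L[OF I]
      by (auto simp: HT_carrier HT_add HT_smult fp_HT_coh_class[OF I] fp_pol_def subst_add subst_mult
          pols_in_zy_invariants subst_zy_id intro!: L_set_pol)
    show "coh_class n k (loc_pol n I) \<in> carrier (HT n k)"
      using loc_pol_invariant[OF I] by (simp add: HT_carrier)
    show "R_fun n I \<in> L_units n"
      by (rule R_fun_unit[OF subsets_of_cardD(1)[OF I]])
    fix J assume J: "J \<in> subsets_of_card n k"
    show "fp_HT n I (coh_class n k (loc_pol n J)) = (if I = J then R_fun n I else 0)"
      by (simp add: fp_HT_coh_class[OF I] fp_pol_loc_pol[OF J I])
  next
    fix h c assume "h \<in> carrier (HT n k)" and c: "c \<in> L_set n"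
    then obtain f where f: "h = coh_class n k f" "f \<in> invariants n k" by (auto simp: HT_carrier)
    have "(\<Sum>I\<in>subsets_of_card n k. frag_of (coh_class n k (loc_pol n I), c * fp_HT n I h / R_fun n I)) =
      (\<Sum>I\<in>subsets_of_card n k. frag_of (coh_class n k (loc_pol n I), c * fp_pol n I f / R_fun n I))"
      unfolding f(1) by (intro sum.cong refl) (simp add: fp_HT_coh_class)
    then show "frag_of (h, c) - (\<Sum>I\<in>subsets_of_card n k. frag_of (coh_class n k (loc_pol n I), c * fp_HT n I h / R_fun n I)) \<in> ker"
      using HT_expand[OF n k f(2) c] f(1) by simp
  qed
qed

section \<open>The disjoint union of the components\<close>

lemma HT_zero_in: "\<zero>\<^bsub>HT n k\<^esub> \<in> carrier (HT n k)"
  by (simp add: HT_zero HT_carrier invariants_closed)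

lemma HT_zero_add: "h \<in> carrier (HT n k) \<Longrightarrow> \<zero>\<^bsub>HT n k\<^esub> \<oplus>\<^bsub>HT n k\<^esub> h = h"
  "h \<in> carrier (HT n k) \<Longrightarrow> h \<oplus>\<^bsub>HT n k\<^esub> \<zero>\<^bsub>HT n k\<^esub> = h"
  by (auto simp: HT_zero HT_carrier HT_add invariants_closed)

lemma HT_smult_zero: "r \<in> pols_in (zy_vars n) \<Longrightarrow> r \<odot>\<^bsub>HT n k\<^esub> \<zero>\<^bsub>HT n k\<^esub> = \<zero>\<^bsub>HT n k\<^esub>"
  by (simp add: HT_zero HT_smult invariants_closed pols_in_zy_invariants)

lemma HX_simps:
  "carrier (HX n) = (\<Pi>\<^sub>E k\<in>{0..n}. carrier (HT n k))"
  "g \<oplus>\<^bsub>HX n\<^esub> h = (\<lambda>k\<in>{0..n}. g k \<oplus>\<^bsub>HT n k\<^esub> h k)"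
  "r \<odot>\<^bsub>HX n\<^esub> h = (\<lambda>k\<in>{0..n}. r \<odot>\<^bsub>HT n k\<^esub> h k)"
  by (simp_all add: HX_def)

lemma HX_scalar_ext: "scalar_ext n (HX n)"
proof
  fix m m' assume m: "m \<in> carrier (HX n)" "m' \<in> carrier (HX n)"
  have "m k \<oplus>\<^bsub>HT n k\<^esub> m' k \<in> carrier (HT n k)" if "k \<in> {0..n}" for k
    using m that by (intro scalar_ext.M_add[OF HT_scalar_ext]) (auto simp: HX_simps)
  then show "m \<oplus>\<^bsub>HX n\<^esub> m' \<in> carrier (HX n)" by (simp add: HX_simps)
next
  fix r m assume m: "r \<in> pols_in (zy_vars n)" "m \<in> carrier (HX n)"
  have "r \<odot>\<^bsub>HT n k\<^esub> m k \<in> carrier (HT n k)" if "k \<in> {0..n}" for k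
    using m that by (intro scalar_ext.M_smult[OF HT_scalar_ext]) (auto simp: HX_simps)
  then show "r \<odot>\<^bsub>HX n\<^esub> m \<in> carrier (HX n)" by (simp add: HX_simps)
qed

lemma HX_incl_in: "h \<in> carrier (HT n k) \<Longrightarrow> HX_incl n k h \<in> carrier (HX n)"
  by (auto simp: HX_simps HX_incl_def HT_zero_in)

lemma HX_incl_add:
  assumes "h \<in> carrier (HT n k)" "h' \<in> carrier (HT n k)"
  shows "HX_incl n k (h \<oplus>\<^bsub>HT n k\<^esub> h') = HX_incl n k h \<oplus>\<^bsub>HX n\<^esub> HX_incl n k h'"
  unfolding HX_simps HX_incl_def
  by (rule restrict_ext) (simp add: HT_zero_add HT_zero_in)

lemma HX_incl_smult:
  assumes "r \<in> pols_in (zy_vars n)"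
  shows "HX_incl n k (r \<odot>\<^bsub>HT n k\<^esub> h) = r \<odot>\<^bsub>HX n\<^esub> HX_incl n k h"
  unfolding HX_simps HX_incl_def
  by (rule restrict_ext) (simp add: HT_smult_zero assms)

lemma HX_incl_ker:
  assumes "x \<in> tensor_ker (Czy n) (HT n k) (L n)"
  shows "frag_extend (\<lambda>(h, c). frag_of (HX_incl n k h, id c)) x \<in> tensor_ker (Czy n) (HX n) (L n)"
  by (rule scalar_ext.ker_map[OF HT_scalar_ext HX_scalar_ext _ _ _ _ _ _ assms])
    (simp_all add: HX_incl_in HX_incl_add HX_incl_smult)

lemma HXL_incl_cls:
  "HXL_incl n k (tensor_class (Czy n) (HT n k) (L n) x) =
   tensor_class (Czy n) (HX n) (L n) (frag_extend (\<lambda>(h, c). frag_of (HX_incl n k h, id c)) x)"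
  unfolding HXL_incl_def
  by (rule scalar_ext.tensor_map_cls[OF HT_scalar_ext HX_scalar_ext HX_incl_ker])

text \<open>The truncations \<open>tr m\<close>, equal to \<open>h\<close> below \<open>m\<close>
  and to zero from \<open>m\<close> on, grow by one component at a time, and each step is one
  relation of additivity in the first slot. The last truncation is \<open>h\<close>.\<close>

lemma HX_decompose:
  assumes h: "h \<in> carrier (HX n)" and c: "c \<in> L_set n"
  shows "frag_of (h, c) - (\<Sum>k = 0..n. frag_of (HX_incl n k (h k), c)) \<in> tensor_ker (Czy n) (HX n) (L n)"
proof -
  interpret scalar_ext n "HX n" by (rule HX_scalar_ext)
  define tr where "tr m = (\<lambda>j\<in>{0..n}. if j < m then h j else \<zero>\<^bsub>HT n j\<^esub>)" for m
  have hk: "h k \<in> carrier (HT n k)" if "k \<in> {0..n}" for k using h that by (auto simp: HX_simps)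
  have tr_in: "tr m \<in> carrier (HX n)" for m
    by (auto simp: HX_simps tr_def HT_zero_in hk)
  have "frag_of (tr m, c) - (\<Sum>k\<in>{..<m}. frag_of (HX_incl n k (h k), c)) \<in> ker" if "m \<le> Suc n" for m
    using that
  proof (induction m)
    case 0
    have "tr 0 \<oplus>\<^bsub>HX n\<^esub> tr 0 = tr 0"
      unfolding HX_simps tr_def by (rule restrict_ext) (simp add: HT_zero_add HT_zero_in)
    then show ?case using ker_uminus[OF ker_add_left[OF tr_in[of 0] tr_in[of 0] c]] by simp
  next
    case (Suc m)
    then have m: "m \<in> {0..n}" by simp
    have "tr m \<oplus>\<^bsub>HX n\<^esub> HX_incl n m (h m) = tr (Suc m)"
      unfolding HX_simps tr_def HX_incl_def
      by (rule restrict_ext) (auto simp: HT_zero_add HT_zero_in hk)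
    then have "frag_of (tr (Suc m), c) - (frag_of (tr m, c) + frag_of (HX_incl n m (h m), c)) \<in> ker"
      using ker_add_left[OF tr_in[of m] HX_incl_in[OF hk[OF m]] c] by simp
    moreover have "frag_of (tr m, c) - (\<Sum>k\<in>{..<m}. frag_of (HX_incl n k (h k), c)) \<in> ker"
      using Suc by simp
    ultimately have "frag_of (tr (Suc m), c) -
        ((\<Sum>k\<in>{..<m}. frag_of (HX_incl n k (h k), c)) + frag_of (HX_incl n m (h m), c)) \<in> ker"
      by (rule ker_trans_add_left)
    then show ?case by simp
  qed
  from this[of "Suc n"] have "frag_of (tr (Suc n), c) - (\<Sum>k\<in>{..<Suc n}. frag_of (HX_incl n k (h k), c)) \<in> ker"
    by simp
  moreover have "tr (Suc n) = h"
    using h by (auto simp: tr_def HX_simps PiE_def extensional_def fun_eq_iff)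
  moreover have "{..<Suc n} = {0..n}" by auto
  ultimately show ?thesis by simp
qed

definition HX_basis :: "nat \<Rightarrow> nat set \<Rightarrow> nat \<Rightarrow> pol set"
  where "HX_basis n I = HX_incl n (card I) (coh_class n (card I) (loc_pol n I))"

lemma subsets_of_card_self: "I \<subseteq> {1..n} \<Longrightarrow> I \<in> subsets_of_card n (card I)"
  by (simp add: subsets_of_card_def)

lemma card_le_n: "I \<subseteq> {1..n} \<Longrightarrow> card I \<le> n"
  using card_mono[of "{1..n}" I] by simp

lemma sum_Pow_by_card:
  "(\<Sum>I\<in>Pow {1..n}. f I) = (\<Sum>k = 0..n. \<Sum>I\<in>subsets_of_card n k. f I)"
proof -
  have "Pow {1..n} = (\<Union>k\<in>{0..n}. subsets_of_card n k)"
    using card_le_n by (auto simp: subsets_of_card_def)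
  then show ?thesis
    by (simp only:) (rule sum.UNION_disjoint, auto simp: finite_subsets_of_card subsets_of_card_def)
qed

text \<open>The dual systems of the components are put side by side: a class is first decomposed
  into its components, then each is expanded, and components of different index pair to
  zero.\<close>

lemma HX_localized:
  assumes n: "n \<ge> 1"
  shows "localized n (HX n) (Pow {1..n}) (\<lambda>I h. fp_HT n I (h (card I))) (HX_basis n) (R_fun n)"
proof -
  interpret scalar_ext n "HX n" by (rule HX_scalar_ext)
  show ?thesis
  proof
    show "finite (Pow {1..n})" by simp
    fix I assume "I \<in> Pow {1..n}"
    then have I: "I \<subseteq> {1..n}" by simp
    then have k: "card I \<in> {0..n}" using card_le_n by simp
    note IS = subsets_of_card_self[OF I]
    interpret H: localized n "HT n (card I)" "subsets_of_card n (card I)" "fp_HT n"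
      "\<lambda>J. coh_class n (card I) (loc_pol n J)" "R_fun n"
      by (rule HT_localized[OF n card_le_n[OF I]])
    show "lin_fun (\<lambda>h. fp_HT n I (h (card I)))"
      using H.lin[OF IS] k unfolding lin_fun_def H.lin_fun_def by (auto simp: HX_simps PiE_def Pi_def)
    show "HX_basis n I \<in> carrier (HX n)"
      unfolding HX_basis_def by (rule HX_incl_in[OF H.b_in[OF IS]])
    show "R_fun n I \<in> L_units n" by (rule R_fun_unit[OF I])
    fix J assume "J \<in> Pow {1..n}"
    then have J: "J \<subseteq> {1..n}" by simp
    show "fp_HT n I (HX_basis n J (card I)) = (if I = J then R_fun n I else 0)"
    proof (cases "card I = card J")
      case True
      then have "J \<in> subsets_of_card n (card I)" using subsets_of_card_self[OF J] by simp
      then show ?thesis using H.dual[OF IS] True k by (simp add: HX_basis_def HX_incl_def)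
    next
      case False
      then have "fp_HT n I (HX_basis n J (card I)) = fp_pol n I 0"
        using k by (simp add: HX_basis_def HX_incl_def HT_zero fp_HT_coh_class[OF IS])
      then show ?thesis using False by (auto simp: fp_pol_def)
    qed
  next
    fix h c assume h: "h \<in> carrier (HX n)" and c: "c \<in> L_set n"
    have "(\<Sum>k = 0..n. frag_of (HX_incl n k (h k), c)) -
      (\<Sum>k = 0..n. \<Sum>I\<in>subsets_of_card n k. frag_of (HX_basis n I, c * fp_HT n I (h (card I)) / R_fun n I)) \<in> ker"
      unfolding sum_subtractf[symmetric]
    proof (rule ker_sum)
      fix k assume "k \<in> {0..n}"
      then have k: "k \<le> n" and hk: "h k \<in> carrier (HT n k)" using h by (auto simp: HX_simps)
      from HX_incl_ker[OF localized.expand[OF HT_localized[OF n k] hk c]]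
      have "frag_of (HX_incl n k (h k), c) - (\<Sum>I\<in>subsets_of_card n k.
          frag_of (HX_incl n k (coh_class n k (loc_pol n I)), c * fp_HT n I (h k) / R_fun n I)) \<in> ker"
        by (simp add: frag_extend_diff frag_extend_sum finite_subsets_of_card comp_def)
      also have "(\<Sum>I\<in>subsets_of_card n k.
          frag_of (HX_incl n k (coh_class n k (loc_pol n I)), c * fp_HT n I (h k) / R_fun n I)) =
        (\<Sum>I\<in>subsets_of_card n k. frag_of (HX_basis n I, c * fp_HT n I (h (card I)) / R_fun n I))"
        by (intro sum.cong refl) (simp add: HX_basis_def subsets_of_cardD(2))
      finally show "frag_of (HX_incl n k (h k), c) -
        (\<Sum>I\<in>subsets_of_card n k. frag_of (HX_basis n I, c * fp_HT n I (h (card I)) / R_fun n I)) \<in> ker" .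
    qed
    from ker_trans[OF HX_decompose[OF h c] this]
    show "frag_of (h, c) - (\<Sum>I\<in>Pow {1..n}. frag_of (HX_basis n I, c * fp_HT n I (h (card I)) / R_fun n I)) \<in> ker"
      by (simp only: sum_Pow_by_card)
  qed
qed

lemma restr_HXL_incl:
  assumes n: "n \<ge> 1" and k: "k \<le> n" and I: "I \<subseteq> {1..n}" and X: "X \<in> carrier (HTL n k)"
  shows "restr n I (HXL_incl n k X) = (if card I = k then rval (fp_HT n I) X else 0)"
proof -
  interpret H: localized n "HT n k" "subsets_of_card n k" "fp_HT n"
    "\<lambda>J. coh_class n k (loc_pol n J)" "R_fun n"
    by (rule HT_localized[OF n k])
  interpret X: localized n "HX n" "Pow {1..n}" "\<lambda>I h. fp_HT n I (h (card I))" "HX_basis n" "R_fun n"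
    by (rule HX_localized[OF n])
  obtain x where x: "X = H.cls x" "x \<in> H.chains"
    using H.T_elem X by (auto simp: HTL_def)
  let ?\<rho> = "\<lambda>h. fp_HT n I (h (card I))"
  have Iin: "I \<in> Pow {1..n}" using I by simp
  have ci: "card I \<in> {0..n}" using card_le_n[OF I] by simp
  have "restr n I (HXL_incl n k X) = val ?\<rho> (frag_extend (\<lambda>(h, c). frag_of (HX_incl n k h, id c)) x)"
    unfolding restr_eq_rval x(1) HXL_incl_cls by (rule X.rval_cls[OF X.lin[OF Iin]])
  also have "\<dots> = (if card I = k then rval (fp_HT n I) X else 0)"
  proof (cases "card I = k")
    case True
    then have IS: "I \<in> subsets_of_card n k" using I by (simp add: subsets_of_card_def)
    have "val ?\<rho> (frag_extend (\<lambda>(h, c). frag_of (HX_incl n k h, id c)) x) = 1 * val (fp_HT n I) x"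
      by (rule val_frag_extend[where S = UNIV]) (use True k in \<open>simp_all add: HX_incl_def\<close>)
    then show ?thesis using True x(1) H.rval_cls[OF H.lin[OF IS]] by simp
  next
    case False
    have "fp_HT n I \<zero>\<^bsub>HT n (card I)\<^esub> = 0"
      by (simp add: HT_zero fp_HT_coh_class[OF subsets_of_card_self[OF I]] fp_pol_def)
    then have "val ?\<rho> (frag_extend (\<lambda>(h, c). frag_of (HX_incl n k h, id c)) x) = 0 * val (fp_HT n I) x"
      by (intro val_frag_extend[where S = UNIV]) (use False ci in \<open>simp_all add: HX_incl_def\<close>)
    then show ?thesis using False by simp
  qed
  finally show ?thesis .
qed

lemma HXL_incl_in:
  assumes X: "X \<in> carrier (HTL n k)"
  shows "HXL_incl n k X \<in> carrier (HXL n)"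
proof -
  from scalar_ext.T_elem[OF HT_scalar_ext X[unfolded HTL_def]]
  obtain x where x: "x \<in> scalar_ext.chains n (HT n k)" "X = tensor_class (Czy n) (HT n k) (L n) x"
    by (rule bexE)
  show ?thesis
    unfolding x(2) HXL_incl_cls HXL_def
    by (rule scalar_ext.cls_in[OF HX_scalar_ext])
      (rule scalar_ext.chains_frag_extend[OF HT_scalar_ext x(1) HX_incl_in _ HX_scalar_ext], simp_all)
qed

text \<open>An enumeration of the index set turns both families into square matrices, for which a
  right inverse is a left inverse.\<close>

lemma sum_inverse_commute:
  fixes M N :: "'i \<Rightarrow> 'i \<Rightarrow> 'a::field"
  assumes A: "finite A"
    and MN: "\<And>i j. i \<in> A \<Longrightarrow> j \<in> A \<Longrightarrow> (\<Sum>l\<in>A. M i l * N l j) = (if i = j then 1 else 0)"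
    and ij: "i \<in> A" "j \<in> A"
  shows "(\<Sum>l\<in>A. N i l * M l j) = (if i = j then 1 else 0)"
proof -
  obtain e where e: "bij_betw e {0..<card A} A"
    using ex_bij_betw_nat_finite[OF A] by blast
  define m where "m = card A"
  note e = e[folded m_def]
  have inj: "e a = e b \<longleftrightarrow> a = b" if "a < m" "b < m" for a b
    using inj_onD[OF bij_betw_imp_inj_on[OF e], of a b] that by auto
  have eA: "e a \<in> A" if "a < m" for a using bij_betwE[OF e] that by auto
  define P where "P = mat m m (\<lambda>(a, b). M (e a) (e b))"
  define Q where "Q = mat m m (\<lambda>(a, b). N (e a) (e b))"
  have carr: "P \<in> carrier_mat m m" "Q \<in> carrier_mat m m" by (auto simp: P_def Q_def)
  have sum: "(\<Sum>l\<in>A. f l) = (\<Sum>c\<in>{0..<m}. f (e c))" for f :: "'i \<Rightarrow> 'a"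
    using sum.reindex_bij_betw[OF e, of f] by simp
  have "P * Q = 1\<^sub>m m"
  proof (rule eq_matI)
    fix a b assume "a < dim_row (1\<^sub>m m :: 'a mat)" "b < dim_col (1\<^sub>m m :: 'a mat)"
    then have ab: "a < m" "b < m" by auto
    have "(P * Q) $$ (a, b) = (\<Sum>c\<in>{0..<m}. M (e a) (e c) * N (e c) (e b))"
      using ab by (simp add: P_def Q_def scalar_prod_def)
    also have "\<dots> = (if e a = e b then 1 else 0)"
      using MN[OF eA[OF ab(1)] eA[OF ab(2)]] by (simp add: sum)
    finally show "(P * Q) $$ (a, b) = 1\<^sub>m m $$ (a, b)"
      using ab by (simp add: inj)
  qed (auto simp: P_def Q_def)
  then have QP: "Q * P = 1\<^sub>m m"
    by (rule mat_mult_left_right_inverse[OF carr])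
  obtain a b where ab: "a < m" "b < m" "i = e a" "j = e b"
    using ij bij_betw_imp_surj_on[OF e] by (metis atLeastLessThan_iff imageE)
  have "(\<Sum>l\<in>A. N i l * M l j) = (Q * P) $$ (a, b)"
    using ab by (simp add: P_def Q_def scalar_prod_def sum)
  also have "\<dots> = (if i = j then 1 else 0)"
    unfolding QP using ab by (simp add: inj)
  finally show ?thesis .
qed

section \<open>The restrictions of the stable envelope\<close>

definition pt_prod :: "nat set \<Rightarrow> rat_fun"
  where "pt_prod J = (\<Prod>a\<in>J. \<Prod>b\<in>J. zz a - zz b + yy)"

lemma z_at_image:
  assumes "J \<in> subsets_of_card n k"
  shows "z_at J ` {1..k} = zz ` J" "inj_on (z_at J) {1..k}"
proof -
  note e = nth_elt_bij[OF subsets_of_cardD(3,2)[OF assms]]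
  have za: "z_at J = zz \<circ> nth_elt J" by (rule ext) (simp add: z_at_def)
  show "z_at J ` {1..k} = zz ` J"
    unfolding za image_comp[symmetric] bij_betw_imp_surj_on[OF e] ..
  show "inj_on (z_at J) {1..k}"
    unfolding za by (rule comp_inj_on[OF bij_betw_imp_inj_on[OF e] zz_inj])
qed

lemma prod_zz_image: "(\<Prod>u\<in>zz ` J. f u) = (\<Prod>a\<in>J. f (zz a))"
  by (rule prod.reindex[OF zz_inj, unfolded comp_def])

lemma e_fun_z_at:
  assumes "J \<in> subsets_of_card n k"
  shows "e_fun k (z_at J) yy = pt_prod J"
proof -
  note e = nth_elt_bij[OF subsets_of_cardD(3,2)[OF assms]]
  have inner: "(\<Prod>b = 1..k. x - zz (nth_elt J b) + yy) = (\<Prod>b\<in>J. x - zz b + yy)" for x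
    by (rule prod.reindex_bij_betw[OF e])
  show ?thesis
    unfolding e_fun_def z_at_def pt_prod_def inner
    by (rule prod.reindex_bij_betw[OF e, of "\<lambda>a. \<Prod>b\<in>J. zz a - zz b + yy"])
qed

lemma W_plus_eq:
  assumes I: "I \<in> subsets_of_card n k" and J: "J \<in> subsets_of_card n k"
  shows "W_plus n I lam (z_at J) zz yy =
    yy ^ k * weight_sum n lam zz yy I (zz ` J) / (C_fun n 0 I lam yy * C_fun n 1 I lam yy * pt_prod J)"
  using W_fun_eq_weight_sum[OF subsets_of_cardD(3)[OF I], of "z_at J"] z_at_image[OF J]
  by (simp add: W_plus_def e_fun_z_at[OF J] subsets_of_cardD(2)[OF I])

text \<open>The reflection is an involution on \<open>{1..n}\<close>, so the preimage in
  \<open>W_perm\<close> is the image used in \<open>weight_sum_opp\<close>.\<close>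

lemma refl_idx_preimage: "J \<subseteq> {1..n} \<Longrightarrow> {i \<in> {1..n}. n + 1 - i \<in> J} = refl_idx n ` J"
  using refl_idx_mem[of J n] refl_idx_in[of _ n] by (auto simp: refl_idx_def)

lemma W_minus_eq:
  assumes I: "I \<in> subsets_of_card n k" and J: "J \<in> subsets_of_card n k"
  shows "W_minus n J lam (z_at I) zz yy =
    (- 1) ^ k * yy ^ k / pt_prod I * weight_sum_opp n lam zz yy J (zz ` I)"
proof -
  note JD = subsets_of_cardD[OF J]
  have c: "card (refl_idx n ` J) = k" using card_refl_idx[OF JD(1)] JD(2) by simp
  have s: "(\<lambda>i. n + 1 - i) = refl_idx n" by (rule ext) (simp add: refl_idx_def)
  have "W_perm n (\<lambda>i. n + 1 - i) J lm (z_at I) zz yy =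
      yy ^ k * weight_sum n lm (zz \<circ> refl_idx n) yy (refl_idx n ` J) (zz ` I)" for lm
    unfolding W_perm_def refl_idx_preimage[OF JD(1)] unfolding s
    using W_fun_eq_weight_sum[of "refl_idx n ` J" "z_at I"] z_at_image[OF I] JD(3) c by simp
  then show ?thesis
    by (simp add: W_minus_def Let_def e_fun_z_at[OF I] JD(2) weight_sum_opp_def)
qed

lemma pt_prod_unit: "J \<subseteq> {1..n} \<Longrightarrow> pt_prod J \<in> L_units n"
  unfolding pt_prod_def by (intro L_units_prod L_units_diff_yy) auto

lemma C_fun_unit: "C_fun n r I lam yy \<in> L_units n"
  unfolding C_fun_def by (intro L_units_prod L_units_lam)

lemma Q_fun_unit: "I \<subseteq> {1..n} \<Longrightarrow> Q_fun n I \<in> L_units n"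
  unfolding Q_fun_def by (intro L_units_prod L_units_diff_yy) auto

text \<open>The prefactors of \<open>W_plus\<close> and \<open>W_minus\<close> together with
  \<open>1 / (R * Q)\<close> are the weight \<open>\<omega>\<close> divided by \<open>C\<close>, so
  the sum is the pairing of \<open>weight_sum_biorthogonal\<close> divided by its diagonal
  value.\<close>

lemma biorthogonality:
  assumes J: "J \<in> subsets_of_card n k" and K: "K \<in> subsets_of_card n k"
  shows "(\<Sum>I\<in>subsets_of_card n k. W_minus n J lam (z_at I) zz yy / (R_fun n I * Q_fun n I) *
    W_plus n K lam (z_at I) zz yy) = (if J = K then 1 else 0)"
proof -
  define Z where "Z = zz ` {1..n}"
  have z: "bij_betw zz {1..n} Z" unfolding Z_def by (rule inj_on_imp_bij_betw[OF zz_inj])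
  define C where "C = C_fun n 0 K lam yy * C_fun n 1 K lam yy"
  have C: "C \<noteq> 0" unfolding C_def using L_units_nonzero[OF C_fun_unit] by simp
  define \<omega> where "\<omega> = (\<lambda>U. (- 1) ^ k * yy ^ k * yy ^ k / ((\<Prod>u\<in>U. \<Prod>v\<in>U. u - v + yy) * (\<Prod>u\<in>U. \<Prod>v\<in>U. u - v + yy) *
     ((\<Prod>u\<in>U. \<Prod>v\<in>Z - U. u - v) * (\<Prod>u\<in>U. \<Prod>v\<in>Z - U. u - v + yy))))"
  have bio: "pairing n k Z \<omega> lam zz zz yy J K = (if J = K then C else 0)"
    unfolding C_def \<omega>_def
  proof (rule weight_sum_biorthogonal[OF two_rat_fun_nonzero _ lam_minus_nonzero yy_nonzero z])
    fix u v assume "u \<in> Z" "v \<in> Z"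
    then show "u - v + yy \<noteq> 0" unfolding Z_def using zz_diff_plus_yy_nonzero by auto
  qed (use subsets_of_cardD[OF J] subsets_of_cardD[OF K] in auto)
  have \<omega>: "\<omega> (zz ` I) = (- 1) ^ k * yy ^ k * yy ^ k / (pt_prod I * pt_prod I * (R_fun n I * Q_fun n I))"
    if "I \<in> subsets_of_card n k" for I
    unfolding \<omega>_def compl_prod_image[OF z subsets_of_cardD(1)[OF that]]
    by (simp add: prod_zz_image pt_prod_def R_fun_def Q_fun_def)
  have "pairing n k Z \<omega> lam zz zz yy J K = (\<Sum>I\<in>subsets_of_card n k.
      weight_sum n lam zz yy K (zz ` I) * weight_sum_opp n lam zz yy J (zz ` I) * \<omega> (zz ` I))"
    unfolding pairing_def
  proof (rule sum.reindex_bij_betw[symmetric])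
    show "bij_betw ((`) zz) (subsets_of_card n k) {U. U \<subseteq> Z \<and> card U = k}"
    proof (rule bij_betw_imageI)
      show "inj_on ((`) zz) (subsets_of_card n k)"
        by (intro inj_onI) (metis inj_image_eq_iff zz_inj)
      have "card (zz ` I) = card I" for I by (rule card_image[OF zz_inj])
      then show "(`) zz ` subsets_of_card n k = {U. U \<subseteq> Z \<and> card U = k}"
        unfolding Z_def subsets_of_card_def
        by (auto simp: image_iff subset_image_iff)
    qed
  qed
  also have "\<dots> = (\<Sum>I\<in>subsets_of_card n k. C * (W_minus n J lam (z_at I) zz yy / (R_fun n I * Q_fun n I) *
    W_plus n K lam (z_at I) zz yy))"
  proof (rule sum.cong[OF refl])
    fix I assume I: "I \<in> subsets_of_card n k"
    show "weight_sum n lam zz yy K (zz ` I) * weight_sum_opp n lam zz yy J (zz ` I) * \<omega> (zz ` I) =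
        C * (W_minus n J lam (z_at I) zz yy / (R_fun n I * Q_fun n I) * W_plus n K lam (z_at I) zz yy)"
      unfolding \<omega>[OF I] W_plus_eq[OF K I] W_minus_eq[OF I J] C_def[symmetric]
      using C by (simp add: mult_ac)
  qed
  finally have "C * (\<Sum>I\<in>subsets_of_card n k. W_minus n J lam (z_at I) zz yy / (R_fun n I * Q_fun n I) *
    W_plus n K lam (z_at I) zz yy) = (if J = K then C else 0)"
    using bio by (simp add: sum_distrib_left)
  then show ?thesis using C by (auto split: if_splits)
qed

text \<open>The same square matrices in the other order: the relation that sums over fixed points
  yields the one that sums over the labels of the weight functions.\<close>

lemma biorthogonality':
  assumes "I \<in> subsets_of_card n k" and "J \<in> subsets_of_card n k"
  shows "(\<Sum>K\<in>subsets_of_card n k. W_plus n K lam (z_at I) zz yy *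
    (W_minus n K lam (z_at J) zz yy / (R_fun n J * Q_fun n J))) = (if I = J then 1 else 0)"
  by (rule sum_inverse_commute[OF finite_subsets_of_card biorthogonality assms])

text \<open>At a fixed point the only denominators are differences of distinct \<open>z\<close>,
  which are units.\<close>

lemma W_fun_in_L:
  assumes K: "card K = k" and J: "J \<in> subsets_of_card n k" and lm: "lm \<in> L_set n"
    and z: "\<And>a. a \<in> {1..n} \<Longrightarrow> z a \<in> L_set n"
  shows "W_fun n K lm (z_at J) z yy \<in> L_set n"
proof -
  note JD = subsets_of_cardD[OF J]
  note e = nth_elt_bij[OF JD(3,2)]
  have el: "nth_elt J r \<in> {1..n}" if "r \<in> {1..k}" for r
    using bij_betwE[OF e] that JD(1) by blast
  have t: "z_at J r \<in> L_set n" if "r \<in> {1..k}" for r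
    unfolding z_at_def by (rule L_set_vars(3)[OF el[OF that]])
  have l: "l_fun n K lm (z_at J \<circ> \<pi>) z yy r a \<in> L_set n"
    if "\<pi> permutes {1..k}" "r \<in> {1..k}" "a \<in> {1..n}" for \<pi> r a
  proof -
    have "z_at J (\<pi> r) \<in> L_set n" using t permutes_in_image[OF that(1)] that(2) by blast
    then show ?thesis
      using z[OF that(3)] lm L_set_vars(2)[of n]
      by (auto simp: l_fun_def Let_def intro!: L_set_add L_set_diff L_set_mult L_set_of_int)
  qed
  have q: "(z_at J (\<pi> a) - z_at J (\<pi> b) + yy) / (z_at J (\<pi> a) - z_at J (\<pi> b)) \<in> L_set n"
    if \<pi>: "\<pi> permutes {1..k}" and ab: "a \<in> {1..k}" "b \<in> {1..k}" "a < b" for \<pi> a b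
  proof (rule L_set_divide)
    have m: "\<pi> a \<in> {1..k}" "\<pi> b \<in> {1..k}" using permutes_in_image[OF \<pi>] ab by auto
    then show "z_at J (\<pi> a) - z_at J (\<pi> b) + yy \<in> L_set n"
      by (intro L_set_add L_set_diff t L_set_vars)
    have "\<pi> a \<noteq> \<pi> b" using inj_onD[OF permutes_inj_on[OF \<pi>], of a b UNIV] ab(3) by auto
    then have "nth_elt J (\<pi> a) \<noteq> nth_elt J (\<pi> b)"
      using inj_onD[OF bij_betw_imp_inj_on[OF e]] m by blast
    then show "z_at J (\<pi> a) - z_at J (\<pi> b) \<in> L_units n"
      unfolding z_at_def by (intro L_units_diff el m)
  qed
  show ?thesis
    unfolding W_fun_def Let_def K
    by (intro L_set_mult L_set_power L_set_vars L_set_sum L_set_prod_closed)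
      (auto intro: l q)
qed

lemma W_plus_in_L:
  assumes I: "I \<in> subsets_of_card n k" and J: "J \<in> subsets_of_card n k"
  shows "W_plus n I lam (z_at J) zz yy \<in> L_set n"
  unfolding W_plus_def subsets_of_cardD(2)[OF I] e_fun_z_at[OF J]
  by (intro L_set_divide W_fun_in_L[OF subsets_of_cardD(2)[OF I] J] L_set_vars L_units_mult C_fun_unit
      pt_prod_unit subsets_of_cardD(1)[OF J])

lemma W_minus_in_L:
  assumes I: "I \<in> subsets_of_card n k" and J: "J \<in> subsets_of_card n k"
  shows "W_minus n J lam (z_at I) zz yy \<in> L_set n"
proof -
  note JD = subsets_of_cardD[OF J]
  have c: "card {i \<in> {1..n}. n + 1 - i \<in> J} = k"
    using card_refl_idx[OF JD(1)] JD(2) by (simp only: refl_idx_preimage[OF JD(1)])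
  have "W_perm n (\<lambda>i. n + 1 - i) J (- lam - of_int (int n - 2 * int k) * yy) (z_at I) zz yy \<in> L_set n"
    unfolding W_perm_def
  proof (rule W_fun_in_L[OF c I])
    show "- lam - of_int (int n - 2 * int k) * yy \<in> L_set n"
      by (rule L_set_diff[OF L_set_uminus[OF L_set_vars(1)] L_set_mult[OF L_set_of_int L_set_vars(2)]])
    fix a assume "a \<in> {1..n}"
    then have "n + 1 - a \<in> {1..n}" by auto
    then show "(zz \<circ> (\<lambda>i. n + 1 - i)) a \<in> L_set n"
      unfolding comp_def by (rule L_set_vars(3))
  qed
  moreover have "(- 1) ^ k / pt_prod I \<in> L_set n"
    by (rule L_set_divide[OF L_set_power[OF L_set_uminus[OF L_set_1]] pt_prod_unit[OF subsets_of_cardD(1)[OF I]]])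
  ultimately show ?thesis
    unfolding W_minus_def Let_def JD(2) e_fun_z_at[OF I] by (rule L_set_mult[rotated])
qed

section \<open>The standard basis\<close>

lemma word_of_in: "word_of n I \<in> words n"
  by (auto simp: word_of_def words_def)

lemma word_of_inj:
  assumes "I \<subseteq> {1..n}" "J \<subseteq> {1..n}"
  shows "word_of n I = word_of n J \<longleftrightarrow> I = J"
proof
  assume eq: "word_of n I = word_of n J"
  show "I = J"
  proof (rule Set.set_eqI)
    fix j
    show "j \<in> I \<longleftrightarrow> j \<in> J"
    proof (cases "j \<in> {1..n}")
      case True
      have "word_of n I j = word_of n J j" by (simp only: eq)
      then show ?thesis
        using True by (cases "j \<in> I"; cases "j \<in> J") (simp_all add: word_of_def)
    next
      case False
      then have "j \<notin> I" "j \<notin> J" using assms by blast+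
      then show ?thesis by simp
    qed
  qed
qed simp

lemma words_eq: "words n = word_of n ` Pow {1..n}"
proof (intro equalityI subsetI)
  fix w assume w: "w \<in> words n"
  have "w = word_of n {j \<in> {1..n}. w j = 1}"
  proof
    fix j
    show "w j = word_of n {j \<in> {1..n}. w j = 1} j"
      using w by (cases "j \<in> {1..n}") (auto simp: words_def word_of_def PiE_def Pi_def extensional_def)
  qed
  then show "w \<in> word_of n ` Pow {1..n}" by blast
qed (auto intro: word_of_in)

lemma v_basis_eq:
  assumes w: "w \<in> words n"
  shows "v_basis n I w = (if w = word_of n I then 1 else 0)"
proof -
  have "v_basis n I w = (\<Prod>j = 1..n. if w j = word_of n I j then 1 else 0)"
    using w by (simp add: v_basis_def pure_tensor_def basis_C2_def)
  also have "\<dots> = (if w = word_of n I then 1 else 0)"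
  proof (cases "w = word_of n I")
    case False
    then obtain j where j: "w j \<noteq> word_of n I j" by blast
    have "j \<in> {1..n}"
    proof (rule ccontr)
      assume "j \<notin> {1..n}"
      then show False
        using j PiE_arb[OF w[unfolded words_def]] PiE_arb[OF word_of_in[of n I, unfolded words_def]] by simp
    qed
    then have "(\<Prod>j = 1..n. if w j = word_of n I j then 1 else 0 :: rat_fun) = 0"
      using j by (intro prod_zero) auto
    then show ?thesis using False by simp
  qed simp
  finally show ?thesis .
qed

lemma v_basis_in: "v_basis n I \<in> carrier (VL n)"
proof -
  have "v_basis n I \<in> extensional (words n)" by (simp add: v_basis_def pure_tensor_def)
  then show ?thesis by (simp add: VL_def PiE_def Pi_def v_basis_eq)
qed

lemma xi_word_of:
  assumes I: "I \<subseteq> {1..n}" and K: "K \<subseteq> {1..n}"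
  shows "xi n I (word_of n K) =
    (if card K = card I then W_minus n K lam (z_at I) zz yy / Q_fun n I else 0)"
proof -
  let ?S = "subsets_of_card n (card I)"
  have "(\<Sum>J\<in>?S. W_minus n J lam (z_at I) zz yy * v_basis n J (word_of n K)) =
    (\<Sum>J\<in>?S. if J = K then W_minus n K lam (z_at I) zz yy else 0)"
  proof (rule sum.cong[OF refl])
    fix J assume "J \<in> ?S"
    then have "J \<subseteq> {1..n}" by (rule subsets_of_cardD)
    then show "W_minus n J lam (z_at I) zz yy * v_basis n J (word_of n K) =
        (if J = K then W_minus n K lam (z_at I) zz yy else 0)"
      using v_basis_eq[OF word_of_in, of n J K] word_of_inj[OF K] by auto
  qed
  also have "\<dots> = (if card K = card I then W_minus n K lam (z_at I) zz yy else 0)"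
    using K by (simp add: finite_subsets_of_card) (simp add: subsets_of_card_def)
  finally show ?thesis
    by (simp add: xi_def word_of_in)
qed

lemma xi_in_L:
  assumes I: "I \<subseteq> {1..n}" and w: "w \<in> words n"
  shows "xi n I w \<in> L_set n"
proof -
  obtain K where K: "K \<subseteq> {1..n}" "w = word_of n K" using w by (auto simp: words_eq)
  show ?thesis
  proof (cases "card K = card I")
    case True
    then have "K \<in> subsets_of_card n (card I)" using subsets_of_card_self[OF K(1)] by simp
    then show ?thesis
      unfolding K(2) xi_word_of[OF I K(1)] using True
      by (simp add: L_set_divide[OF W_minus_in_L[OF subsets_of_card_self[OF I]] Q_fun_unit[OF I]])
  qed (simp add: K(2) xi_word_of[OF I K(1)])
qed


section \<open>The two maps\<close>

context
  fixes n :: nat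
  assumes n: "n \<ge> 1"
begin

interpretation X: localized n "HX n" "Pow {1..n}" "\<lambda>I h. fp_HT n I (h (card I))" "HX_basis n" "R_fun n"
  rewrites "tensor_ext (Czy n) (HX n) (L n) = HXL n"
  by (rule HX_localized[OF n]) (simp only: HXL_def)

lemma restr_add: "I \<subseteq> {1..n} \<Longrightarrow> X \<in> carrier (HXL n) \<Longrightarrow> Y \<in> carrier (HXL n) \<Longrightarrow>
    restr n I (X \<oplus>\<^bsub>HXL n\<^esub> Y) = restr n I X + restr n I Y"
  unfolding restr_eq_rval by (rule X.rval_add[OF X.lin]) auto

lemma restr_smult: "I \<subseteq> {1..n} \<Longrightarrow> c \<in> L_set n \<Longrightarrow> X \<in> carrier (HXL n) \<Longrightarrow>
    restr n I (c \<odot>\<^bsub>HXL n\<^esub> X) = c * restr n I X"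
  unfolding restr_eq_rval by (rule X.rval_smult[OF X.lin]) auto

lemma restr_in_L: "I \<subseteq> {1..n} \<Longrightarrow> X \<in> carrier (HXL n) \<Longrightarrow> restr n I X \<in> L_set n"
  unfolding restr_eq_rval by (rule X.rval_in_L[OF X.lin]) auto

lemma HXL_eqI:
  assumes "X \<in> carrier (HXL n)" "Y \<in> carrier (HXL n)"
    and "\<And>I. I \<subseteq> {1..n} \<Longrightarrow> restr n I X = restr n I Y"
  shows "X = Y"
  using assms(3) unfolding restr_eq_rval by (intro X.T_eqI[OF assms(1,2)]) auto

text \<open>\<open>T_exists\<close> and \<open>T_eqI\<close> for the component give a unique class
  with the prescribed restrictions, which makes the definite description in \<open>kappa\<close>
  meaningful.\<close>

lemma kappa_props:
  assumes I: "I \<subseteq> {1..n}"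
  shows "kappa n I \<in> carrier (HTL n (card I))"
    and "J \<in> subsets_of_card n (card I) \<Longrightarrow>
      restr n J (HXL_incl n (card I) (kappa n I)) = W_plus n I lam (z_at J) zz yy"
proof -
  define k where "k = card I"
  have k: "k \<le> n" using card_le_n[OF I] by (simp add: k_def)
  have IS: "I \<in> subsets_of_card n k" using subsets_of_card_self[OF I] by (simp add: k_def)
  interpret H: localized n "HT n k" "subsets_of_card n k" "fp_HT n"
    "\<lambda>J. coh_class n k (loc_pol n J)" "R_fun n"
    rewrites "tensor_ext (Czy n) (HT n k) (L n) = HTL n k"
    by (rule HT_localized[OF n k]) (simp only: HTL_def)
  have r: "restr n J (HXL_incl n k X) = rval (fp_HT n J) X"
    if "X \<in> carrier (HTL n k)" "J \<in> subsets_of_card n k" for X J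
    using restr_HXL_incl[OF n k subsets_of_cardD(1)[OF that(2)] that(1)] subsets_of_cardD(2)[OF that(2)] by simp
  let ?P = "\<lambda>X. X \<in> carrier (HTL n k) \<and>
    (\<forall>J \<in> subsets_of_card n k. restr n J (HXL_incl n k X) = W_plus n I lam (z_at J) zz yy)"
  obtain X where X: "X \<in> carrier (HTL n k)"
    "\<And>J. J \<in> subsets_of_card n k \<Longrightarrow> rval (fp_HT n J) X = W_plus n I lam (z_at J) zz yy"
    using H.T_exists[of "\<lambda>J. W_plus n I lam (z_at J) zz yy"] W_plus_in_L[OF IS] by blast
  have "?P (THE X. ?P X)"
  proof (rule theI[of ?P X])
    show "?P X" using X r by simp
    fix Y assume Y: "?P Y"
    show "Y = X"
    proof (rule H.T_eqI)
      show "Y \<in> carrier (HTL n k)" using Y by simp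
      show "X \<in> carrier (HTL n k)" by (rule X(1))
      fix J assume J: "J \<in> subsets_of_card n k"
      show "rval (fp_HT n J) Y = rval (fp_HT n J) X"
        using Y J r[of Y J] X(2)[OF J] by simp
    qed
  qed
  then have "?P (kappa n I)" unfolding kappa_def k_def .
  then show "kappa n I \<in> carrier (HTL n (card I))"
    "J \<in> subsets_of_card n (card I) \<Longrightarrow>
      restr n J (HXL_incl n (card I) (kappa n I)) = W_plus n I lam (z_at J) zz yy"
    by (simp_all add: k_def)
qed

section \<open>The two maps in fixed point coordinates\<close>

lemma restr_kappa:
  assumes I: "I \<subseteq> {1..n}" and J: "J \<subseteq> {1..n}"
  shows "restr n J (HXL_incl n (card I) (kappa n I)) =
    (if card I = card J then W_plus n I lam (z_at J) zz yy else 0)"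
proof (cases "card I = card J")
  case True
  then show ?thesis
    using kappa_props(2)[OF I, of J] subsets_of_card_self[OF J] by simp
next
  case False
  then show ?thesis
    using restr_HXL_incl[OF n card_le_n[OF I] J kappa_props(1)[OF I]] by simp
qed

lemma VL_simps:
  "carrier (VL n) = words n \<rightarrow>\<^sub>E L_set n"
  "u \<oplus>\<^bsub>VL n\<^esub> v = (\<lambda>w\<in>words n. u w + v w)" "c \<odot>\<^bsub>VL n\<^esub> u = (\<lambda>w\<in>words n. c * u w)"
  by (simp_all add: VL_def)

lemma VL_coeff_in: "u \<in> carrier (VL n) \<Longrightarrow> u (word_of n I) \<in> L_set n"
  using word_of_in by (auto simp: VL_simps)

lemma Stab_term_in:
  "u \<in> carrier (VL n) \<Longrightarrow> I \<in> Pow {1..n} \<Longrightarrow>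
    u (word_of n I) \<odot>\<^bsub>HXL n\<^esub> HXL_incl n (card I) (kappa n I) \<in> carrier (HXL n)"
  by (rule X.T_smult_closed[OF VL_coeff_in HXL_incl_in[OF kappa_props(1)]]) auto

lemma Stab_in: "u \<in> carrier (VL n) \<Longrightarrow> Stab n u \<in> carrier (HXL n)"
  unfolding Stab_def by (rule X.T_finsum_closed[OF Stab_term_in])

text \<open>In the coordinates given by restriction, \<open>Stab\<close> is the matrix of the values
  of \<open>W_plus\<close>, with one block for each cardinality.\<close>

lemma restr_Stab:
  assumes u: "u \<in> carrier (VL n)" and J: "J \<subseteq> {1..n}"
  shows "restr n J (Stab n u) =
    (\<Sum>I\<in>subsets_of_card n (card J). u (word_of n I) * W_plus n I lam (z_at J) zz yy)"
proof -
  have "restr n J (Stab n u) =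
      (\<Sum>I\<in>Pow {1..n}. restr n J (u (word_of n I) \<odot>\<^bsub>HXL n\<^esub> HXL_incl n (card I) (kappa n I)))"
    unfolding Stab_def restr_eq_rval
    by (rule X.rval_finsum[OF X.lin finite_Pow_iff[THEN iffD2, OF finite_atLeastAtMost] Stab_term_in[OF u]])
      (use J in auto)
  also have "\<dots> = (\<Sum>I\<in>Pow {1..n}. if I \<in> subsets_of_card n (card J)
      then u (word_of n I) * W_plus n I lam (z_at J) zz yy else 0)"
  proof (rule sum.cong[OF refl])
    fix I assume "I \<in> Pow {1..n}"
    then have I: "I \<subseteq> {1..n}" by simp
    show "restr n J (u (word_of n I) \<odot>\<^bsub>HXL n\<^esub> HXL_incl n (card I) (kappa n I)) =
        (if I \<in> subsets_of_card n (card J) then u (word_of n I) * W_plus n I lam (z_at J) zz yy else 0)"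
      unfolding restr_smult[OF J VL_coeff_in[OF u] HXL_incl_in[OF kappa_props(1)[OF I]]] restr_kappa[OF I J]
      using I by (simp add: subsets_of_card_def)
  qed
  also have "\<dots> = (\<Sum>I\<in>Pow {1..n} \<inter> subsets_of_card n (card J).
      u (word_of n I) * W_plus n I lam (z_at J) zz yy)"
    by (rule sum.inter_restrict[symmetric]) simp
  also have "Pow {1..n} \<inter> subsets_of_card n (card J) = subsets_of_card n (card J)"
    by (auto simp: subsets_of_card_def)
  finally show ?thesis .
qed

text \<open>\<open>Stab\<close> is a finite sum in a quotient module; its linearity is checked after
  restriction to the fixed points, where it is evident from \<open>restr_Stab\<close>.\<close>

lemma Stab_linear: "Stab n \<in> linear_maps (L n) (VL n) (HXL n)"
  unfolding linear_maps_def
proof (intro CollectI conjI ballI Pi_I)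
  fix u assume u: "u \<in> carrier (VL n)"
  show "Stab n u \<in> carrier (HXL n)" by (rule Stab_in[OF u])
  fix v assume v: "v \<in> carrier (VL n)"
  have uv: "u \<oplus>\<^bsub>VL n\<^esub> v \<in> carrier (VL n)"
    using u v by (auto simp: VL_simps intro: L_set_add)
  show "Stab n (u \<oplus>\<^bsub>VL n\<^esub> v) = Stab n u \<oplus>\<^bsub>HXL n\<^esub> Stab n v"
  proof (rule HXL_eqI[OF Stab_in[OF uv] X.T_add_closed[OF Stab_in[OF u] Stab_in[OF v]]])
    fix J assume J: "J \<subseteq> {1..n}"
    show "restr n J (Stab n (u \<oplus>\<^bsub>VL n\<^esub> v)) = restr n J (Stab n u \<oplus>\<^bsub>HXL n\<^esub> Stab n v)"
      unfolding restr_add[OF J Stab_in[OF u] Stab_in[OF v]] restr_Stab[OF u J] restr_Stab[OF v J]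
        restr_Stab[OF uv J] sum.distrib[symmetric]
      by (intro sum.cong refl) (simp add: VL_simps word_of_in distrib_right)
  qed
next
  fix c u assume "c \<in> carrier (L n)" and u: "u \<in> carrier (VL n)"
  then have c: "c \<in> L_set n" by simp
  have cu: "c \<odot>\<^bsub>VL n\<^esub> u \<in> carrier (VL n)"
    using u c by (auto simp: VL_simps intro: L_set_mult)
  show "Stab n (c \<odot>\<^bsub>VL n\<^esub> u) = c \<odot>\<^bsub>HXL n\<^esub> Stab n u"
  proof (rule HXL_eqI[OF Stab_in[OF cu] X.T_smult_closed[OF c Stab_in[OF u]]])
    fix J assume J: "J \<subseteq> {1..n}"
    show "restr n J (Stab n (c \<odot>\<^bsub>VL n\<^esub> u)) = restr n J (c \<odot>\<^bsub>HXL n\<^esub> Stab n u)"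
      unfolding restr_smult[OF J c Stab_in[OF u]] restr_Stab[OF u J] restr_Stab[OF cu J] sum_distrib_left
      by (intro sum.cong refl) (simp add: VL_simps word_of_in mult.assoc)
  qed
qed

lemma Stab_v_basis:
  assumes I: "I \<subseteq> {1..n}"
  shows "Stab n (v_basis n I) = HXL_incl n (card I) (kappa n I)"
proof (rule HXL_eqI[OF Stab_in[OF v_basis_in] HXL_incl_in[OF kappa_props(1)[OF I]]])
  fix J assume J: "J \<subseteq> {1..n}"
  have "restr n J (Stab n (v_basis n I)) =
    (\<Sum>K\<in>subsets_of_card n (card J). if K = I then W_plus n I lam (z_at J) zz yy else 0)"
    unfolding restr_Stab[OF v_basis_in J]
  proof (rule sum.cong[OF refl])
    fix K assume "K \<in> subsets_of_card n (card J)"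
    then have K: "K \<subseteq> {1..n}" by (rule subsets_of_cardD)
    show "v_basis n I (word_of n K) * W_plus n K lam (z_at J) zz yy =
        (if K = I then W_plus n I lam (z_at J) zz yy else 0)"
      using v_basis_eq[OF word_of_in, of n I K] word_of_inj[OF K I] by simp
  qed
  also have "\<dots> = restr n J (HXL_incl n (card I) (kappa n I))"
    unfolding restr_kappa[OF I J] using I by (simp add: finite_subsets_of_card) (simp add: subsets_of_card_def)
  finally show "restr n J (Stab n (v_basis n I)) = restr n J (HXL_incl n (card I) (kappa n I))" .
qed

lemma nu_apply:
  "w \<in> words n \<Longrightarrow> nu n X w = (\<Sum>I\<in>Pow {1..n}. restr n I X / R_fun n I * xi n I w)"
  by (simp only: nu_def restrict_apply' sum_Pow_by_card)

lemma nu_ext: "nu n X \<in> extensional (words n)"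
  by (simp add: nu_def)

lemma nu_in:
  assumes "X \<in> carrier (HXL n)"
  shows "nu n X \<in> carrier (VL n)"
  unfolding VL_simps
proof (rule PiE_I)
  fix w assume w: "w \<in> words n"
  show "nu n X w \<in> L_set n"
    unfolding nu_apply[OF w]
    by (intro L_set_sum L_set_mult L_set_divide restr_in_L[OF _ assms] R_fun_unit xi_in_L[OF _ w]) auto
qed (simp add: nu_def)

lemma nu_linear: "nu n \<in> linear_maps (L n) (HXL n) (VL n)"
  unfolding linear_maps_def
proof (intro CollectI conjI ballI Pi_I)
  fix X assume X: "X \<in> carrier (HXL n)"
  show "nu n X \<in> carrier (VL n)" by (rule nu_in[OF X])
  fix Y assume Y: "Y \<in> carrier (HXL n)"
  show "nu n (X \<oplus>\<^bsub>HXL n\<^esub> Y) = nu n X \<oplus>\<^bsub>VL n\<^esub> nu n Y"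
  proof (rule extensionalityI[OF nu_ext])
    fix w assume w: "w \<in> words n"
    show "nu n (X \<oplus>\<^bsub>HXL n\<^esub> Y) w = (nu n X \<oplus>\<^bsub>VL n\<^esub> nu n Y) w"
      unfolding VL_simps restrict_apply'[OF w] nu_apply[OF w] sum.distrib[symmetric]
      by (intro sum.cong refl) (simp add: restr_add[OF _ X Y] add_divide_distrib distrib_right)
  qed (simp add: VL_simps)
next
  fix c X assume "c \<in> carrier (L n)" and X: "X \<in> carrier (HXL n)"
  then have c: "c \<in> L_set n" by simp
  show "nu n (c \<odot>\<^bsub>HXL n\<^esub> X) = c \<odot>\<^bsub>VL n\<^esub> nu n X"
  proof (rule extensionalityI[OF nu_ext])
    fix w assume w: "w \<in> words n"
    show "nu n (c \<odot>\<^bsub>HXL n\<^esub> X) w = (c \<odot>\<^bsub>VL n\<^esub> nu n X) w"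
      unfolding VL_simps restrict_apply'[OF w] nu_apply[OF w] sum_distrib_left
      by (intro sum.cong refl) (simp add: restr_smult[OF _ c X])
  qed (simp add: VL_simps)
qed

lemma nu_simple:
  assumes k: "k \<le> n" and f: "f \<in> invariants n k" and c: "c \<in> L_set n"
  shows "nu n (HXL_incl n k (HTL_simple n k (coh_class n k f) c)) =
    (\<lambda>w\<in>words n. \<Sum>I \<in> subsets_of_card n k. c * fp_pol n I f / R_fun n I * xi n I w)"
proof (rule extensionalityI[OF nu_ext])
  interpret H: localized n "HT n k" "subsets_of_card n k" "fp_HT n"
    "\<lambda>J. coh_class n k (loc_pol n J)" "R_fun n"
    by (rule HT_localized[OF n k])
  let ?X = "HTL_simple n k (coh_class n k f) c"
  have X: "?X \<in> carrier (HTL n k)"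
    unfolding HTL_simple_def HTL_def using f c by (intro H.cls_in H.chains_intros(5)) (simp_all add: HT_carrier)
  have r: "restr n I (HXL_incl n k ?X) = (if I \<in> subsets_of_card n k then c * fp_pol n I f else 0)"
    if I: "I \<subseteq> {1..n}" for I
  proof (cases "card I = k")
    case True
    then have IS: "I \<in> subsets_of_card n k" using subsets_of_card_self[OF I] by simp
    have "rval (fp_HT n I) ?X = c * fp_pol n I f"
      unfolding HTL_simple_def H.rval_cls[OF H.lin[OF IS]] by (simp add: fp_HT_coh_class[OF IS])
    then show ?thesis using restr_HXL_incl[OF n k I X] True IS by simp
  next
    case False
    then show ?thesis using restr_HXL_incl[OF n k I X] by (simp add: subsets_of_card_def)
  qed
  fix w assume w: "w \<in> words n"
  have "nu n (HXL_incl n k ?X) w = (\<Sum>I\<in>Pow {1..n}. if I \<in> subsets_of_card n k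
      then c * fp_pol n I f / R_fun n I * xi n I w else 0)"
    unfolding nu_apply[OF w] by (intro sum.cong refl) (simp add: r)
  also have "\<dots> = (\<Sum>I\<in>Pow {1..n} \<inter> subsets_of_card n k. c * fp_pol n I f / R_fun n I * xi n I w)"
    by (rule sum.inter_restrict[symmetric]) simp
  also have "Pow {1..n} \<inter> subsets_of_card n k = subsets_of_card n k"
    by (auto simp: subsets_of_card_def)
  finally show "nu n (HXL_incl n k ?X) w =
      (\<lambda>w\<in>words n. \<Sum>I \<in> subsets_of_card n k. c * fp_pol n I f / R_fun n I * xi n I w) w"
    using w by simp
qed simp

text \<open>The sum over all fixed points is cut down to those of the same cardinality, because
  \<open>xi\<close> of another block has no component at this word. What is left is the matrix of
  \<open>W_minus\<close> with the weights \<open>1 / (R * Q)\<close>.\<close>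

lemma nu_word_of:
  assumes K: "K \<subseteq> {1..n}"
  shows "nu n X (word_of n K) = (\<Sum>I\<in>subsets_of_card n (card K).
    restr n I X * (W_minus n K lam (z_at I) zz yy / (R_fun n I * Q_fun n I)))"
proof -
  have "nu n X (word_of n K) = (\<Sum>I\<in>Pow {1..n}. if I \<in> subsets_of_card n (card K)
      then restr n I X * (W_minus n K lam (z_at I) zz yy / (R_fun n I * Q_fun n I)) else 0)"
    unfolding nu_apply[OF word_of_in]
  proof (rule sum.cong[OF refl])
    fix I assume "I \<in> Pow {1..n}"
    then have I: "I \<subseteq> {1..n}" by simp
    show "restr n I X / R_fun n I * xi n I (word_of n K) = (if I \<in> subsets_of_card n (card K)
        then restr n I X * (W_minus n K lam (z_at I) zz yy / (R_fun n I * Q_fun n I)) else 0)"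
      unfolding xi_word_of[OF I K] using I by (auto simp: subsets_of_card_def)
  qed
  also have "\<dots> = (\<Sum>I\<in>Pow {1..n} \<inter> subsets_of_card n (card K).
      restr n I X * (W_minus n K lam (z_at I) zz yy / (R_fun n I * Q_fun n I)))"
    by (rule sum.inter_restrict[symmetric]) simp
  also have "Pow {1..n} \<inter> subsets_of_card n (card K) = subsets_of_card n (card K)"
    by (auto simp: subsets_of_card_def)
  finally show ?thesis .
qed

text \<open>Exchanging the two sums puts the sum over fixed points inside, which is the one in
  \<open>biorthogonality\<close>.\<close>

lemma nu_Stab:
  assumes u: "u \<in> carrier (VL n)"
  shows "nu n (Stab n u) = u"
proof (rule extensionalityI[OF nu_ext])
  show "u \<in> extensional (words n)" using u by (simp add: VL_simps PiE_def)
  fix w assume "w \<in> words n"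
  then obtain K where K: "K \<subseteq> {1..n}" "w = word_of n K" by (auto simp: words_eq)
  define k where "k = card K"
  let ?S = "subsets_of_card n k"
  let ?N = "\<lambda>J I. W_minus n J lam (z_at I) zz yy / (R_fun n I * Q_fun n I)"
  let ?M = "\<lambda>I J. W_plus n J lam (z_at I) zz yy"
  have KS: "K \<in> ?S" using subsets_of_card_self[OF K(1)] by (simp add: k_def)
  have "nu n (Stab n u) w = (\<Sum>I\<in>?S. (\<Sum>J\<in>?S. u (word_of n J) * ?M I J) * ?N K I)"
    unfolding K(2) nu_word_of[OF K(1)] k_def[symmetric]
  proof (rule sum.cong[OF refl])
    fix I assume I: "I \<in> ?S"
    show "restr n I (Stab n u) * ?N K I = (\<Sum>J\<in>?S. u (word_of n J) * ?M I J) * ?N K I"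
      unfolding restr_Stab[OF u subsets_of_cardD(1)[OF I]] subsets_of_cardD(2)[OF I] ..
  qed
  also have "\<dots> = (\<Sum>J\<in>?S. u (word_of n J) * (\<Sum>I\<in>?S. ?N K I * ?M I J))"
    unfolding sum_distrib_left sum_distrib_right
    by (subst sum.swap) (intro sum.cong refl, simp only: mult_ac)
  also have "\<dots> = (\<Sum>J\<in>?S. if J = K then u (word_of n J) else 0)"
  proof (rule sum.cong[OF refl])
    fix J assume J: "J \<in> ?S"
    show "u (word_of n J) * (\<Sum>I\<in>?S. ?N K I * ?M I J) = (if J = K then u (word_of n J) else 0)"
      unfolding biorthogonality[OF KS J] by simp
  qed
  also have "\<dots> = u w"
    using KS K(2) by (simp add: finite_subsets_of_card)
  finally show "nu n (Stab n u) w = u w" .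
qed

text \<open>Tested on restrictions, which separate classes by \<open>HXL_eqI\<close>. Here the
  labels of the weight functions are summed out, so \<open>biorthogonality'\<close> applies.\<close>

lemma Stab_nu:
  assumes X: "X \<in> carrier (HXL n)"
  shows "Stab n (nu n X) = X"
proof (rule HXL_eqI[OF Stab_in[OF nu_in[OF X]] X])
  fix J assume J: "J \<subseteq> {1..n}"
  define k where "k = card J"
  let ?S = "subsets_of_card n k"
  let ?N = "\<lambda>J I. W_minus n J lam (z_at I) zz yy / (R_fun n I * Q_fun n I)"
  let ?M = "\<lambda>I J. W_plus n J lam (z_at I) zz yy"
  have JS: "J \<in> ?S" using subsets_of_card_self[OF J] by (simp add: k_def)
  have "restr n J (Stab n (nu n X)) = (\<Sum>K\<in>?S. (\<Sum>I\<in>?S. restr n I X * ?N K I) * ?M J K)"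
    unfolding restr_Stab[OF nu_in[OF X] J] k_def[symmetric]
  proof (rule sum.cong[OF refl])
    fix K assume K: "K \<in> ?S"
    show "nu n X (word_of n K) * ?M J K = (\<Sum>I\<in>?S. restr n I X * ?N K I) * ?M J K"
      unfolding nu_word_of[OF subsets_of_cardD(1)[OF K]] subsets_of_cardD(2)[OF K] ..
  qed
  also have "\<dots> = (\<Sum>I\<in>?S. restr n I X * (\<Sum>K\<in>?S. ?M J K * ?N K I))"
    unfolding sum_distrib_left sum_distrib_right
    by (subst sum.swap) (intro sum.cong refl, simp only: mult_ac)
  also have "\<dots> = (\<Sum>I\<in>?S. if I = J then restr n I X else 0)"
  proof (rule sum.cong[OF refl])
    fix I assume I: "I \<in> ?S"
    show "restr n I X * (\<Sum>K\<in>?S. ?M J K * ?N K I) = (if I = J then restr n I X else 0)"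
      unfolding biorthogonality'[OF JS I] by simp
  qed
  also have "\<dots> = restr n J X"
    using JS by (simp add: finite_subsets_of_card)
  finally show "restr n J (Stab n (nu n X)) = restr n J X" .
qed

end

text \<open>Since \<open>kappa\<close>, \<open>Stab\<close> and \<open>nu\<close> are defined by
  formulas that make sense for any argument, the statement also certifies that they are the intended
  objects: existence of the classes, linearity, and the prescribed values on basis vectors and
  simple tensors accompany the two inverse identities.\<close>

theorem theorem8p1:
  fixes n :: nat
  assumes "n \<ge> 1"
  shows
    "(\<forall>I \<subseteq> {1..n}.
        kappa n I \<in> carrier (HTL n (card I)) \<and>
        (\<forall>J \<in> subsets_of_card n (card I).
           restr n J (HXL_incl n (card I) (kappa n I)) = W_plus n I lam (z_at J) zz yy)) \<and>
     Stab n \<in> linear_maps (L n) (VL n) (HXL n) \<and>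
     (\<forall>I \<subseteq> {1..n}. Stab n (v_basis n I) = HXL_incl n (card I) (kappa n I)) \<and>
     nu n \<in> linear_maps (L n) (HXL n) (VL n) \<and>
     (\<forall>k \<le> n. \<forall>f \<in> invariants n k. \<forall>c \<in> carrier (L n).
        nu n (HXL_incl n k (HTL_simple n k (coh_class n k f) c)) =
        (\<lambda>w\<in>words n. \<Sum>I \<in> subsets_of_card n k.
           c * fp_pol n I f / R_fun n I * xi n I w)) \<and>
     (\<forall>u \<in> carrier (VL n). nu n (Stab n u) = u) \<and>
     (\<forall>X \<in> carrier (HXL n). Stab n (nu n X) = X)"
proof (intro conjI allI impI ballI)
  fix I assume I: "I \<subseteq> {1..n}"
  show "kappa n I \<in> carrier (HTL n (card I))"
    by (rule kappa_props(1)[OF assms I])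
  show "Stab n (v_basis n I) = HXL_incl n (card I) (kappa n I)"
    by (rule Stab_v_basis[OF assms I])
  fix J assume "J \<in> subsets_of_card n (card I)"
  then show "restr n J (HXL_incl n (card I) (kappa n I)) = W_plus n I lam (z_at J) zz yy"
    by (rule kappa_props(2)[OF assms I])
next
  fix k f c assume "k \<le> n" "f \<in> invariants n k" "c \<in> carrier (L n)"
  then show "nu n (HXL_incl n k (HTL_simple n k (coh_class n k f) c)) =
      (\<lambda>w\<in>words n. \<Sum>I \<in> subsets_of_card n k. c * fp_pol n I f / R_fun n I * xi n I w)"
    by (intro nu_simple[OF assms]) simp_all
qed (rule Stab_linear[OF assms] nu_linear[OF assms] nu_Stab[OF assms] Stab_nu[OF assms]; assumption)+

end
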